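(* Let $n=1$. The sequence space $d_\Delta$ is dense in $\mathcal{C}_{b,u}(\mathbb{N}_0,\rho)$ with respect to the supremum norm, i.e. $\mathcal{C}_{b,u}(\mathbb{N}_0,\rho)=\overline{d_\Delta}$. Moreover, the radial Toeplitz algebra $\mathfrak{T}_{rad}(L^\infty)$ over $\mathcal{F}^2(\mathbb{C})$ is isomorphic to $\mathcal{C}_{b,u}(\mathbb{N}_0,\rho)$.
   Context: $\mathcal{F}^2(\mathbb{C})$ is the Fock space of entire functions on $\mathbb{C}$ that are square integrable with respect to $e^{-\pi|z|^2}dz$. Its normalized kernels are $k_z(w)=e^{\pi\bar z w-\pi|z|^2/2}$ and its orthonormal basis is $e_m(z)=\sqrt{\pi^m/m!}\,z^m$ for $m\in\mathbb{N}_0$. $B(S)(z)=\langle Sk_z,k_z\rangle$ is the Berezin transform and $\Delta=\partial_z\partial_{\bar z}$. $\mathcal{W}^{2,\infty}(\mathcal{F}^2)$ is the set of bounded operators $S$ such that $\Delta B(S)=B(T)$ for some bounded operator $T$. An operator $S$ is radial if it commutes with every operator $f(z)\mapsto f(A^{-1}z)$ for $A$ unimodular. Radial operators are diagonal in the basis $(e_m)$. $\Gamma(S)=(\lambda_m)_{m\in\mathbb{N}_0}$ denotes the eigenvalue sequence of a radial $S$, so that $Se_m=\lambda_me_m$. $d_\Delta$ is the set of all $\Gamma(S)$ with $S$ radial and $S\in\mathcal{W}^{2,\infty}(\mathcal{F}^2)$. The Toeplitz operator with symbol $a$ is $T_af=P(af)$, where $P$ is the orthogonal projection of $L^2(e^{-\pi|z|^2}dz)$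 onto $\mathcal{F}^2$. $\mathfrak{T}_{rad}(L^\infty)$ is the $C^*$-algebra generated by all $T_a$ with $a\in L^\infty$ radial, i.e. depending only on $|z|$. $\rho(m_1,m_2)=|\sqrt{m_1}-\sqrt{m_2}|$ on $\mathbb{N}_0$. $\mathcal{C}_{b,u}(\mathbb{N}_0,\rho)$ is the $C^*$-algebra of bounded sequences on $\mathbb{N}_0$ that are uniformly continuous with respect to $\rho$, with the supremum norm. *)

theory Defs
  imports "HOL-Analysis.Analysis"
begin

definition fock_weight :: "complex \<Rightarrow> real" where
  "fock_weight z = exp (- pi * (cmod z)\<^sup>2)"

definition fock :: "(complex \<Rightarrow> complex) set" where
  "fock = {f. f holomorphic_on UNIV \<and>
              integrable lborel (\<lambda>z. (cmod (f z))\<^sup>2 * fock_weight z)}"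

definition finner :: "(complex \<Rightarrow> complex) \<Rightarrow> (complex \<Rightarrow> complex) \<Rightarrow> complex" where
  "finner f g = integral\<^sup>L lborel (\<lambda>z. f z * cnj (g z) * complex_of_real (fock_weight z))"

definition fnorm :: "(complex \<Rightarrow> complex) \<Rightarrow> real" where
  "fnorm f = sqrt (integral\<^sup>L lborel (\<lambda>z. (cmod (f z))\<^sup>2 * fock_weight z))"

text \<open>Normalized reproducing kernels and orthonormal basis\<close>
definition kz :: "complex \<Rightarrow> complex \<Rightarrow> complex" where
  "kz z = (\<lambda>w. exp (complex_of_real pi * cnj z * w - complex_of_real (pi * (cmod z)\<^sup>2 / 2)))"

definition ebasis :: "nat \<Rightarrow> complex \<Rightarrow> complex" where
  "ebasis m = (\<lambda>z. complex_of_real (sqrt (pi ^ m / fact m)) * z ^ m)"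

text \<open>Bounded operators on F^2. Convention: an operator is a map on all functions which
  sends F^2 into F^2, is linear and bounded there, and is 0 outside F^2 (this normalisation
  makes operators correspond one-to-one to HOL functions).\<close>
definition bops :: "((complex \<Rightarrow> complex) \<Rightarrow> (complex \<Rightarrow> complex)) set" where
  "bops = {S. (\<forall>f\<in>fock. S f \<in> fock)
            \<and> (\<forall>f\<in>fock. \<forall>g\<in>fock. S (\<lambda>z. f z + g z) = (\<lambda>z. S f z + S g z))
            \<and> (\<forall>f\<in>fock. \<forall>c. S (\<lambda>z. c * f z) = (\<lambda>z. c * S f z))
            \<and> (\<exists>C. \<forall>f\<in>fock. fnorm (S f) \<le> C * fnorm f)
            \<and> (\<forall>f. f \<notin> fock \<longrightarrow> S f = (\<lambda>_. 0))}"

definition berezin :: "((complex \<Rightarrow> complex) \<Rightarrow> (complex \<Rightarrow> complex)) \<Rightarrow> complex \<Rightarrow> complex" where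
  "berezin S z = finner (S (kz z)) (kz z)"

text \<open>Real directional derivative and Laplacian Delta = d_z d_zbar = (d_x^2 + d_y^2)/4\<close>
definition dpart :: "complex \<Rightarrow> (complex \<Rightarrow> complex) \<Rightarrow> complex \<Rightarrow> complex" where
  "dpart v f z = vector_derivative (\<lambda>t::real. f (z + complex_of_real t * v)) (at 0)"

definition laplace :: "(complex \<Rightarrow> complex) \<Rightarrow> complex \<Rightarrow> complex" where
  "laplace f z = (dpart 1 (dpart 1 f) z + dpart \<i> (dpart \<i> f) z) / 4"

definition W2inf :: "((complex \<Rightarrow> complex) \<Rightarrow> (complex \<Rightarrow> complex)) set" where
  "W2inf = {S. S \<in> bops \<and> (\<exists>T\<in>bops. \<forall>z. laplace (berezin S) z = berezin T z)}"

definition radial_op :: "((complex \<Rightarrow> complex) \<Rightarrow> (complex \<Rightarrow> complex)) \<Rightarrow> bool" where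
  "radial_op S \<longleftrightarrow> (\<forall>u. cmod u = 1 \<longrightarrow>
      (\<forall>f\<in>fock. S (\<lambda>z. f (inverse u * z)) = (\<lambda>z. S f (inverse u * z))))"

text \<open>Eigenvalue sequence of a (diagonal) radial operator: S e_m = lambda_m e_m\<close>
definition Gamma_op :: "((complex \<Rightarrow> complex) \<Rightarrow> (complex \<Rightarrow> complex)) \<Rightarrow> nat \<Rightarrow> complex" where
  "Gamma_op S m = finner (S (ebasis m)) (ebasis m)"

definition d_Delta :: "(nat \<Rightarrow> complex) set" where
  "d_Delta = {Gamma_op S | S. S \<in> bops \<and> radial_op S \<and> S \<in> W2inf}"

definition Cbu :: "(nat \<Rightarrow> complex) set" where
  "Cbu = {x. bounded (range x) \<and>
             (\<forall>\<epsilon>>0. \<exists>\<delta>>0. \<forall>m1 m2. \<bar>sqrt (real m1) - sqrt (real m2)\<bar> < \<delta>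
                 \<longrightarrow> cmod (x m1 - x m2) < \<epsilon>)}"

definition fock_proj :: "(complex \<Rightarrow> complex) \<Rightarrow> (complex \<Rightarrow> complex)" where
  "fock_proj g = (THE h. h \<in> fock \<and> (\<forall>k\<in>fock. finner (\<lambda>z. g z - h z) k = 0))"

definition toeplitz :: "(complex \<Rightarrow> complex) \<Rightarrow> (complex \<Rightarrow> complex) \<Rightarrow> (complex \<Rightarrow> complex)" where
  "toeplitz a f = (if f \<in> fock then fock_proj (\<lambda>z. a z * f z) else (\<lambda>_. 0))"

definition radial_Linf :: "(complex \<Rightarrow> complex) set" where
  "radial_Linf = {a. a \<in> borel_measurable lborel \<and> (\<exists>C. AE z in lborel. cmod (a z) \<le> C)
                     \<and> (\<exists>a0. \<forall>z. a z = a0 (cmod z))}"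

definition op_add where "op_add S T = (\<lambda>f z. S f z + T f z)"
definition op_scale where "op_scale c S = (\<lambda>f z. c * S f z)"
definition op_comp where "op_comp S T = (\<lambda>f. S (T f))"

definition is_adjoint where
  "is_adjoint S T \<longleftrightarrow> (\<forall>f\<in>fock. \<forall>g\<in>fock. finner (S f) g = finner f (T g))"

definition cstar_closed :: "((complex \<Rightarrow> complex) \<Rightarrow> (complex \<Rightarrow> complex)) set \<Rightarrow> bool" where
  "cstar_closed A \<longleftrightarrow> A \<subseteq> bops
     \<and> (\<forall>S\<in>A. \<forall>T\<in>A. op_add S T \<in> A \<and> op_comp S T \<in> A)
     \<and> (\<forall>S\<in>A. \<forall>c. op_scale c S \<in> A)
     \<and> (\<forall>S\<in>A. \<exists>T\<in>A. is_adjoint S T)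
     \<and> (\<forall>S\<in>bops. (\<forall>\<epsilon>>0. \<exists>T\<in>A. \<forall>f\<in>fock. fnorm (\<lambda>z. S f z - T f z) \<le> \<epsilon> * fnorm f)
              \<longrightarrow> S \<in> A)"

definition T_rad :: "((complex \<Rightarrow> complex) \<Rightarrow> (complex \<Rightarrow> complex)) set" where
  "T_rad = \<Inter>{A. toeplitz ` radial_Linf \<subseteq> A \<and> cstar_closed A}"

definition star_iso :: "(((complex \<Rightarrow> complex) \<Rightarrow> (complex \<Rightarrow> complex)) \<Rightarrow> nat \<Rightarrow> complex) \<Rightarrow> bool" where
  "star_iso \<Phi> \<longleftrightarrow> bij_betw \<Phi> T_rad Cbu
     \<and> (\<forall>S\<in>T_rad. \<forall>T\<in>T_rad. \<Phi> (op_add S T) = (\<lambda>m. \<Phi> S m + \<Phi> T m)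
                            \<and> \<Phi> (op_comp S T) = (\<lambda>m. \<Phi> S m * \<Phi> T m)
                            \<and> (is_adjoint S T \<longrightarrow> \<Phi> T = (\<lambda>m. cnj (\<Phi> S m))))
     \<and> (\<forall>S\<in>T_rad. \<forall>c. \<Phi> (op_scale c S) = (\<lambda>m. c * \<Phi> S m))"

end

theory Submission
  imports Defs "HOL-Probability.Probability" "HOL-Complex_Analysis.Complex_Analysis"
begin

text \<open>
  For a radial operator with eigenvalues \<open>x\<close>, applying \<open>\<Delta>\<close> to the Berezin transform turns \<open>x\<close>
  into \<open>\<pi>\<close> times \<open>(m + 1) (x (m + 1) - x m) - m (x m - x (m - 1))\<close>, so \<open>d_Delta\<close> consists of the bounded
  sequences for which this expression is bounded. Such sequences satisfy \<open>x (m + 1) - x m = O(1 / \<surd>m)\<close>.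
  Hence they are Lipschitz for the square-root metric, and the product rule for the second difference shows that
  they form an algebra. They include the eigenvalue sequences of radial Toeplitz operators, which are
  the averages \<open>E\<^sub>m a\<close> of a bounded function \<open>a\<close> on the half-line against the Gamma density \<open>t ^ m * exp (- t) / m!\<close>.

  Both claims therefore reduce to one: a uniformly closed \<open>*\<close>-algebra of sequences that contains all
  averages \<open>E\<^sub>m a\<close> contains \<open>Cbu\<close>. The variable \<open>\<surd>t\<close> has mean \<open>\<theta> m\<close>, which grows like \<open>\<surd>m\<close>, and variance at most
  one under \<open>E\<^sub>m\<close>. Therefore the \<open>n\<close>-th powers of \<open>E\<^sub>m (exp (\<i> c \<surd>t / n))\<close> converge uniformly to \<open>exp (\<i> c \<theta> m)\<close>,
  and the algebra contains every continuous function of \<open>exp (\<i> c \<theta> m)\<close>. A partition of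
  unity on the circle cuts the half-line into families of short intervals that are periodic with the large period \<open>2 \<pi> / c\<close>.
  On one family a uniformly continuous sequence is almost constant on each interval, and since these
  intervals are far apart compared with the variance, \<open>E\<^sub>m a\<close> for a step function \<open>a\<close> approximates it there.
\<close>

section \<open>Sequences with bounded radial Laplacian\<close>

text \<open>The Gamma law of index m has spread of order one in the coordinate
  \<open>\<surd>t\<close>, uniformly in m, so averaging blurs all detail below unit scale. Finer
  detail is recovered by multiplication: a frequency c is split into n slow factors, each averaged
  with error O(1 / n^2), so that the product is off by O(1 / n) only. Two independent scales then
  enter the approximation: the width of the intervals is dictated by the modulus of continuity of
  the sequence, the period between them by the Gamma spread. Location comes from functions on the
  circle, values from averages of step functions. In \<open>d_Delta\<close> the operator T with
  \<Delta> B(S) = B(T) is an arbitrary bounded one. Only its Berezin transform is known to be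
  radial, and rotation averaging shows that the diagonal of T already produces this transform.
  Uniqueness of power series coefficients then identifies this diagonal with \<pi>
  \<open>Lop x\<close>, which gives the bound on \<open>Lop x\<close>. On the operator side
  everything is read in coefficients with respect to \<open>ebasis\<close>, which rests on Parseval
  and on one fact about the plane: \<pi> |z|^2 carries Lebesgue measure to Lebesgue measure on the
  half-line.\<close>

definition Lop :: "(nat \<Rightarrow> complex) \<Rightarrow> nat \<Rightarrow> complex" where
  "Lop x m = of_nat (Suc m) * (x (Suc m) - x m) - of_nat m * (x m - x (m - 1))"

definition Wseq :: "(nat \<Rightarrow> complex) set" where
  "Wseq = {x. bounded (range x) \<and> bounded (range (Lop x))}"

lemma bounded_rangeE:
  fixes x :: "'a \<Rightarrow> complex"
  assumes "bounded (range x)"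
  obtains B where "B > 0" "\<And>m. cmod (x m) \<le> B"
  using assms unfolding bounded_pos by auto

lemma bounded_rangeI:
  fixes x :: "'a \<Rightarrow> complex"
  assumes "\<And>m. cmod (x m) \<le> B"
  shows "bounded (range x)"
  using assms unfolding bounded_iff by auto

text \<open>A discrete Landau inequality: bounds on a function and on its second difference control
  the first difference. The weights in \<open>Lop\<close> make \<open>\<surd>m\<close> the right
  window length.\<close>

lemma Wseq_diff_bound:
  assumes "x \<in> Wseq"
  obtains K where "K > 0" "\<And>m. cmod (x (Suc m) - x m) \<le> K / sqrt (real (Suc m))"
proof -
  obtain B where B: "B > 0" "\<And>m. cmod (x m) \<le> B"
    using assms bounded_rangeE unfolding Wseq_def by blast
  obtain C where C: "C > 0" "\<And>m. cmod (Lop x m) \<le> C"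
    using assms bounded_rangeE unfolding Wseq_def by blast
  \<comment> \<open>The factor m hides the truncated predecessor at m = 0, so \<open>Lop x k\<close>
    is exactly the increment of \<open>a\<close> for every k.\<close>
  define a where "a m = of_nat m * (x m - x (m - 1))" for m
  have astep: "a (Suc k) - a k = Lop x k" for k
    by (simp add: a_def Lop_def)
  have adiff: "cmod (a (m + j) - a m) \<le> C * real j" for m j
  proof (induction j)
    case (Suc j)
    have "a (m + Suc j) - a m = Lop x (m + j) + (a (m + j) - a m)"
      using astep[of "m + j", symmetric] by simp
    then have "cmod (a (m + Suc j) - a m) \<le> cmod (Lop x (m + j)) + cmod (a (m + j) - a m)"
      by (metis norm_triangle_ineq)
    also have "\<dots> \<le> C + C * real j" using C(2)[of "m+j"] Suc by linarith
    finally show ?case by (simp add: algebra_simps)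
  qed simp
  \<comment> \<open>The factor 4 collects two halvings: the weights 1 / (m + i) are at least 1 / (2
    m) on the window, and \<open>sqrt m\<close> is at most twice its floor.\<close>
  define K where "K = 4 * (2 * B + C)"
  have abound: "cmod (a m) \<le> K * sqrt (real m)" if m: "m \<ge> 1" for m
  proof -
    define h where "h = nat \<lfloor>sqrt (real m)\<rfloor>"
    have s1: "sqrt (real m) \<ge> 1" using m by simp
    have h1: "real h \<le> sqrt (real m)" "sqrt (real m) < real h + 1" "h \<ge> 1"
      unfolding h_def using s1 by (auto simp: le_nat_iff)
    have hh: "real h * real h \<le> real m"
      using mult_mono[OF h1(1) h1(1)] by simp
    have h2: "sqrt (real m) \<le> 2 * real h" using h1 by linarith
    have hm: "real h \<le> real m" using hh by (metis le_square of_nat_le_iff of_nat_mult order_trans)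
    have "x (m + j) - x m = (\<Sum>i<j. a (m + Suc i) / of_nat (m + Suc i))" for j
    proof (induction j)
      case (Suc j)
      have "of_nat (m + Suc j) \<noteq> (0::complex)" unfolding of_nat_eq_0_iff by simp
      then have "a (m + Suc j) / of_nat (m + Suc j) = x (m + Suc j) - x (m + j)"
        unfolding a_def by simp
      then have "x (m + Suc j) - x m = (x (m + j) - x m) + a (m + Suc j) / of_nat (m + Suc j)"
        by (simp del: add_Suc_right of_nat_add)
      then show ?case unfolding Suc sum.lessThan_Suc .
    qed simp
    then have eq: "x (m + h) - x m = (\<Sum>i<h. a m / of_nat (m + Suc i)) + (\<Sum>i<h. (a (m + Suc i) - a m) / of_nat (m + Suc i))"
      by (simp add: sum.distrib[symmetric] add_divide_distrib[symmetric])
    have "(\<Sum>i<h. a m / of_nat (m + Suc i)) = a m * of_real (\<Sum>i<h. 1 / real (m + Suc i))"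
      by (simp add: sum_distrib_left)
    moreover have S: "(\<Sum>i<h. 1 / real (m + Suc i)) \<ge> real h * (1 / (2 * real m))"
    proof -
      have "(\<Sum>i<h. 1 / (2 * real m)) \<le> (\<Sum>i<h. 1 / real (m + Suc i))"
        using hm m by (intro sum_mono divide_left_mono) auto
      then show ?thesis by simp
    qed
    ultimately have c1: "cmod (\<Sum>i<h. a m / of_nat (m + Suc i)) \<ge> cmod (a m) * (real h * (1 / (2 * real m)))"
      by (simp only: norm_mult norm_of_real) (intro mult_left_mono, auto)
    have "cmod (\<Sum>i<h. (a (m + Suc i) - a m) / of_nat (m + Suc i)) \<le> (\<Sum>i<h. C * real h / real m)"
    proof (rule sum_norm_le)
      fix i assume "i \<in> {..<h}"
      then have i: "Suc i \<le> h" by auto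
      have "cmod (a (m + Suc i) - a m) \<le> C * real h"
        using order.trans[OF adiff[of m "Suc i"] mult_left_mono[of "real (Suc i)" "real h" C]] i C(1) by simp
      then have "cmod (a (m + Suc i) - a m) / real (m + Suc i) \<le> C * real h / real m"
        using m C(1) by (intro frac_le) auto
      then show "cmod ((a (m + Suc i) - a m) / of_nat (m + Suc i)) \<le> C * real h / real m"
        by (simp only: norm_divide norm_of_nat)
    qed
    also have "\<dots> = C * (real h * real h / real m)" by simp
    also have "\<dots> \<le> C * 1" using hh m C(1) by (intro mult_left_mono) auto
    finally have c2: "cmod (\<Sum>i<h. (a (m + Suc i) - a m) / of_nat (m + Suc i)) \<le> C" by simp
    have "cmod (\<Sum>i<h. a m / of_nat (m + Suc i)) \<le> cmod (x (m + h) - x m) + C"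
      using norm_triangle_ineq4[of "x (m + h) - x m" "\<Sum>i<h. (a (m + Suc i) - a m) / of_nat (m + Suc i)"] c2
      unfolding eq by simp
    also have "\<dots> \<le> 2 * B + C"
      using norm_triangle_ineq4[of "x (m+h)" "x m"] B(2)[of m] B(2)[of "m+h"] by linarith
    finally have "cmod (a m) * (real h * (1 / (2 * real m))) \<le> 2 * B + C" using c1 by linarith
    then have "cmod (a m) * real h \<le> (2 * B + C) * (2 * real m)"
      using m by (simp add: field_simps)
    also have "\<dots> \<le> (2 * B + C) * (4 * (sqrt (real m) * real h))"
      using h2 B C s1 mult_left_mono[OF h2, of "sqrt (real m)"]
      by (intro mult_left_mono) (auto simp: mult_ac)
    finally have "cmod (a m) * real h \<le> K * sqrt (real m) * real h"
      by (simp add: K_def algebra_simps)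
    then show ?thesis using h1(3) by simp
  qed
  show ?thesis
  proof
    show "K > 0" using B C by (simp add: K_def)
    fix m
    have "real (Suc m) * cmod (x (Suc m) - x m) = cmod (a (Suc m))"
      unfolding a_def norm_mult norm_of_nat by simp
    also have "\<dots> \<le> K * sqrt (real (Suc m))" by (rule abound) simp
    finally have *: "real (Suc m) * cmod (x (Suc m) - x m) \<le> K * sqrt (real (Suc m))" .
    have "sqrt (real (Suc m)) * (sqrt (real (Suc m)) * cmod (x (Suc m) - x m)) \<le> sqrt (real (Suc m)) * K"
      using * by (simp add: mult.assoc[symmetric] mult.commute del: of_nat_Suc)
    then have "sqrt (real (Suc m)) * cmod (x (Suc m) - x m) \<le> K"
      by (rule mult_left_le_imp_le) simp
    then show "cmod (x (Suc m) - x m) \<le> K / sqrt (real (Suc m))"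
      by (simp add: field_simps del: of_nat_Suc)
  qed
qed

lemma sqrt_Suc_diff: "1 / (2 * sqrt (real (Suc k))) \<le> sqrt (real (Suc k)) - sqrt (real k)"
proof -
  have "(sqrt (real (Suc k)) - sqrt (real k)) * (sqrt (real (Suc k)) + sqrt (real k)) = 1"
    by (simp add: algebra_simps)
  moreover have "sqrt (real (Suc k)) + sqrt (real k) \<le> 2 * sqrt (real (Suc k))" by simp
  moreover have "sqrt (real (Suc k)) - sqrt (real k) \<ge> 0" by simp
  ultimately have "1 \<le> (sqrt (real (Suc k)) - sqrt (real k)) * (2 * sqrt (real (Suc k)))"
    by (metis mult_left_mono)
  then show ?thesis by (simp add: divide_le_eq del: of_nat_Suc)
qed

text \<open>An increment of size K / sqrt (m + 1) is at most 2 K times the increment of the square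
  root, and this comparison telescopes.\<close>

lemma Wseq_subset_Cbu: "Wseq \<subseteq> Cbu"
proof
  fix x assume x: "x \<in> Wseq"
  then obtain K where K: "K > 0" "\<And>m. cmod (x (Suc m) - x m) \<le> K / sqrt (real (Suc m))"
    using Wseq_diff_bound by metis
  have le: "cmod (x (n + j) - x n) \<le> 2 * K * (sqrt (real (n + j)) - sqrt (real n))" for n j
  proof (induction j)
    case (Suc j)
    have "cmod (x (n + Suc j) - x n) \<le> cmod (x (Suc (n + j)) - x (n + j)) + cmod (x (n + j) - x n)"
      using norm_triangle_ineq[of "x (Suc (n + j)) - x (n + j)" "x (n + j) - x n"] by simp
    also have "\<dots> \<le> 2 * K * (1 / (2 * sqrt (real (Suc (n+j))))) + cmod (x (n + j) - x n)"
      using K(2)[of "n+j"] by simp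
    also have "\<dots> \<le> 2 * K * (sqrt (real (Suc (n+j))) - sqrt (real (n+j))) + 2 * K * (sqrt (real (n + j)) - sqrt (real n))"
      using K(1) by (intro add_mono mult_left_mono Suc sqrt_Suc_diff) auto
    finally show ?case by (simp add: algebra_simps)
  qed simp
  have abs: "cmod (x m - x n) \<le> 2 * K * \<bar>sqrt (real m) - sqrt (real n)\<bar>" for m n
  proof (cases "n \<le> m")
    case True
    then show ?thesis using le[of n "m - n"] by simp
  next
    case False
    then show ?thesis using le[of m "n - m"] by (simp add: norm_minus_commute)
  qed
  show "x \<in> Cbu"
    unfolding Cbu_def
  proof (intro CollectI conjI allI impI)
    show "bounded (range x)" using x by (simp add: Wseq_def)
    fix \<epsilon> :: real assume e: "\<epsilon> > 0"
    show "\<exists>\<delta>>0. \<forall>m1 m2. \<bar>sqrt (real m1) - sqrt (real m2)\<bar> < \<delta> \<longrightarrow> cmod (x m1 - x m2) < \<epsilon>"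
    proof (intro exI[of _ "\<epsilon> / (2 * K)"] conjI allI impI)
      fix m n assume "\<bar>sqrt (real m) - sqrt (real n)\<bar> < \<epsilon> / (2 * K)"
      then have "2 * K * \<bar>sqrt (real m) - sqrt (real n)\<bar> < \<epsilon>"
        using K(1) by (simp add: field_simps)
      then show "cmod (x m - x n) < \<epsilon>" using abs[of m n] by linarith
    qed (use e K in auto)
  qed
qed

lemma Wseq_add: "x \<in> Wseq \<Longrightarrow> y \<in> Wseq \<Longrightarrow> (\<lambda>m. x m + y m) \<in> Wseq"
proof -
  assume "x \<in> Wseq" "y \<in> Wseq"
  moreover have "Lop (\<lambda>m. x m + y m) = (\<lambda>m. Lop x m + Lop y m)"
    by (auto simp: Lop_def algebra_simps)
  ultimately show ?thesis
    unfolding Wseq_def using bounded_plus_comp[of x UNIV y] bounded_plus_comp[of "Lop x" UNIV "Lop y"] by auto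
qed

lemma Wseq_scale: assumes "x \<in> Wseq" shows "(\<lambda>m. c * x m) \<in> Wseq"
proof -
  obtain B where B: "B > 0" "\<And>m. cmod (x m) \<le> B"
    using assms bounded_rangeE unfolding Wseq_def by blast
  obtain C where C: "C > 0" "\<And>m. cmod (Lop x m) \<le> C"
    using assms bounded_rangeE unfolding Wseq_def by blast
  have "Lop (\<lambda>m. c * x m) = (\<lambda>m. c * Lop x m)"
    by (auto simp: Lop_def algebra_simps)
  then show ?thesis
    unfolding Wseq_def
    using bounded_rangeI[of "\<lambda>m. c * x m" "cmod c * B"] bounded_rangeI[of "\<lambda>m. c * Lop x m" "cmod c * C"]
    by (simp add: norm_mult mult_left_mono B C)
qed

lemma Wseq_cnj: assumes "x \<in> Wseq" shows "(\<lambda>m. cnj (x m)) \<in> Wseq"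
proof -
  have "Lop (\<lambda>m. cnj (x m)) = (\<lambda>m. cnj (Lop x m))"
    by (auto simp: Lop_def algebra_simps)
  then show ?thesis
    using assms unfolding Wseq_def bounded_iff by auto
qed

lemma Wseq_mult: assumes "x \<in> Wseq" "y \<in> Wseq" shows "(\<lambda>m. x m * y m) \<in> Wseq"
proof -
  obtain B where B: "B > 0" "\<And>m. cmod (x m) \<le> B"
    using assms(1) bounded_rangeE unfolding Wseq_def by blast
  obtain C where C: "C > 0" "\<And>m. cmod (Lop x m) \<le> C"
    using assms(1) bounded_rangeE unfolding Wseq_def by blast
  obtain B' where B': "B' > 0" "\<And>m. cmod (y m) \<le> B'"
    using assms(2) bounded_rangeE unfolding Wseq_def by blast
  obtain C' where C': "C' > 0" "\<And>m. cmod (Lop y m) \<le> C'"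
    using assms(2) bounded_rangeE unfolding Wseq_def by blast
  obtain K where K: "K > 0" "\<And>m. cmod (x (Suc m) - x m) \<le> K / sqrt (real (Suc m))"
    using Wseq_diff_bound[OF assms(1)] by metis
  obtain K' where K': "K' > 0" "\<And>m. cmod (y (Suc m) - y m) \<le> K' / sqrt (real (Suc m))"
    using Wseq_diff_bound[OF assms(2)] by metis
  \<comment> \<open>Cross term of the product rule: the weight m + 1 against two increments of order
    1 / sqrt (m + 1), hence bounded. \<open>D'\<close> below is the same term one index earlier,
    vanishing at 0.\<close>
  define D where "D m = of_nat (Suc m) * ((x (Suc m) - x m) * (y (Suc m) - y m))" for m
  have D: "cmod (D m) \<le> K * K'" for m
  proof -
    have "cmod (D m) \<le> real (Suc m) * (K / sqrt (real (Suc m)) * (K' / sqrt (real (Suc m))))"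
      unfolding D_def norm_mult norm_of_nat using K K' by (intro mult_left_mono mult_mono) auto
    also have "\<dots> = K * K'" by (simp del: of_nat_Suc)
    finally show ?thesis .
  qed
  define D' where "D' m = of_nat m * ((x m - x (m - 1)) * (y m - y (m - 1)))" for m
  have D': "cmod (D' m) \<le> K * K'" for m
  proof (cases m)
    case 0 then show ?thesis using K K' by (simp add: D'_def)
  next
    case (Suc k) then show ?thesis using D[of k] by (simp add: D'_def D_def)
  qed
  have L: "Lop (\<lambda>m. x m * y m) m = x m * Lop y m + y m * Lop x m + D m + D' m" for m
    unfolding Lop_def D_def D'_def by (simp add: algebra_simps)
  show ?thesis
    unfolding Wseq_def
  proof (intro CollectI conjI)
    show "bounded (range (\<lambda>m. x m * y m))"
      using B B' by (intro bounded_rangeI[of _ "B * B'"]) (auto simp: norm_mult intro!: mult_mono)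
    show "bounded (range (Lop (\<lambda>m. x m * y m)))"
    proof (rule bounded_rangeI)
      fix m
      have "cmod (x m * Lop y m) \<le> B * C'" "cmod (y m * Lop x m) \<le> B' * C"
        using B B' C C' by (auto simp: norm_mult intro!: mult_mono)
      then show "cmod (Lop (\<lambda>m. x m * y m) m) \<le> B * C' + B' * C + K * K' + K * K'"
        unfolding L using D[of m] D'[of m]
        by (intro order.trans[OF norm_triangle_ineq] add_mono) auto
    qed
  qed
qed

section \<open>Gamma averages\<close>

text \<open>\<open>erlang_density m 1\<close> is t^m exp (-t) / m!, of shape m + 1; mean and
  variance are therefore both m + 1, not m.\<close>

definition gmeas :: "nat \<Rightarrow> real measure" where
  "gmeas m = density lborel (\<lambda>t. ennreal (erlang_density m 1 t))"

definition gam :: "(real \<Rightarrow> complex) \<Rightarrow> nat \<Rightarrow> complex" where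
  "gam a m = integral\<^sup>L (gmeas m) a"

interpretation gm: prob_space "gmeas m" for m
  unfolding gmeas_def by (rule prob_space_erlang_density) simp

lemma sets_gmeas [simp, measurable_cong]: "sets (gmeas m) = sets borel"
  by (simp add: gmeas_def)

lemma space_gmeas [simp]: "space (gmeas m) = UNIV"
  by (simp add: gmeas_def)

lemma prob_gmeas_UNIV [simp]: "measure (gmeas m) UNIV = 1"
  using gm.prob_space[of m] by simp

lemma gmeas_moment: "has_bochner_integral (gmeas m) (\<lambda>t. t ^ i) (fact (m + i) / fact m)"
proof -
  have "distributed (gmeas m) lborel (\<lambda>t. t) (erlang_density m 1)"
    unfolding distributed_def by (auto simp: gmeas_def intro!: distr_id2)
  from gm.has_bochner_integral_erlang_ith_moment[OF _ this, of i] show ?thesis by simp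
qed

lemma gmeas_moment1: "has_bochner_integral (gmeas m) (\<lambda>t. t) (real (Suc m))"
  using gmeas_moment[of m 1] by simp

lemma gmeas_moment2: "has_bochner_integral (gmeas m) (\<lambda>t. t\<^sup>2) (real (Suc m) * real (Suc (Suc m)))"
  using gmeas_moment[of m 2] by (simp add: algebra_simps del: of_nat_Suc)

lemma gmeas_var:
  "has_bochner_integral (gmeas m) (\<lambda>t. (t - real (Suc m))\<^sup>2) (real (Suc m))"
proof -
  have "has_bochner_integral (gmeas m) (\<lambda>t. t\<^sup>2 - 2 * real (Suc m) * t + (real (Suc m))\<^sup>2)
     (real (Suc m) * real (Suc (Suc m)) - 2 * real (Suc m) * real (Suc m) + (real (Suc m))\<^sup>2)"
    by (intro has_bochner_integral_add has_bochner_integral_diff has_bochner_integral_mult_right gmeas_moment1 gmeas_moment2)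
       (simp add: has_bochner_integral_iff gm.prob_space)
  then show ?thesis by (simp add: power2_eq_square algebra_simps)
qed

lemma AE_gmeas_nonneg: "AE t in gmeas m. t \<ge> 0"
  unfolding gmeas_def by (subst AE_density) (auto simp: erlang_density_def)

lemma gmeas_integral:
  fixes f :: "real \<Rightarrow> 'a::{banach, second_countable_topology}"
  assumes "f \<in> borel_measurable borel"
  shows "integral\<^sup>L (gmeas m) f = (\<integral>t. erlang_density m 1 t *\<^sub>R f t \<partial>lborel)"
    and "integrable (gmeas m) f \<longleftrightarrow> integrable lborel (\<lambda>t. erlang_density m 1 t *\<^sub>R f t)"
  using assms unfolding gmeas_def
  by (auto intro!: integral_density simp: integrable_density)

lemma gmeas_integrable_bounded:
  fixes a :: "real \<Rightarrow> complex"
  assumes "a \<in> borel_measurable borel" "bounded (range a)"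
  shows "integrable (gmeas m) a"
proof -
  obtain B where "\<And>m. cmod (a m) \<le> B"
    using assms bounded_rangeE by blast
  then show ?thesis using assms(1)
    by (intro gm.integrable_const_bound[of _ B]) auto
qed

lemma gam_bound:
  assumes "\<And>t. cmod (a t) \<le> B"
  shows "cmod (gam a m) \<le> B"
proof -
  have "0 \<le> B" using assms norm_ge_zero order.trans by blast
  have "cmod (gam a m) \<le> (\<integral>t. cmod (a t) \<partial>gmeas m)" unfolding gam_def by (rule integral_norm_bound)
  also have "\<dots> \<le> (\<integral>t. B \<partial>gmeas m)"
    using assms \<open>0 \<le> B\<close> by (intro integral_mono_AE') auto
  finally show ?thesis by (simp add: gm.prob_space)
qed

lemma erlang_Suc: "erlang_density (Suc m) 1 t = t / real (Suc m) * erlang_density m 1 t"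
  by (simp add: erlang_density_def field_simps del: of_nat_Suc)

text \<open>\<open>Lop\<close> acts on the densities: the recursion \<open>erlang_Suc\<close> turns
  the weighted second difference of three consecutive densities into one density times a quadratic
  factor whose absolute mean is at most 2.\<close>

lemma gam_in_Wseq:
  assumes a: "a \<in> borel_measurable borel" "bounded (range a)"
  shows "gam a \<in> Wseq"
proof -
  obtain B where B: "B > 0" "\<And>t. cmod (a t) \<le> B"
    using a bounded_rangeE by blast
  have ab: "cmod (gam a m) \<le> B" for m using gam_bound B by blast
  have int: "integrable lborel (\<lambda>t. erlang_density m 1 t *\<^sub>R a t)" for m
    using gmeas_integrable_bounded[OF a] gmeas_integral[OF a(1)] by auto
  have "cmod (Lop (gam a) m) \<le> 2 * B" for m
  proof (cases m)
    case 0
    then show ?thesis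
      using norm_triangle_ineq4[of "gam a 1" "gam a 0"] ab[of 0] ab[of 1] by (simp add: Lop_def)
  next
    case (Suc k)
    \<comment> \<open>Everything is referred to the lowest index k = m - 1, whose law has mean and
      variance k + 1. Hence ((t - (k + 1))^2 + t) / (k + 1) has mean exactly 2.\<close>
    define q where "q t = ((t - real (Suc k))\<^sup>2 - t) / real (Suc k)" for t
    have "Lop (gam a) m = (\<integral>t. erlang_density k 1 t *\<^sub>R (of_real (q t) * a t) \<partial>lborel)"
    proof -
      have "Lop (gam a) m = of_nat (Suc (Suc k)) * gam a (Suc (Suc k)) - (of_nat (Suc (Suc k)) + of_nat (Suc k)) * gam a (Suc k) + of_nat (Suc k) * gam a k"
        by (simp add: Lop_def Suc algebra_simps)
      also have "\<dots> = (\<integral>t. of_nat (Suc (Suc k)) * (erlang_density (Suc (Suc k)) 1 t *\<^sub>R a t) - (of_nat (Suc (Suc k)) + of_nat (Suc k)) * (erlang_density (Suc k) 1 t *\<^sub>R a t)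
         + of_nat (Suc k) * (erlang_density k 1 t *\<^sub>R a t) \<partial>lborel)"
        unfolding gam_def gmeas_integral(1)[OF a(1)]
        by (intro has_bochner_integral_integral_eq[symmetric] has_bochner_integral_add has_bochner_integral_diff
              has_bochner_integral_mult_right has_bochner_integral_integrable int)
      also have "\<dots> = (\<integral>t. erlang_density k 1 t *\<^sub>R (of_real (q t) * a t) \<partial>lborel)"
      proof (rule Bochner_Integration.integral_cong[OF refl])
        fix t :: real
        have "of_nat (Suc (Suc k)) * (erlang_density (Suc (Suc k)) 1 t *\<^sub>R a t) - (of_nat (Suc (Suc k)) + of_nat (Suc k)) * (erlang_density (Suc k) 1 t *\<^sub>R a t)
         + of_nat (Suc k) * (erlang_density k 1 t *\<^sub>R a t) =
          of_real (real (Suc (Suc k)) * erlang_density (Suc (Suc k)) 1 t - (real (Suc (Suc k)) + real (Suc k)) * erlang_density (Suc k) 1 t + real (Suc k) * erlang_density k 1 t) * a t"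
          by (simp add: scaleR_conv_of_real algebra_simps)
        also have "real (Suc (Suc k)) * erlang_density (Suc (Suc k)) 1 t - (real (Suc (Suc k)) + real (Suc k)) * erlang_density (Suc k) 1 t + real (Suc k) * erlang_density k 1 t
           = q t * erlang_density k 1 t"
        proof -
          have 1: "real (Suc (Suc k)) * erlang_density (Suc (Suc k)) 1 t = t * (t / real (Suc k)) * erlang_density k 1 t"
            unfolding erlang_Suc by (simp del: of_nat_Suc)
          define s where "s = real (Suc k)"
          have s: "s \<noteq> 0" "real (Suc (Suc k)) = s + 1" by (auto simp: s_def)
          show ?thesis
            unfolding 1 unfolding erlang_Suc q_def s s_def[symmetric] using s(1)
            by (simp add: power2_eq_square field_simps)
        qed
        finally show "of_nat (Suc (Suc k)) * (erlang_density (Suc (Suc k)) 1 t *\<^sub>R a t) - (of_nat (Suc (Suc k)) + of_nat (Suc k)) * (erlang_density (Suc k) 1 t *\<^sub>R a t)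
         + of_nat (Suc k) * (erlang_density k 1 t *\<^sub>R a t) = erlang_density k 1 t *\<^sub>R (of_real (q t) * a t)"
          by (simp add: scaleR_conv_of_real)
      qed
      finally show ?thesis .
    qed
    also have "\<dots> = (\<integral>t. of_real (q t) * a t \<partial>gmeas k)"
      by (subst gmeas_integral(1)) (use a in \<open>auto simp: q_def\<close>)
    finally have "cmod (Lop (gam a) m) \<le> (\<integral>t. cmod (of_real (q t) * a t) \<partial>gmeas k)"
      by (simp only: integral_norm_bound)
    also have "\<dots> \<le> (\<integral>t. B * (((t - real (Suc k))\<^sup>2 + t) / real (Suc k)) \<partial>gmeas k)"
    proof (rule integral_mono_AE')
      show "integrable (gmeas k) (\<lambda>t. B * (((t - real (Suc k))\<^sup>2 + t) / real (Suc k)))"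
        using gmeas_var[of k] gmeas_moment1[of k] by (auto simp: has_bochner_integral_iff)
      show "AE t in gmeas k. cmod (of_real (q t) * a t) \<le> B * (((t - real (Suc k))\<^sup>2 + t) / real (Suc k))"
        using AE_gmeas_nonneg
      proof eventually_elim
        fix t :: real assume t: "0 \<le> t"
        have "\<bar>(t - real (Suc k))\<^sup>2 - t\<bar> \<le> (t - real (Suc k))\<^sup>2 + t"
          using t zero_le_power2[of "t - real (Suc k)"] by linarith
        then have "\<bar>q t\<bar> \<le> ((t - real (Suc k))\<^sup>2 + t) / real (Suc k)"
          unfolding q_def abs_divide by (simp add: divide_right_mono)
        then have "\<bar>q t\<bar> * cmod (a t) \<le> ((t - real (Suc k))\<^sup>2 + t) / real (Suc k) * B"
          using B t by (intro mult_mono) auto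
        then show "cmod (of_real (q t) * a t) \<le> B * (((t - real (Suc k))\<^sup>2 + t) / real (Suc k))"
          unfolding norm_mult norm_of_real by (simp only: mult.commute)
      qed
      show "AE t in gmeas k. 0 \<le> B * (((t - real (Suc k))\<^sup>2 + t) / real (Suc k))"
        using AE_gmeas_nonneg
        by eventually_elim (use B in \<open>auto intro!: divide_nonneg_pos mult_nonneg_nonneg\<close>)
    qed
    also have "\<dots> = B * ((real (Suc k) + real (Suc k)) / real (Suc k))"
      using gmeas_var[of k] gmeas_moment1[of k] by (simp add: has_bochner_integral_iff del: of_nat_Suc)
    also have "\<dots> = 2 * B" by (simp add: field_simps)
    finally show ?thesis .
  qed
  then show ?thesis
    unfolding Wseq_def using ab bounded_rangeI by blast
qed

section \<open>Mean and variance of the square root under the Gamma laws\<close>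

definition theta :: "nat \<Rightarrow> real" where
  "theta m = integral\<^sup>L (gmeas m) sqrt"

lemma theta_integrable: "integrable (gmeas m) sqrt"
proof (rule Bochner_Integration.integrable_bound)
  show "integrable (gmeas m) (\<lambda>t. 1 + t)"
    using gmeas_moment1[of m] by (auto simp: has_bochner_integral_iff)
  show "AE t in gmeas m. norm (sqrt t) \<le> norm (1 + t)"
    using AE_gmeas_nonneg
  proof eventually_elim
    fix t :: real assume "0 \<le> t"
    then have "t \<le> (1 + t)\<^sup>2" by (simp add: power2_eq_square algebra_simps)
    then have "sqrt t \<le> 1 + t" using \<open>0 \<le> t\<close> by (intro real_le_lsqrt) auto
    then show "norm (sqrt t) \<le> norm (1 + t)" using \<open>0 \<le> t\<close> by simp
  qed
qed simp

text \<open>The closed form brings in the functional equation of Gamma, which gives the exact ratio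
  of consecutive values in \<open>theta_Suc\<close>.\<close>

lemma theta_Gamma: "theta m = Gamma (real m + 3/2) / fact m"
proof -
  have "ennreal (theta m) = (\<integral>\<^sup>+t. ennreal (sqrt t) \<partial>gmeas m)"
    unfolding theta_def using AE_gmeas_nonneg
    by (intro nn_integral_eq_integral[symmetric] theta_integrable) (auto elim!: eventually_mono)
  also have "\<dots> = (\<integral>\<^sup>+t. ennreal (erlang_density m 1 t) * ennreal (sqrt t) \<partial>lborel)"
    unfolding gmeas_def by (intro nn_integral_density) auto
  also have "\<dots> = (\<integral>\<^sup>+t. ennreal (1 / fact m) * ennreal (indicator {0..} t * t powr (real m + 3/2 - 1) / exp t) \<partial>lborel)"
  proof (rule nn_integral_cong)
    fix t :: real
    show "ennreal (erlang_density m 1 t) * ennreal (sqrt t) = ennreal (1 / fact m) * ennreal (indicator {0..} t * t powr (real m + 3/2 - 1) / exp t)"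
    proof (cases "t > 0")
      case True
      have powr: "t powr (real m + 3/2 - 1) = t ^ m * sqrt t"
        using True powr_add[of t "real m" "1/2"] by (simp add: powr_realpow powr_half_sqrt algebra_simps)
      have "erlang_density m 1 t * sqrt t = 1 / fact m * (indicator {0..} t * t powr (real m + 3/2 - 1) / exp t)"
        unfolding powr using True by (simp add: erlang_density_def exp_minus field_simps)
      then show ?thesis using True by (subst (1 2) ennreal_mult[symmetric]) simp_all
    next
      case False
      then show ?thesis by (cases "t = 0") (auto simp: erlang_density_def)
    qed
  qed
  also have "\<dots> = ennreal (1 / fact m) * ennreal (Gamma (real m + 3/2))"
    by (subst nn_integral_cmult) (auto simp: Gamma_conv_nn_integral_real)
  finally have "ennreal (theta m) = ennreal (Gamma (real m + 3/2) / fact m)"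
    by (simp add: ennreal_mult''[symmetric] Gamma_real_pos less_imp_le)
  moreover have "theta m \<ge> 0"
    unfolding theta_def using AE_gmeas_nonneg by (intro integral_nonneg_AE) (auto elim!: eventually_mono)
  ultimately show ?thesis by (simp add: Gamma_real_pos less_imp_le)
qed

lemma theta_pos: "theta m > 0"
  by (simp add: theta_Gamma Gamma_real_pos)

lemma theta_Suc: "theta (Suc m) = theta m * (1 + 1 / (2 * real (Suc m)))"
proof -
  have "Gamma (real m + 3/2 + 1) = (real m + 3/2) * Gamma (real m + 3/2)"
    by (rule Gamma_plus1) (auto elim!: nonpos_Ints_cases)
  moreover have "real (Suc m) + 3/2 = real m + 3/2 + 1" by simp
  ultimately have "theta (Suc m) = (real m + 3/2) * Gamma (real m + 3/2) / (real (Suc m) * fact m)"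
    unfolding theta_Gamma by (simp only: fact_Suc of_nat_mult of_nat_fact)
  also have "\<dots> = theta m * ((real m + 3/2) / real (Suc m))"
    unfolding theta_Gamma by (simp add: mult_ac del: of_nat_Suc)
  also have "(real m + 3/2) / real (Suc m) = 1 + 1 / (2 * real (Suc m))"
    by (simp add: field_simps)
  finally show ?thesis .
qed

text \<open>The ratio 1 + 1 / (2 (m + 1)) dominates sqrt ((m + 2) / (m + 1)), so
  \<open>theta m\<close> / sqrt (m + 1) never decreases from its value
  \<open>theta 0\<close>.\<close>

lemma sqrt_le_theta: "sqrt (real (Suc m)) * theta 0 \<le> theta m"
proof (induction m)
  case (Suc m)
  have "sqrt (real (Suc (Suc m))) \<le> sqrt (real (Suc m)) * (1 + 1 / (2 * real (Suc m)))"
  proof (rule real_le_lsqrt)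
    have "real (Suc m) * (1 + 1 / (2 * real (Suc m)))\<^sup>2 = real (Suc m) + 1 + 1 / (4 * real (Suc m))"
      by (simp add: power2_eq_square field_simps del: of_nat_Suc)
    then show "real (Suc (Suc m)) \<le> (sqrt (real (Suc m)) * (1 + 1 / (2 * real (Suc m))))\<^sup>2"
      by (simp add: power_mult_distrib)
  qed auto
  then have "sqrt (real (Suc (Suc m))) * theta 0 \<le> sqrt (real (Suc m)) * (1 + 1 / (2 * real (Suc m))) * theta 0"
    using theta_pos[of 0] by (intro mult_right_mono) auto
  also have "\<dots> \<le> theta m * (1 + 1 / (2 * real (Suc m)))"
    using mult_right_mono[OF Suc, of "1 + 1 / (2 * real (Suc m))"] by (simp add: algebra_simps)
  finally show ?case unfolding theta_Suc .
qed simp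

text \<open>This direction turns uniform continuity for the square-root metric into uniform
  continuity in \<open>theta\<close>, the coordinate whose exponentials are available. An increment
  of the root is at most 1 / sqrt (k + 1), one of \<open>theta\<close> at least theta 0 / (2 sqrt (k
  + 1)).\<close>

lemma sqrt_theta_lipschitz:
  "\<bar>sqrt (real m) - sqrt (real n)\<bar> \<le> 2 / theta 0 * \<bar>theta m - theta n\<bar>"
proof -
  have step: "sqrt (real (Suc k)) - sqrt (real k) \<le> 2 / theta 0 * (theta (Suc k) - theta k)" for k
  proof -
    have "(sqrt (real (Suc k)) - sqrt (real k)) * sqrt (real (Suc k)) \<le> 1"
    proof -
      have "sqrt (real k) * sqrt (real k) \<le> sqrt (real k) * sqrt (real (Suc k))"
        by (intro mult_left_mono) auto
      then show ?thesis by (simp add: algebra_simps)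
    qed
    then have "sqrt (real (Suc k)) - sqrt (real k) \<le> 1 / sqrt (real (Suc k))"
      by (simp add: field_simps del: of_nat_Suc)
    also have "\<dots> = 2 / theta 0 * (sqrt (real (Suc k)) * theta 0 * (1 / (2 * real (Suc k))))"
      using theta_pos[of 0] real_sqrt_mult_self[of "real (Suc k)"] by (simp add: field_simps del: of_nat_Suc real_sqrt_mult_self)
    also have "\<dots> \<le> 2 / theta 0 * (theta k * (1 / (2 * real (Suc k))))"
      using theta_pos[of 0] sqrt_le_theta[of k] by (intro mult_left_mono mult_right_mono) auto
    also have "\<dots> = 2 / theta 0 * (theta (Suc k) - theta k)"
      unfolding theta_Suc by (simp add: algebra_simps)
    finally show ?thesis .
  qed
  have le: "sqrt (real (n + j)) - sqrt (real n) \<le> 2 / theta 0 * (theta (n + j) - theta n)" for n j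
  proof (induction j)
    case (Suc j)
    then show ?case using step[of "n + j"] by (simp add: algebra_simps)
  qed simp
  have mono: "theta n \<le> theta (n + j)" for n j
  proof (induction j)
    case (Suc j)
    have "theta (n + j) * 1 \<le> theta (n + j) * (1 + 1 / (2 * real (Suc (n + j))))"
      using theta_pos[of "n + j"] by (intro mult_left_mono) auto
    then show ?case using Suc theta_Suc[of "n + j"] by simp
  qed simp
  have "\<bar>sqrt (real (n + j)) - sqrt (real n)\<bar> \<le> 2 / theta 0 * \<bar>theta (n + j) - theta n\<bar>" for n j
    using le[of n j] mono[of n j] by simp
  from this[of n "m - n"] this[of m "n - m"] show ?thesis
    by (cases "n \<le> m") (simp_all add: abs_minus_commute)
qed

text \<open>The mean minimises the quadratic deviation, so it may be replaced by s = sqrt (m + 1).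
  There |sqrt t - s| \<le> |t - s^2| / s, whose square has mean Var(t) / (m + 1) = 1.\<close>

lemma gmeas_sqrt_var:
  "integrable (gmeas m) (\<lambda>t. (sqrt t - theta m)\<^sup>2)"
  "(\<integral>t. (sqrt t - theta m)\<^sup>2 \<partial>gmeas m) \<le> 1"
proof -
  define s where "s = sqrt (real (Suc m))"
  have s: "s > 0" "s * s = real (Suc m)" by (auto simp: s_def)
  have i1: "integrable (gmeas m) (\<lambda>t. (sqrt t - c)\<^sup>2)" for c
  proof -
    have "integrable (gmeas m) (\<lambda>t. t - 2 * c * sqrt t + c\<^sup>2)"
      using gmeas_moment1[of m] theta_integrable[of m] by (auto simp: has_bochner_integral_iff)
    then show ?thesis
      by (rule integrable_cong_AE_imp) (use AE_gmeas_nonneg[of m] in \<open>auto elim!: eventually_mono simp: power2_eq_square algebra_simps\<close>)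
  qed
  then show "integrable (gmeas m) (\<lambda>t. (sqrt t - theta m)\<^sup>2)" .
  have e1: "(\<integral>t. (sqrt t - c)\<^sup>2 \<partial>gmeas m) = real (Suc m) - 2 * c * theta m + c\<^sup>2" for c
  proof -
    have "(\<integral>t. (sqrt t - c)\<^sup>2 \<partial>gmeas m) = (\<integral>t. t - 2 * c * sqrt t + c\<^sup>2 \<partial>gmeas m)"
      by (rule integral_cong_AE) (use AE_gmeas_nonneg[of m] in \<open>auto elim!: eventually_mono simp: power2_eq_square algebra_simps\<close>)
    also have "\<dots> = real (Suc m) - 2 * c * theta m + c\<^sup>2"
      using gmeas_moment1[of m] theta_integrable[of m] by (simp add: has_bochner_integral_iff theta_def gm.prob_space)
    finally show ?thesis .
  qed
  have "(\<integral>t. (sqrt t - theta m)\<^sup>2 \<partial>gmeas m) \<le> (\<integral>t. (sqrt t - s)\<^sup>2 \<partial>gmeas m)"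
    unfolding e1 using zero_le_power2[of "s - theta m"] by (simp add: power2_eq_square algebra_simps)
  also have "\<dots> \<le> (\<integral>t. (t - real (Suc m))\<^sup>2 / real (Suc m) \<partial>gmeas m)"
  proof (rule integral_mono_AE')
    show "integrable (gmeas m) (\<lambda>t. (t - real (Suc m))\<^sup>2 / real (Suc m))"
      using gmeas_var[of m] by (auto simp: has_bochner_integral_iff)
    show "AE t in gmeas m. (sqrt t - s)\<^sup>2 \<le> (t - real (Suc m))\<^sup>2 / real (Suc m)"
      using AE_gmeas_nonneg[of m]
    proof eventually_elim
      fix t :: real assume t: "0 \<le> t"
      have "t - real (Suc m) = (sqrt t - s) * (sqrt t + s)"
        using s t by (simp add: algebra_simps)
      then have "(t - real (Suc m))\<^sup>2 = (sqrt t - s)\<^sup>2 * (sqrt t + s)\<^sup>2" by (simp add: power_mult_distrib)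
      also have "\<dots> \<ge> (sqrt t - s)\<^sup>2 * s\<^sup>2"
        using s t by (intro mult_left_mono power_mono) auto
      finally have "(sqrt t - s)\<^sup>2 * real (Suc m) \<le> (t - real (Suc m))\<^sup>2"
        using s by (simp add: power2_eq_square)
      then show "(sqrt t - s)\<^sup>2 \<le> (t - real (Suc m))\<^sup>2 / real (Suc m)"
        by (simp add: pos_le_divide_eq del: of_nat_Suc)
    qed
  qed simp
  also have "\<dots> = 1" using gmeas_var[of m] by (simp add: has_bochner_integral_iff del: of_nat_Suc)
  finally show "(\<integral>t. (sqrt t - theta m)\<^sup>2 \<partial>gmeas m) \<le> 1" .
qed

section \<open>Closed algebras containing the Gamma averages\<close>

text \<open>Instantiated twice: with the uniform closure of \<open>Wseq\<close>, and with the
  eigenvalue sequences of the diagonal operators in a C*-algebra that contains the radial Toeplitz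
  operators.\<close>

locale gamma_algebra =
  fixes A :: "(nat \<Rightarrow> complex) set"
  assumes gam_in: "a \<in> borel_measurable borel \<Longrightarrow> bounded (range a) \<Longrightarrow> gam a \<in> A"
    and add_in: "x \<in> A \<Longrightarrow> y \<in> A \<Longrightarrow> (\<lambda>m. x m + y m) \<in> A"
    and mult_in: "x \<in> A \<Longrightarrow> y \<in> A \<Longrightarrow> (\<lambda>m. x m * y m) \<in> A"
    and scale_in: "x \<in> A \<Longrightarrow> (\<lambda>m. c * x m) \<in> A"
    and cnj_in: "x \<in> A \<Longrightarrow> (\<lambda>m. cnj (x m)) \<in> A"
    and limit_in: "(\<And>\<epsilon>. \<epsilon> > 0 \<Longrightarrow> \<exists>y\<in>A. \<forall>m. cmod (x m - y m) < \<epsilon>) \<Longrightarrow> x \<in> A"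
begin

lemma const_in: "(\<lambda>m. c) \<in> A"
proof -
  have "gam (\<lambda>_. 1) = (\<lambda>m. 1)" by (auto simp: gam_def)
  moreover have "gam (\<lambda>_. 1) \<in> A" by (rule gam_in) auto
  ultimately show ?thesis using scale_in[of "\<lambda>m. 1" c] by simp
qed

lemma power_in: "x \<in> A \<Longrightarrow> (\<lambda>m. x m ^ n) \<in> A"
  by (induction n) (auto intro: const_in mult_in)

lemma sum_in: "(\<And>i. i \<in> I \<Longrightarrow> f i \<in> A) \<Longrightarrow> (\<lambda>m. \<Sum>i\<in>I. f i m) \<in> A"
proof (induction I rule: infinite_finite_induct)
  case (insert i I)
  then show ?case using add_in[of "f i" "\<lambda>m. \<Sum>i\<in>I. f i m"] by simp
qed (auto intro: const_in)

end

section \<open>Continuous functions of the phase of theta\<close>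

lemma gam_cis_approx:
  "cmod (gam (\<lambda>t. cis (b * sqrt t)) m - cis (b * theta m)) \<le> b\<^sup>2 / 2"
proof -
  \<comment> \<open>The exponential is compared with its tangent \<open>l\<close> at the exact mean
    \<open>theta m\<close>. The linear term integrates to zero, and the remainder is at most b^2 / 2
    times a variance bounded by one. Any other centre would leave an error of first order in
    b.\<close>
  have i1: "integrable (gmeas m) (\<lambda>t. cis (b * sqrt t))"
    by (intro gm.integrable_const_bound[of _ 1]) (auto simp: cis_conv_exp)
  define l where "l t = cis (b * theta m) * (1 + \<i> * of_real (b * (sqrt t - theta m)))" for t
  have i2: "integrable (gmeas m) l"
    unfolding l_def using theta_integrable[of m]
    by (intro integrable_mult_right Bochner_Integration.integrable_add integrable_of_real Bochner_Integration.integrable_diff) auto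
  have "integral\<^sup>L (gmeas m) l = cis (b * theta m) * (1 + \<i> * of_real (b * (theta m - theta m)))"
    unfolding l_def using theta_integrable[of m] by (simp add: theta_def)
  then have "gam (\<lambda>t. cis (b * sqrt t)) m - cis (b * theta m) = (\<integral>t. cis (b * sqrt t) - l t \<partial>gmeas m)"
    using i1 i2 by (simp add: gam_def)
  also have "cmod \<dots> \<le> (\<integral>t. cmod (cis (b * sqrt t) - l t) \<partial>gmeas m)"
    by (rule integral_norm_bound)
  also have "\<dots> \<le> (\<integral>t. b\<^sup>2 / 2 * (sqrt t - theta m)\<^sup>2 \<partial>gmeas m)"
  proof (rule integral_mono)
    fix t
    define y where "y = b * (sqrt t - theta m)"
    have "cis (b * sqrt t) = cis (b * theta m) * cis y"
      by (simp add: cis_mult y_def algebra_simps)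
    then have "cis (b * sqrt t) - l t = cis (b * theta m) * (cis y - (1 + \<i> * of_real y))"
      by (simp add: l_def y_def algebra_simps)
    then have "cmod (cis (b * sqrt t) - l t) = cmod (cis y - (1 + \<i> * of_real y))"
      by (simp add: norm_mult)
    also have "\<dots> \<le> y\<^sup>2 / 2"
      using iexp_approx1[of y 1] by (simp add: cis_conv_exp numeral_2_eq_2)
    also have "\<dots> = b\<^sup>2 / 2 * (sqrt t - theta m)\<^sup>2" by (simp add: y_def power_mult_distrib)
    finally show "cmod (cis (b * sqrt t) - l t) \<le> b\<^sup>2 / 2 * (sqrt t - theta m)\<^sup>2" .
  qed (use i1 i2 gmeas_sqrt_var(1)[of m] in auto)
  also have "\<dots> \<le> b\<^sup>2 / 2 * 1"
    using gmeas_sqrt_var(2)[of m] by (simp del: mult_1_right add: mult_left_mono)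
  finally show ?thesis by simp
qed

text \<open>At frequency c / n the error is quadratic, (c / n)^2 / 2. Taking n-th powers inside the
  unit disc multiplies it by at most n, which leaves c^2 / (2 n).\<close>

lemma (in gamma_algebra) cis_theta: "(\<lambda>m. cis (c * theta m)) \<in> A"
proof (rule limit_in)
  fix \<epsilon> :: real assume e: "\<epsilon> > 0"
  obtain n' :: nat where "c\<^sup>2 / \<epsilon> < real n'" using reals_Archimedean2 by blast
  then obtain n :: nat where n: "n > 0" "c\<^sup>2 / \<epsilon> < real n" by (intro that[of "Suc n'"]) auto
  define u where "u = gam (\<lambda>t. cis (c / n * sqrt t))"
  show "\<exists>y\<in>A. \<forall>m. cmod (cis (c * theta m) - y m) < \<epsilon>"
  proof (intro bexI allI)
    show "(\<lambda>m. u m ^ n) \<in> A" unfolding u_def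
      by (intro power_in gam_in) (auto intro!: bounded_rangeI[of _ 1] simp: cis_conv_exp)
    fix m
    have "cis (c * theta m) = cis (real n * (c / n * theta m))" using n by simp
    also have "\<dots> = cis (c / n * theta m) ^ n" by (rule Complex.DeMoivre[symmetric])
    finally have "cmod (cis (c * theta m) - u m ^ n) \<le> real n * cmod (cis (c / n * theta m) - u m)"
      using norm_power_diff[of "cis (c / n * theta m)" "u m" n] gam_bound[of "\<lambda>t. cis (c / n * sqrt t)" 1 m]
      by (simp add: u_def)
    also have "\<dots> \<le> real n * ((c / n)\<^sup>2 / 2)"
      using gam_cis_approx[of "c / n" m] by (intro mult_left_mono) (auto simp: u_def norm_minus_commute)
    also have "\<dots> = c\<^sup>2 / (2 * real n)" using n by (simp add: power2_eq_square)
    also have "\<dots> < \<epsilon>"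
    proof -
      have "c\<^sup>2 < \<epsilon> * real n" using n e by (simp add: field_simps)
      moreover have "0 < \<epsilon> * real n" using n e by simp
      ultimately have "c\<^sup>2 < \<epsilon> * (2 * real n)" by linarith
      then show ?thesis using n by (simp add: divide_less_eq)
    qed
    finally show "cmod (cis (c * theta m) - u m ^ n) < \<epsilon>" .
  qed
qed

lemma (in gamma_algebra) Re_in: "x \<in> A \<Longrightarrow> (\<lambda>m. of_real (Re (x m))) \<in> A"
proof -
  assume x: "x \<in> A"
  have "(\<lambda>m. 1/2 * (x m + cnj (x m))) \<in> A" by (intro scale_in add_in cnj_in x)
  then show ?thesis by (simp add: complex_add_cnj)
qed

lemma (in gamma_algebra) Im_in: "x \<in> A \<Longrightarrow> (\<lambda>m. of_real (Im (x m))) \<in> A"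
  using Re_in[OF scale_in[of x "-\<i>"]] by simp

text \<open>Real polynomial functions on the plane are generated by real-linear functionals, hence
  by real and imaginary part, which closure under conjugation supplies.\<close>

lemma (in gamma_algebra) poly_in:
  assumes "real_polynomial_function g" and x: "x \<in> A"
  shows "(\<lambda>m. of_real (g (x m))) \<in> A"
  using assms(1)
proof induction
  case (linear f)
  then interpret bounded_linear f .
  have "f z = f 1 * Re z + f \<i> * Im z" for z
  proof -
    have "z = Re z *\<^sub>R 1 + Im z *\<^sub>R \<i>" by (simp add: complex_eq_iff)
    then have "f z = Re z *\<^sub>R f 1 + Im z *\<^sub>R f \<i>" by (metis add scaleR)
    then show ?thesis by simp
  qed
  then have "(\<lambda>m. of_real (f (x m))) = (\<lambda>m. of_real (f 1) * of_real (Re (x m)) + of_real (f \<i>) * complex_of_real (Im (x m)))"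
    by (metis of_real_add of_real_mult)
  also have "\<dots> \<in> A" by (intro add_in scale_in Re_in Im_in x)
  finally show ?case .
next
  case (const c)
  show ?case by (rule const_in)
next
  case (add f g)
  then show ?case using add_in by simp
next
  case (mult f g)
  then show ?case using mult_in by simp
qed

lemma (in gamma_algebra) circle_in:
  assumes g: "continuous_on (sphere 0 1) g" and x: "x \<in> A" "\<And>m. cmod (x m) = 1"
  shows "(\<lambda>m. of_real (g (x m))) \<in> A"
proof (rule limit_in)
  fix \<epsilon> :: real assume "\<epsilon> > 0"
  then obtain p where p: "real_polynomial_function p" "\<And>z. z \<in> sphere 0 1 \<Longrightarrow> \<bar>g z - p z\<bar> < \<epsilon>"
    using Stone_Weierstrass_real_polynomial_function[OF compact_sphere g] by blast
  have "cmod (complex_of_real (g (x m)) - of_real (p (x m))) < \<epsilon>" for m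
    using p(2)[of "x m"] x(2)[of m] by (simp only: of_real_diff[symmetric] norm_of_real) simp
  then show "\<exists>y\<in>A. \<forall>m. cmod (complex_of_real (g (x m)) - y m) < \<epsilon>"
    using poly_in[OF p(1) x(1)] by (intro bexI[of _ "\<lambda>m. of_real (p (x m))"]) auto
qed

section \<open>Approximation of uniformly continuous sequences\<close>

lemma cis_near_1:
  assumes "d > 0"
  obtains \<eta> where "\<eta> > 0" "\<And>\<alpha>. cmod (cis \<alpha> - 1) < \<eta> \<Longrightarrow> \<exists>l::int. \<bar>\<alpha> - 2 * pi * of_int l\<bar> < d"
proof
  \<comment> \<open>Capping at pi stays where the cosine is decreasing, so 1 - cos d' separates
    angles. Rounding to the nearest period below puts the reduced angle \<beta> into
    [-pi, pi].\<close>
  define d' where "d' = min d pi"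
  have d': "0 < d'" "d' \<le> pi" "d' \<le> d" using assms pi_gt_zero by (auto simp: d'_def)
  show "1 - cos d' > 0" using cos_monotone_0_pi[of 0 d'] d' by simp
  fix \<alpha> assume a: "cmod (cis \<alpha> - 1) < 1 - cos d'"
  define l where "l = round (\<alpha> / (2 * pi))"
  define \<beta> where "\<beta> = \<alpha> - 2 * pi * of_int l"
  have "\<bar>of_int l - \<alpha> / (2 * pi)\<bar> \<le> 1 / 2" unfolding l_def by (rule of_int_round_abs_le)
  moreover have "\<beta> = - (2 * pi) * (of_int l - \<alpha> / (2 * pi))" by (simp add: \<beta>_def field_simps)
  ultimately have b: "\<bar>\<beta>\<bar> \<le> pi" by (simp add: abs_mult mult_le_cancel_left)
  have "cos \<beta> = cos \<alpha>" unfolding \<beta>_def cos_diff cos_int_2pin sin_int_2pin by simp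
  then have "1 - cos \<beta> = - Re (cis \<alpha> - 1)" by simp
  also have "\<dots> \<le> cmod (cis \<alpha> - 1)" using abs_Re_le_cmod[of "cis \<alpha> - 1"] by linarith
  finally have "cos d' < cos \<beta>" using a by linarith
  then have "cos d' < cos \<bar>\<beta>\<bar>" by simp
  then have "\<bar>\<beta>\<bar> < d'"
    using cos_monotone_0_pi_le[of d' "\<bar>\<beta>\<bar>"] d' b by (meson abs_ge_zero less_le_not_le linorder_not_less order_less_imp_le)
  then show "\<exists>l::int. \<bar>\<alpha> - 2 * pi * of_int l\<bar> < d" using d' \<beta>_def by (intro exI[of _ l]) linarith
qed

theorem (in gamma_algebra) Cbu_subset: "Cbu \<subseteq> A"
proof
  fix x assume x: "x \<in> Cbu"
  then obtain B where B: "B > 0" "\<And>m. cmod (x m) \<le> B"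
    using bounded_rangeE unfolding Cbu_def by blast
  show "x \<in> A"
  proof (rule limit_in)
    fix \<epsilon> :: real assume "\<epsilon> > 0"
    \<comment> \<open>The total error will be 2 e: one e for the oscillation of x on an interval,
      one for the Gamma mass far from the mean.\<close>
    define e where "e = \<epsilon> / 3"
    have e: "e > 0" using \<open>\<epsilon> > 0\<close> by (simp add: e_def)
    obtain \<delta> where \<delta>: "\<delta> > 0" "\<And>m n. \<bar>sqrt (real m) - sqrt (real n)\<bar> < \<delta> \<Longrightarrow> cmod (x m - x n) < e"
      using x e unfolding Cbu_def by blast
    define d where "d = \<delta> * theta 0 / 2"
    have d: "d > 0" using \<delta>(1) theta_pos[of 0] by (simp add: d_def)
    have close: "cmod (x m - x n) < e" if "\<bar>theta m - theta n\<bar> < d" for m n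
    proof (rule \<delta>(2))
      have "2 / theta 0 * \<bar>theta m - theta n\<bar> < 2 / theta 0 * d"
        using that theta_pos[of 0] by (intro mult_strict_left_mono) auto
      also have "\<dots> = \<delta>" using theta_pos[of 0] by (simp add: d_def)
      finally show "\<bar>sqrt (real m) - sqrt (real n)\<bar> < \<delta>"
        using sqrt_theta_lipschitz[of m n] by linarith
    qed
    \<comment> \<open>The second bound makes the Chebyshev cost 32 B / R^2 of leaving a quarter
      period at most e. The first keeps a quarter period plus d / 2 within half a period.\<close>
    define R where "R = max (2 * d) (sqrt (32 * B / e))"
    have R: "R \<ge> 2 * d" "R > 0" "32 * B \<le> e * R\<^sup>2"
    proof -
      show "R \<ge> 2 * d" by (simp add: R_def)
      then show "R > 0" using d by linarith
      have "sqrt (32 * B / e) \<le> R" by (simp add: R_def)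
      then have "(sqrt (32 * B / e))\<^sup>2 \<le> R\<^sup>2" using B e by (intro power_mono) auto
      then show "32 * B \<le> e * R\<^sup>2" using B e by (simp add: field_simps)
    qed
    define c where "c = 2 * pi / R"
    have c: "c > 0" using R by (simp add: c_def)
    have cR: "2 * pi = c * R" using R by (simp add: c_def)
    have "c * d / 2 > 0" using c d by simp
    \<comment> \<open>The angle c d / 2 is the distance d / 2 in the theta coordinate: a phase known
      up to \<eta> locates \<open>theta m\<close> modulo R up to d / 2.\<close>
    then obtain \<eta> where \<eta>: "\<eta> > 0" "\<And>\<alpha>. cmod (cis \<alpha> - 1) < \<eta> \<Longrightarrow> \<exists>l::int. \<bar>\<alpha> - 2 * pi * of_int l\<bar> < c * d / 2"
      using cis_near_1 by metis
    have "compact (sphere (0::complex) 1)" by simp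
    moreover have "sphere (0::complex) 1 \<subseteq> (\<Union>\<omega>\<in>sphere 0 1. ball \<omega> \<eta>)" using \<eta>(1) by force
    ultimately obtain \<Omega> where \<Omega>: "\<Omega> \<subseteq> sphere (0::complex) 1" "finite \<Omega>" "sphere (0::complex) 1 \<subseteq> (\<Union>\<omega>\<in>\<Omega>. ball \<omega> \<eta>)"
      using compactE_image[of "sphere 0 1" "sphere 0 1" "\<lambda>\<omega>. ball \<omega> \<eta>"] by (metis open_ball)
    \<comment> \<open>Tent functions on the covering balls, normalised by their sum \<open>S\<close>
      to a partition of unity \<open>g\<close> on the circle; the cover makes \<open>S\<close>
      positive there.\<close>
    define h where "h \<omega> z = max 0 (\<eta> - cmod (z - \<omega>))" for \<omega> z :: complex
    define S where "S z = (\<Sum>\<omega>\<in>\<Omega>. h \<omega> z)" for z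
    define g where "g \<omega> z = h \<omega> z / S z" for \<omega> z
    have Spos: "S z > 0" if zs: "z \<in> sphere 0 1" for z
    proof -
      obtain \<omega> where w: "\<omega> \<in> \<Omega>" "z \<in> ball \<omega> \<eta>" using \<Omega>(3) zs by blast
      have "h \<omega> z > 0" using w by (auto simp: h_def dist_norm norm_minus_commute)
      then show ?thesis unfolding S_def using \<Omega>(2) w(1)
        by (intro sum_pos2[of _ \<omega>]) (auto simp: h_def)
    qed
    have gcont: "continuous_on (sphere 0 1) (g \<omega>)" for \<omega>
      unfolding g_def using Spos
      by (intro continuous_on_divide) (auto simp: S_def h_def intro!: continuous_intros less_imp_neq[THEN not_sym])
    define v where "v m = cis (c * theta m)" for m
    have v: "v \<in> A" "\<And>m. cmod (v m) = 1" unfolding v_def using cis_theta by auto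
    \<comment> \<open>A point of the theta axis whose phase is \<omega>; the others are its
      translates by multiples of R.\<close>
    define p where "p \<omega> = Arg \<omega> / c" for \<omega>
    define near where "near \<omega> l m \<longleftrightarrow> \<bar>theta m - p \<omega> - R * of_int l\<bar> < d / 2" for \<omega> m and l :: int
    \<comment> \<open>One sample of x per interval. Any index in it will do, since two of them are
      less than d apart in theta. The value 0 fills intervals that contain no
      \<open>theta m\<close>.\<close>
    define Y where "Y \<omega> l = (if \<exists>m. near \<omega> l m then x (SOME m. near \<omega> l m) else 0)" for \<omega> and l :: int
    \<comment> \<open>The summand 1/2 under the floor centres the l-th cell, of length R in the
      coordinate sqrt t, at p \<omega> + R l.\<close>
    define a where "a \<omega> t = Y \<omega> \<lfloor>(sqrt t - p \<omega>) / R + 1/2\<rfloor>" for \<omega> t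
    have Yb: "cmod (Y \<omega> l) \<le> B" for \<omega> l using B by (auto simp: Y_def)
    have ab: "cmod (a \<omega> t) \<le> B" for \<omega> t using Yb by (simp add: a_def)
    have am: "a \<omega> \<in> borel_measurable borel" for \<omega>
    proof -
      have 1: "Y \<omega> \<in> measurable (count_space UNIV) borel" by simp
      have 2: "(\<lambda>t. \<lfloor>(sqrt t - p \<omega>) / R + 1/2\<rfloor>) \<in> measurable borel (count_space UNIV)" by measurable
      show ?thesis unfolding a_def by (rule measurable_compose[OF 2 1])
    qed
    have gama: "gam (a \<omega>) \<in> A" for \<omega> by (rule gam_in[OF am bounded_rangeI[OF ab]])
    \<comment> \<open>The support of \<open>g \<omega>\<close> forces \<open>theta m\<close> into
      one of the short intervals, so both the sample and the cell around it are the right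
      ones.\<close>
    have key: "cmod (gam (a \<omega>) m - x m) \<le> 2 * e" if w: "\<omega> \<in> \<Omega>" and gz: "g \<omega> (v m) \<noteq> 0" for \<omega> m
    proof -
      have nw: "cmod \<omega> = 1" using w \<Omega>(1) by auto
      then have "\<omega> \<noteq> 0" by auto
      then have weq: "\<omega> = cis (c * p \<omega>)" using c nw cis_Arg[of \<omega>] by (auto simp: p_def sgn_div_norm)
      have "h \<omega> (v m) \<noteq> 0" using gz by (auto simp: g_def)
      then have "cmod (v m - \<omega>) < \<eta>" by (auto simp: h_def max_def split: if_splits)
      moreover have "v m - \<omega> = \<omega> * (cis (c * (theta m - p \<omega>)) - 1)"
        unfolding v_def by (subst (1 2) weq) (simp add: algebra_simps cis_mult)
      ultimately have "cmod (cis (c * (theta m - p \<omega>)) - 1) < \<eta>" using nw by (simp add: norm_mult)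
      then obtain l :: int where l: "\<bar>c * (theta m - p \<omega>) - 2 * pi * of_int l\<bar> < c * d / 2" using \<eta>(2) by blast
      have "c * (theta m - p \<omega>) - 2 * pi * of_int l = c * (theta m - p \<omega> - R * of_int l)"
        unfolding cR by (simp add: algebra_simps)
      then have "c * \<bar>theta m - p \<omega> - R * of_int l\<bar> < c * (d / 2)" using l c by (simp add: abs_mult)
      then have nr: "\<bar>theta m - p \<omega> - R * of_int l\<bar> < d / 2" using c by simp
      then have ex: "near \<omega> l m" by (simp add: near_def)
      define m' where "m' = (SOME m. near \<omega> l m)"
      have "near \<omega> l m'" unfolding m'_def by (rule someI[where P = "near \<omega> l", OF ex])
      then have "\<bar>theta m' - theta m\<bar> < d" using nr unfolding near_def by linarith
      moreover have "Y \<omega> l = x m'" using ex by (auto simp: Y_def m'_def)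
      ultimately have Y: "cmod (Y \<omega> l - x m) < e" using close by simp
      \<comment> \<open>Within R / 4 of \<open>theta m\<close> the step function has the sampled
        value. Further away the trivial bound 2 B is absorbed by the quadratic term, as 16 (sqrt t -
        theta m)^2 \<ge> R^2.\<close>
      have pt: "cmod (a \<omega> t - x m) \<le> e + 32 * B / R\<^sup>2 * (sqrt t - theta m)\<^sup>2" for t
      proof (cases "\<bar>sqrt t - theta m\<bar> < R / 4")
        case True
        then have "\<bar>sqrt t - p \<omega> - R * of_int l\<bar> < R / 2" using nr R(1) by linarith
        moreover have "sqrt t - p \<omega> - R * of_int l = R * ((sqrt t - p \<omega>) / R - of_int l)"
        proof -
          have "sqrt t - p \<omega> = R * ((sqrt t - p \<omega>) / R)" using R(2) by simp
          then show ?thesis unfolding right_diff_distrib by simp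
        qed
        ultimately have "R * \<bar>(sqrt t - p \<omega>) / R - of_int l\<bar> < R * (1 / 2)" using R(2) by (simp add: abs_mult)
        then have "\<bar>(sqrt t - p \<omega>) / R - of_int l\<bar> < 1 / 2" using R(2) by simp
        then have "\<lfloor>(sqrt t - p \<omega>) / R + 1/2\<rfloor> = l" by linarith
        then have "cmod (a \<omega> t - x m) < e" using Y by (simp add: a_def)
        moreover have "0 \<le> 32 * B / R\<^sup>2 * (sqrt t - theta m)\<^sup>2" using B by simp
        ultimately show ?thesis by linarith
      next
        case False
        then have "(R / 4)\<^sup>2 \<le> \<bar>sqrt t - theta m\<bar>\<^sup>2" using R(2) by (intro power_mono) auto
        then have "R\<^sup>2 \<le> 16 * (sqrt t - theta m)\<^sup>2" by (simp add: power_divide)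
        then have "2 * B / R\<^sup>2 * R\<^sup>2 \<le> 2 * B / R\<^sup>2 * (16 * (sqrt t - theta m)\<^sup>2)"
          using B by (intro mult_left_mono) auto
        then have "2 * B \<le> 32 * B / R\<^sup>2 * (sqrt t - theta m)\<^sup>2" using R(2) by simp
        moreover have "cmod (a \<omega> t - x m) \<le> 2 * B"
          using norm_triangle_ineq4[of "a \<omega> t" "x m"] ab[of \<omega> t] B(2)[of m] by linarith
        ultimately show ?thesis using e by linarith
      qed
      have ia: "integrable (gmeas m) (a \<omega>)" by (rule gmeas_integrable_bounded[OF am bounded_rangeI[OF ab]])
      have "gam (a \<omega>) m - x m = (\<integral>t. a \<omega> t - x m \<partial>gmeas m)" using ia by (simp add: gam_def)
      also have "cmod \<dots> \<le> (\<integral>t. cmod (a \<omega> t - x m) \<partial>gmeas m)" by (rule integral_norm_bound)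
      also have "\<dots> \<le> (\<integral>t. e + 32 * B / R\<^sup>2 * (sqrt t - theta m)\<^sup>2 \<partial>gmeas m)"
        using ia gmeas_sqrt_var(1)[of m] pt by (intro integral_mono) auto
      also have "\<dots> = e + 32 * B / R\<^sup>2 * (\<integral>t. (sqrt t - theta m)\<^sup>2 \<partial>gmeas m)"
        using gmeas_sqrt_var(1)[of m] by simp
      also have "\<dots> \<le> e + 32 * B / R\<^sup>2 * 1"
        using gmeas_sqrt_var(2)[of m] B by (intro add_left_mono mult_left_mono) auto
      also have "\<dots> \<le> e + e" using R by (simp add: field_simps)
      finally show ?thesis by simp
    qed
    \<comment> \<open>A convex combination in which each average enters only where its weight is
      nonzero, hence where it is within 2 e of x.\<close>
    define y where "y m = (\<Sum>\<omega>\<in>\<Omega>. of_real (g \<omega> (v m)) * gam (a \<omega>) m)" for m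
    have "y \<in> A" unfolding y_def
      by (intro sum_in mult_in[of "\<lambda>m. of_real (g _ (v m))"] circle_in gcont v gama)
    moreover have "cmod (x m - y m) < \<epsilon>" for m
    proof -
      have vm: "v m \<in> sphere 0 1" using v by simp
      have g0: "g \<omega> (v m) \<ge> 0" for \<omega> using Spos[OF vm] by (auto simp: g_def h_def)
      have s1: "(\<Sum>\<omega>\<in>\<Omega>. g \<omega> (v m)) = 1"
        using Spos[OF vm] by (simp add: g_def sum_divide_distrib[symmetric] S_def)
      have "y m - x m = y m - of_real (\<Sum>\<omega>\<in>\<Omega>. g \<omega> (v m)) * x m" by (simp add: s1)
      also have "\<dots> = (\<Sum>\<omega>\<in>\<Omega>. of_real (g \<omega> (v m)) * (gam (a \<omega>) m - x m))"
        by (simp add: y_def sum_distrib_right sum_subtractf right_diff_distrib)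
      also have "cmod \<dots> \<le> (\<Sum>\<omega>\<in>\<Omega>. g \<omega> (v m) * (2 * e))"
      proof (rule sum_norm_le)
        fix \<omega> assume w: "\<omega> \<in> \<Omega>"
        show "cmod (of_real (g \<omega> (v m)) * (gam (a \<omega>) m - x m)) \<le> g \<omega> (v m) * (2 * e)"
          using key[OF w, of m] g0[of \<omega>] by (cases "g \<omega> (v m) = 0") (auto simp: norm_mult intro!: mult_left_mono)
      qed
      also have "\<dots> = 2 * e" using s1 by (simp add: sum_distrib_right[symmetric])
      finally show ?thesis using e by (simp add: norm_minus_commute e_def)
    qed
    ultimately show "\<exists>y\<in>A. \<forall>m. cmod (x m - y m) < \<epsilon>" by blast
  qed
qed

section \<open>Radial integration on the complex plane\<close>

text \<open>Invariance is taken from orthogonal maps of \<open>real^2\<close>; \<open>h\<close> and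
  \<open>k\<close> identify the two planes and match boxes with boxes, and boxes determine the
  measure.\<close>

lemma lborel_complex_rotation:
  assumes u: "cmod u = 1"
  shows "distr lborel borel (\<lambda>z. u * z) = lborel"
proof (rule lborel_eqI[symmetric])
  define h :: "real^2 \<Rightarrow> complex" where "h v = Complex (v $ 1) (v $ 2)" for v
  define k :: "complex \<Rightarrow> real^2" where "k z = vector [Re z, Im z]" for z
  have hk: "h (k z) = z" for z by (simp add: h_def k_def)
  have kh: "k (h v) = v" for v by (simp add: h_def k_def vec_eq_iff forall_2)
  have hm: "h \<in> borel_measurable borel"
    by (intro borel_measurable_continuous_onI) (simp add: h_def[abs_def] Complex_eq continuous_intros)
  have hbox: "h -` box l w = box (k l) (k w)" for l w
    by (auto simp: h_def k_def in_box_complex_iff mem_box_cart forall_2)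
  have hd: "lborel = distr lborel borel h"
  proof (rule lborel_eqI)
    fix l w :: complex assume lw: "\<And>b. b \<in> Basis \<Longrightarrow> l \<bullet> b \<le> w \<bullet> b"
    have B2: "(Basis :: (real^2) set) = {axis 1 1, axis 2 1}"
      unfolding Basis_vec_def UNIV_2 by auto
    have "\<forall>b\<in>Basis. k l \<bullet> b \<le> k w \<bullet> b"
      using lw[of 1] lw[of \<i>] by (simp add: B2 k_def inner_axis)
    then have "emeasure lborel (box (k l) (k w)) = ennreal (\<Prod>b\<in>Basis. (k w - k l) \<bullet> b)"
      by (intro emeasure_lborel_box) auto
    also have "(\<Prod>b\<in>Basis. (k w - k l) \<bullet> b) = (\<Prod>b\<in>Basis. (w - l) \<bullet> b)"
    proof -
      have "axis 1 1 \<noteq> (axis 2 1 :: real^2)" by (simp add: axis_eq_axis)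
      then show ?thesis by (simp add: B2 inner_axis k_def Basis_complex_def)
    qed
    finally show "emeasure (distr lborel borel h) (box l w) = ennreal (\<Prod>b\<in>Basis. (w - l) \<bullet> b)"
      using hm by (simp add: emeasure_distr hbox)
  qed simp
  define R where "R v = k (u * h v)" for v
  \<comment> \<open>\<open>R'\<close> rotates by the inverse angle: the preimage of a box becomes an
    image under a linear isometry.\<close>
  define R' where "R' v = k (cnj u * h v)" for v
  have uu: "u * cnj u = 1" "cnj u * u = 1" using u by (auto simp: complex_norm_square[symmetric] mult.commute)
  have lin: "linear R'"
    by (rule linearI) (auto simp: R'_def k_def h_def vec_eq_iff forall_2 algebra_simps)
  have nk: "norm (k z) = cmod z" for z
    by (simp add: norm_vec_def L2_set_def UNIV_2 k_def cmod_def)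
  have "norm (R' v) = norm v" for v
    using nk[of "h v"] u by (simp add: R'_def nk norm_mult kh)
  then have orth: "orthogonal_transformation R'"
    using lin by (simp add: orthogonal_transformation)
  fix l w :: complex assume lw: "\<And>b. b \<in> Basis \<Longrightarrow> l \<bullet> b \<le> w \<bullet> b"
  have m: "(\<lambda>z. u * z) \<in> borel_measurable borel" by simp
  have "emeasure (distr lborel borel (\<lambda>z. u * z)) (box l w) = emeasure lborel (h -` ((\<lambda>z. u * z) -` box l w))"
    using m hm measurable_sets_borel[OF m, of "box l w"] by (subst hd) (simp add: emeasure_distr)
  also have "h -` ((\<lambda>z. u * z) -` box l w) = R' ` box (k l) (k w)"
  proof -
    have "v \<in> R' ` box (k l) (k w)" if "u * h v \<in> box l w" for v
    proof
      show "R v \<in> box (k l) (k w)" using that by (simp add: R_def hbox[symmetric] hk)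
      show "v = R' (R v)" using uu by (simp add: R_def R'_def hk kh mult.assoc[symmetric])
    qed
    moreover have "u * h (R' v) \<in> box l w" if "v \<in> box (k l) (k w)" for v
      using that uu by (simp add: R'_def hk mult.assoc[symmetric] hbox[symmetric])
    ultimately show ?thesis by auto
  qed
  also have "emeasure lborel (R' ` box (k l) (k w)) = emeasure lebesgue (R' ` box (k l) (k w))"
  proof -
    have "open (R' ` box (k l) (k w))"
      using lin orthogonal_transformation_surj[OF orth] by (intro open_surjective_linear_image) auto
    then have "R' ` box (k l) (k w) \<in> sets lborel" by simp
    then show ?thesis by simp
  qed
  also have "\<dots> = emeasure lebesgue (box (k l) (k w))"
    using measurable_orthogonal_image[OF orth, of "box (k l) (k w)"] measure_orthogonal_image[OF orth, of "box (k l) (k w)"]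
    by (simp add: emeasure_eq_measure2)
  also have "\<dots> = emeasure lborel (box (k l) (k w))" by simp
  also have "\<dots> = emeasure (distr lborel borel h) (box l w)"
    using hm by (simp add: emeasure_distr hbox)
  also have "\<dots> = emeasure lborel (box l w)" using hd by simp
  also have "\<dots> = ennreal (\<Prod>b\<in>Basis. (w - l) \<bullet> b)" using lw by (rule emeasure_lborel_box)
  finally show "emeasure (distr lborel borel (\<lambda>z. u * z)) (box l w) = ennreal (\<Prod>b\<in>Basis. (w - l) \<bullet> b)" .
qed simp

text \<open>The disc \<pi> |z|^2 \<le> t has area t, so no Jacobian factor appears. This is why t =
  \<pi> |z|^2 is the radial variable throughout.\<close>

lemma lborel_complex_radial:
  "distr lborel borel (\<lambda>z::complex. pi * (cmod z)\<^sup>2) = density lborel (indicator {0..})"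
proof (rule measure_eqI_generator_eq[where \<Omega>=UNIV and E="range atMost" and A="\<lambda>i::nat. {..real i}"])
  show "Int_stable (range (atMost :: real \<Rightarrow> _))" by (auto simp: Int_stable_def)
  show "sets (distr lborel borel (\<lambda>z::complex. pi * (cmod z)\<^sup>2)) = sigma_sets UNIV (range (atMost :: real \<Rightarrow> _))"
    "sets (density lborel (indicator {0..})) = sigma_sets UNIV (range (atMost :: real \<Rightarrow> _))"
    by (simp_all add: borel_eq_atMost)
  have L: "emeasure (distr lborel borel (\<lambda>z::complex. pi * (cmod z)\<^sup>2)) {..t} = ennreal t" for t :: real
  proof (cases "t \<ge> 0")
    case True
    have "{z::complex. pi * (cmod z)\<^sup>2 \<le> t} = cball 0 (sqrt (t / pi))"
    proof -
      have 1: "pi * (cmod z)\<^sup>2 \<le> t \<longleftrightarrow> (cmod z)\<^sup>2 \<le> t / pi" for z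
        using pi_gt_zero by (simp add: pos_le_divide_eq mult.commute)
      have 2: "(cmod z)\<^sup>2 \<le> t / pi \<longleftrightarrow> cmod z \<le> sqrt (t / pi)" for z
        using real_sqrt_le_iff[of "(cmod z)\<^sup>2" "t / pi"] by simp
      show ?thesis by (simp add: 1 2 cball_def dist_norm)
    qed
    then have "emeasure (distr lborel borel (\<lambda>z::complex. pi * (cmod z)\<^sup>2)) {..t} = emeasure lborel (cball (0::complex) (sqrt (t / pi)))"
      by (simp add: emeasure_distr vimage_def)
    also have "\<dots> = ennreal (pi * (sqrt (t / pi))\<^sup>2)"
      using True by (subst emeasure_cball) (auto simp: unit_ball_vol_2)
    also have "\<dots> = ennreal t" using True by simp
    finally show ?thesis .
  next
    case False
    then have "{z::complex. pi * (cmod z)\<^sup>2 \<le> t} = {}"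
      by (auto simp: not_le intro: less_le_trans[of t 0])
    then show ?thesis using False by (simp add: emeasure_distr vimage_def ennreal_neg)
  qed
  have Rr: "emeasure (density lborel (indicator {0..})) {..t} = ennreal t" for t :: real
  proof -
    have "emeasure (density lborel (indicator {0..})) {..t} = (\<integral>\<^sup>+x. indicator {0..} x * indicator {..t} x \<partial>lborel)"
      by (rule emeasure_density) auto
    also have "\<dots> = (\<integral>\<^sup>+x. indicator {0..t} x \<partial>lborel)"
      by (intro nn_integral_cong) (auto split: split_indicator)
    finally show ?thesis by (cases "t \<ge> 0") (auto simp: ennreal_neg)
  qed
  show "emeasure (distr lborel borel (\<lambda>z::complex. pi * (cmod z)\<^sup>2)) X = emeasure (density lborel (indicator {0..})) X"
    if "X \<in> range atMost" for X :: "real set" using that L Rr by auto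
  show "emeasure (distr lborel borel (\<lambda>z::complex. pi * (cmod z)\<^sup>2)) {..real i} \<noteq> \<infinity>" for i
    by (simp add: L)
  show "(\<Union>i. {..real i}) = UNIV" using real_arch_simple by auto
qed auto

lemma cnj_measurable [measurable]: "cnj \<in> borel_measurable borel"
  by (intro borel_measurable_continuous_onI continuous_intros)

lemma fock_weight_nonneg [simp]: "0 \<le> fock_weight z"
  by (simp add: fock_weight_def)

lemma fock_weight_measurable [measurable]: "fock_weight \<in> borel_measurable borel"
  unfolding fock_weight_def[abs_def] by measurable

lemma ebasis_measurable [measurable]: "ebasis m \<in> borel_measurable borel"
  unfolding ebasis_def[abs_def] by measurable

lemma ebasis_norm: "(cmod (ebasis m z))\<^sup>2 = (pi * (cmod z)\<^sup>2) ^ m / fact m"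
  by (simp add: ebasis_def norm_mult norm_power power_mult_distrib mult.commute[of m] flip: power_mult)

lemma ebasis_density:
  "(cmod (ebasis m z))\<^sup>2 * fock_weight z = erlang_density m 1 (pi * (cmod z)\<^sup>2)"
proof -
  have "\<not> pi * (cmod z)\<^sup>2 < 0" by (simp add: not_less)
  then show ?thesis
    by (simp add: ebasis_norm erlang_density_def fock_weight_def)
qed

text \<open>The weighted square of \<open>ebasis m\<close> is a probability density on the plane,
  and the Gamma law is the law of \<pi> |z|^2 under it. Thus \<open>gam a m\<close> becomes a
  diagonal matrix entry of multiplication by a radial function.\<close>

lemma gmeas_eq_distr:
  "gmeas m = distr (density lborel (\<lambda>z. ennreal ((cmod (ebasis m z))\<^sup>2 * fock_weight z))) borel (\<lambda>z. pi * (cmod z)\<^sup>2)"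
proof (rule measure_eqI)
  fix S assume "S \<in> sets (gmeas m)"
  then have S [measurable]: "S \<in> sets borel" by simp
  have "emeasure (gmeas m) S = (\<integral>\<^sup>+t. ennreal (erlang_density m 1 t) * indicator S t \<partial>lborel)"
    unfolding gmeas_def by (rule emeasure_density) auto
  also have "\<dots> = (\<integral>\<^sup>+t. indicator {0..} t * (ennreal (erlang_density m 1 t) * indicator S t) \<partial>lborel)"
    by (intro nn_integral_cong) (auto simp: erlang_density_def split: split_indicator)
  also have "\<dots> = (\<integral>\<^sup>+t. ennreal (erlang_density m 1 t) * indicator S t \<partial>density lborel (indicator {0..}))"
    by (rule nn_integral_density[symmetric]) auto
  also have "\<dots> = (\<integral>\<^sup>+z. ennreal (erlang_density m 1 (pi * (cmod z)\<^sup>2)) * indicator S (pi * (cmod z)\<^sup>2) \<partial>(lborel :: complex measure))"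
    unfolding lborel_complex_radial[symmetric] by (rule nn_integral_distr) auto
  also have "\<dots> = (\<integral>\<^sup>+z. ennreal ((cmod (ebasis m z))\<^sup>2 * fock_weight z) * indicator ((\<lambda>z. pi * (cmod z)\<^sup>2) -` S) z \<partial>lborel)"
    by (simp add: ebasis_density indicator_vimage)
  also have "\<dots> = emeasure (density lborel (\<lambda>z. ennreal ((cmod (ebasis m z))\<^sup>2 * fock_weight z))) ((\<lambda>z. pi * (cmod z)\<^sup>2) -` S)"
  proof (rule emeasure_density[symmetric])
    have "(\<lambda>z::complex. pi * (cmod z)\<^sup>2) \<in> borel_measurable borel" by measurable
    from measurable_sets_borel[OF this S] show "(\<lambda>z::complex. pi * (cmod z)\<^sup>2) -` S \<in> sets lborel" by simp
  qed auto
  also have "\<dots> = emeasure (distr (density lborel (\<lambda>z. ennreal ((cmod (ebasis m z))\<^sup>2 * fock_weight z))) borel (\<lambda>z. pi * (cmod z)\<^sup>2)) S"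
    by (subst emeasure_distr) auto
  finally show "emeasure (gmeas m) S = \<dots>" .
qed simp

lemma radial_ebasis_diag:
  fixes a :: "real \<Rightarrow> complex"
  assumes [measurable]: "a \<in> borel_measurable borel"
  shows "(\<integral>z. a (pi * (cmod z)\<^sup>2) * (ebasis m z * cnj (ebasis m z)) * of_real (fock_weight z) \<partial>lborel) = gam a m"
    and "integrable lborel (\<lambda>z. a (pi * (cmod z)\<^sup>2) * (ebasis m z * cnj (ebasis m z)) * of_real (fock_weight z)) \<longleftrightarrow> integrable (gmeas m) a"
proof -
  have eq: "a (pi * (cmod z)\<^sup>2) * (ebasis m z * cnj (ebasis m z)) * of_real (fock_weight z) =
      ((cmod (ebasis m z))\<^sup>2 * fock_weight z) *\<^sub>R a (pi * (cmod z)\<^sup>2)" for z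
    by (simp add: complex_norm_square[symmetric] scaleR_conv_of_real)
  show "(\<integral>z. a (pi * (cmod z)\<^sup>2) * (ebasis m z * cnj (ebasis m z)) * of_real (fock_weight z) \<partial>lborel) = gam a m"
    unfolding gam_def gmeas_eq_distr eq by (subst integral_distr, simp, simp, subst integral_density) auto
  show "integrable lborel (\<lambda>z. a (pi * (cmod z)\<^sup>2) * (ebasis m z * cnj (ebasis m z)) * of_real (fock_weight z)) \<longleftrightarrow> integrable (gmeas m) a"
    unfolding gmeas_eq_distr eq by (subst integrable_distr_eq, simp, simp, subst integrable_density) auto
qed

text \<open>The rotation by pi / (m - n) multiplies the integrand by -1 and preserves the
  integral.\<close>

lemma radial_ebasis_offdiag:
  fixes a :: "real \<Rightarrow> complex"
  assumes [measurable]: "a \<in> borel_measurable borel" and mn: "m \<noteq> n"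
  shows "(\<integral>z. a (pi * (cmod z)\<^sup>2) * (ebasis m z * cnj (ebasis n z)) * of_real (fock_weight z) \<partial>lborel) = 0"
    (is "?I = 0")
proof -
  define q where "q = pi / (real m - real n)"
  define u where "u = cis q"
  have "cnj u = cis (- q)" by (simp add: u_def cis_cnj)
  then have "u ^ m * cnj u ^ n = cis (real m * q + real n * (- q))"
    by (simp only: u_def Complex.DeMoivre cis_mult)
  also have "real m * q + real n * (- q) = q * (real m - real n)"
    by (simp add: algebra_simps)
  also have "\<dots> = pi" using mn by (simp add: q_def)
  finally have um: "u ^ m * cnj u ^ n = -1" by simp
  have u: "cmod u = 1" by (simp add: u_def)
  define F where "F z = a (pi * (cmod z)\<^sup>2) * (ebasis m z * cnj (ebasis n z)) * of_real (fock_weight z)" for z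
  have [measurable]: "F \<in> borel_measurable borel" unfolding F_def by measurable
  have "F (u * z) = (u ^ m * cnj u ^ n) * F z" for z
    using u by (simp add: F_def ebasis_def fock_weight_def norm_mult power_mult_distrib mult_ac)
  then have "F (u * z) = - F z" for z using um by simp
  moreover have "integral\<^sup>L lborel F = (\<integral>z. F (u * z) \<partial>lborel)"
    by (subst lborel_complex_rotation[OF u, symmetric]) (rule integral_distr, auto)
  ultimately have "integral\<^sup>L lborel F = - integral\<^sup>L lborel F" by simp
  then show ?thesis by (simp add: F_def[abs_def])
qed

section \<open>The Fock space\<close>

text \<open>The ambient weighted L^2 space, without holomorphy: a symbol times a Fock function lies
  here before projection.\<close>

definition sqint :: "(complex \<Rightarrow> complex) \<Rightarrow> bool" where
  "sqint f \<longleftrightarrow> f \<in> borel_measurable borel \<and> integrable lborel (\<lambda>z. (cmod (f z))\<^sup>2 * fock_weight z)"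

lemma holomorphic_measurable:
  "f holomorphic_on UNIV \<Longrightarrow> f \<in> borel_measurable borel"
  by (intro borel_measurable_continuous_onI holomorphic_on_imp_continuous_on)

lemma fock_iff: "f \<in> fock \<longleftrightarrow> f holomorphic_on UNIV \<and> sqint f"
  by (auto simp: fock_def sqint_def intro: holomorphic_measurable)

lemma sqint_dominated:
  assumes f: "sqint f" and g: "g \<in> borel_measurable borel" and le: "\<And>z. cmod (g z) \<le> C * cmod (f z)"
  shows "sqint g"
  unfolding sqint_def
proof
  show "integrable lborel (\<lambda>z. (cmod (g z))\<^sup>2 * fock_weight z)"
  proof (rule Bochner_Integration.integrable_bound)
    show "integrable lborel (\<lambda>z. C\<^sup>2 * ((cmod (f z))\<^sup>2 * fock_weight z))"
      using f by (simp add: sqint_def)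
    show "AE z in lborel. norm ((cmod (g z))\<^sup>2 * fock_weight z) \<le> norm (C\<^sup>2 * ((cmod (f z))\<^sup>2 * fock_weight z))"
    proof (rule AE_I2)
      fix z
      have "(cmod (g z))\<^sup>2 \<le> (C * cmod (f z))\<^sup>2" using le by (intro power_mono) auto
      then have "(cmod (g z))\<^sup>2 * fock_weight z \<le> (C * cmod (f z))\<^sup>2 * fock_weight z"
        by (intro mult_right_mono) auto
      then show "norm ((cmod (g z))\<^sup>2 * fock_weight z) \<le> norm (C\<^sup>2 * ((cmod (f z))\<^sup>2 * fock_weight z))"
        by (simp add: power_mult_distrib mult.assoc)
    qed
  qed (use g in measurable)
qed (rule g)

lemma sqint_scale: "sqint f \<Longrightarrow> sqint (\<lambda>z. c * f z)"
  by (rule sqint_dominated[of f _ "cmod c"]) (auto simp: norm_mult sqint_def)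

lemma sqint_add:
  assumes "sqint f" "sqint g" shows "sqint (\<lambda>z. f z + g z)"
proof -
  have [measurable]: "f \<in> borel_measurable borel" "g \<in> borel_measurable borel"
    using assms by (auto simp: sqint_def)
  have "integrable lborel (\<lambda>z. (cmod (f z + g z))\<^sup>2 * fock_weight z)"
  proof (rule Bochner_Integration.integrable_bound)
    show "integrable lborel (\<lambda>z. 2 * ((cmod (f z))\<^sup>2 * fock_weight z) + 2 * ((cmod (g z))\<^sup>2 * fock_weight z))"
      using assms by (simp add: sqint_def)
    show "AE z in lborel. norm ((cmod (f z + g z))\<^sup>2 * fock_weight z) \<le> norm (2 * ((cmod (f z))\<^sup>2 * fock_weight z) + 2 * ((cmod (g z))\<^sup>2 * fock_weight z))"
    proof (rule AE_I2)
      fix z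
      have "(cmod (f z + g z))\<^sup>2 \<le> (cmod (f z) + cmod (g z))\<^sup>2"
        by (intro power_mono norm_triangle_ineq) auto
      also have "\<dots> \<le> 2 * (cmod (f z))\<^sup>2 + 2 * (cmod (g z))\<^sup>2"
        using zero_le_power2[of "cmod (f z) - cmod (g z)"] by (simp add: power2_eq_square algebra_simps)
      finally have "(cmod (f z + g z))\<^sup>2 * fock_weight z \<le> (2 * (cmod (f z))\<^sup>2 + 2 * (cmod (g z))\<^sup>2) * fock_weight z"
        by (intro mult_right_mono) auto
      then show "norm ((cmod (f z + g z))\<^sup>2 * fock_weight z) \<le> norm (2 * ((cmod (f z))\<^sup>2 * fock_weight z) + 2 * ((cmod (g z))\<^sup>2 * fock_weight z))"
        by (simp add: algebra_simps)
    qed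
  qed measurable
  then show ?thesis by (simp add: sqint_def)
qed

lemma sqint_diff: "sqint f \<Longrightarrow> sqint g \<Longrightarrow> sqint (\<lambda>z. f z - g z)"
  using sqint_add[of f "\<lambda>z. (-1) * g z"] sqint_scale[of g "-1"] by simp

lemma sqint_zero [simp]: "sqint (\<lambda>z. 0)"
  by (simp add: sqint_def)

lemma sqint_sum: "(\<And>i. i \<in> I \<Longrightarrow> sqint (f i)) \<Longrightarrow> sqint (\<lambda>z. \<Sum>i\<in>I. f i z)"
  by (induction I rule: infinite_finite_induct) (auto intro: sqint_add)

lemma sqint_integrable:
  assumes "sqint f" "sqint g"
  shows "integrable lborel (\<lambda>z. f z * cnj (g z) * of_real (fock_weight z))"
proof (rule Bochner_Integration.integrable_bound)
  have [measurable]: "f \<in> borel_measurable borel" "g \<in> borel_measurable borel"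
    using assms by (auto simp: sqint_def)
  show "integrable lborel (\<lambda>z. (cmod (f z))\<^sup>2 * fock_weight z + (cmod (g z))\<^sup>2 * fock_weight z)"
    using assms by (simp add: sqint_def)
  show "(\<lambda>z. f z * cnj (g z) * of_real (fock_weight z)) \<in> borel_measurable lborel" by measurable
  show "AE z in lborel. norm (f z * cnj (g z) * of_real (fock_weight z)) \<le> norm ((cmod (f z))\<^sup>2 * fock_weight z + (cmod (g z))\<^sup>2 * fock_weight z)"
  proof (rule AE_I2)
    fix z
    have "2 * (cmod (f z) * cmod (g z)) \<le> (cmod (f z))\<^sup>2 + (cmod (g z))\<^sup>2"
      using zero_le_power2[of "cmod (f z) - cmod (g z)"] by (simp add: power2_eq_square algebra_simps)
    moreover have "0 \<le> cmod (f z) * cmod (g z)" by simp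
    ultimately have "cmod (f z) * cmod (g z) \<le> (cmod (f z))\<^sup>2 + (cmod (g z))\<^sup>2" by linarith
    then have "cmod (f z) * cmod (g z) * fock_weight z \<le> ((cmod (f z))\<^sup>2 + (cmod (g z))\<^sup>2) * fock_weight z"
      by (intro mult_right_mono) auto
    then show "norm (f z * cnj (g z) * of_real (fock_weight z)) \<le> norm ((cmod (f z))\<^sup>2 * fock_weight z + (cmod (g z))\<^sup>2 * fock_weight z)"
      by (simp add: norm_mult algebra_simps)
  qed
qed

lemma finner_add: "sqint f \<Longrightarrow> sqint g \<Longrightarrow> sqint h \<Longrightarrow> finner (\<lambda>z. f z + g z) h = finner f h + finner g h"
  using sqint_integrable[of f h] sqint_integrable[of g h] by (simp add: finner_def distrib_right)

lemma finner_scale: "finner (\<lambda>z. c * f z) h = c * finner f h"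
  by (simp add: finner_def mult.assoc)

lemma finner_diff: "sqint f \<Longrightarrow> sqint g \<Longrightarrow> sqint h \<Longrightarrow> finner (\<lambda>z. f z - g z) h = finner f h - finner g h"
  using sqint_integrable[of f h] sqint_integrable[of g h] by (simp add: finner_def left_diff_distrib)

lemma finner_zero [simp]: "finner (\<lambda>z. 0) h = 0"
  by (simp add: finner_def)

lemma finner_sum:
  "(\<And>i. i \<in> I \<Longrightarrow> sqint (f i)) \<Longrightarrow> sqint h \<Longrightarrow> finner (\<lambda>z. \<Sum>i\<in>I. f i z) h = (\<Sum>i\<in>I. finner (f i) h)"
  by (induction I rule: infinite_finite_induct) (auto simp: finner_add sqint_sum)

lemma finner_cnj: "finner g f = cnj (finner f g)"
proof -
  have "cnj (finner f g) = (\<integral>z. cnj (f z * cnj (g z) * of_real (fock_weight z)) \<partial>lborel)"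
    unfolding finner_def by (rule Bochner_Integration.integral_cnj[symmetric])
  then show ?thesis by (simp add: finner_def mult_ac)
qed

lemma fnorm_nonneg [simp]: "0 \<le> fnorm f"
  by (simp add: fnorm_def)

lemma fnorm_power2: "(fnorm f)\<^sup>2 = (\<integral>z. (cmod (f z))\<^sup>2 * fock_weight z \<partial>lborel)"
  by (simp add: fnorm_def)

lemma finner_self: "finner f f = of_real ((fnorm f)\<^sup>2)"
proof -
  have "finner f f = (\<integral>z. complex_of_real ((cmod (f z))\<^sup>2 * fock_weight z) \<partial>lborel)"
    by (simp add: finner_def complex_norm_square[symmetric])
  then show ?thesis by (simp only: fnorm_power2 integral_complex_of_real)
qed

lemma finner_Cauchy_Schwarz:
  assumes f: "sqint f" and g: "sqint g"
  shows "cmod (finner f g) \<le> fnorm f * fnorm g"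
proof -
  have [measurable]: "f \<in> borel_measurable borel" "g \<in> borel_measurable borel"
    using assms by (auto simp: sqint_def)
  define F where "F z = cmod (f z) * sqrt (fock_weight z)" for z
  define G where "G z = cmod (g z) * sqrt (fock_weight z)" for z
  have [measurable]: "F \<in> borel_measurable borel" "G \<in> borel_measurable borel"
    unfolding F_def G_def by measurable
  have sq: "(\<integral>\<^sup>+z. (ennreal (F z))\<^sup>2 \<partial>lborel) = ennreal ((fnorm f)\<^sup>2)" "(\<integral>\<^sup>+z. (ennreal (G z))\<^sup>2 \<partial>lborel) = ennreal ((fnorm g)\<^sup>2)"
    unfolding F_def G_def fnorm_power2 using f g
    by (auto simp: sqint_def ennreal_power power_mult_distrib intro!: nn_integral_eq_integral)
  have FG: "F z * G z = cmod (f z * cnj (g z) * of_real (fock_weight z))" for z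
    by (simp add: F_def G_def norm_mult)
  have int: "integrable lborel (\<lambda>z. F z * G z)"
    unfolding FG by (intro integrable_norm sqint_integrable f g)
  have FG0: "0 \<le> (\<integral>z. F z * G z \<partial>lborel)" unfolding FG by simp
  have "(\<integral>\<^sup>+z. ennreal (F z) * ennreal (G z) \<partial>lborel) = (\<integral>\<^sup>+z. ennreal (F z * G z) \<partial>lborel)"
    by (intro nn_integral_cong ennreal_mult[symmetric]) (auto simp: F_def G_def)
  also have "\<dots> = ennreal (\<integral>z. F z * G z \<partial>lborel)"
    using int by (intro nn_integral_eq_integral) (auto simp: F_def G_def)
  finally have eq: "(\<integral>\<^sup>+z. ennreal (F z) * ennreal (G z) \<partial>lborel) = ennreal (\<integral>z. F z * G z \<partial>lborel)" .
  have "ennreal ((\<integral>z. F z * G z \<partial>lborel)\<^sup>2) \<le> ennreal ((fnorm f)\<^sup>2) * ennreal ((fnorm g)\<^sup>2)"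
    using Cauchy_Schwarz_nn_integral[of "\<lambda>z. ennreal (F z)" lborel "\<lambda>z. ennreal (G z)"] FG0
    unfolding eq sq by (simp add: ennreal_power)
  also have "\<dots> = ennreal ((fnorm f * fnorm g)\<^sup>2)"
    by (simp add: ennreal_mult[symmetric] power_mult_distrib)
  finally have "(\<integral>z. F z * G z \<partial>lborel)\<^sup>2 \<le> (fnorm f * fnorm g)\<^sup>2" by simp
  then have "(\<integral>z. F z * G z \<partial>lborel) \<le> fnorm f * fnorm g"
    by (rule power2_le_imp_le) simp
  moreover have "cmod (finner f g) \<le> (\<integral>z. F z * G z \<partial>lborel)"
    unfolding finner_def FG by (rule integral_norm_bound)
  ultimately show ?thesis by linarith
qed

lemma ebasis_holomorphic: "ebasis m holomorphic_on UNIV"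
  unfolding ebasis_def[abs_def] by (intro holomorphic_intros)

lemma sqint_ebasis [simp]: "sqint (ebasis m)"
proof -
  have "integrable lborel (\<lambda>z. (1::complex) * (ebasis m z * cnj (ebasis m z)) * of_real (fock_weight z))"
    by (subst radial_ebasis_diag(2)) auto
  then have "integrable lborel (\<lambda>z. complex_of_real ((cmod (ebasis m z))\<^sup>2 * fock_weight z))"
    by (simp add: complex_norm_square[symmetric])
  then have "integrable lborel (\<lambda>z. (cmod (ebasis m z))\<^sup>2 * fock_weight z)"
    by (simp only: complex_of_real_integrable_eq)
  then show ?thesis by (simp add: sqint_def)
qed

lemma ebasis_fock [simp]: "ebasis m \<in> fock"
  by (simp add: fock_iff ebasis_holomorphic)

lemma finner_radial_ebasis:
  fixes a :: "real \<Rightarrow> complex"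
  assumes "a \<in> borel_measurable borel"
  shows "finner (\<lambda>z. a (pi * (cmod z)\<^sup>2) * ebasis m z) (ebasis n) = (if m = n then gam a m else 0)"
  using radial_ebasis_diag(1)[OF assms, of m] radial_ebasis_offdiag[OF assms, of m n]
  by (auto simp: finner_def mult.assoc)

lemma finner_ebasis: "finner (ebasis m) (ebasis n) = (if m = n then 1 else 0)"
  using finner_radial_ebasis[of "\<lambda>_. 1" m n] by (simp add: gam_def)

lemma fnorm_ebasis [simp]: "fnorm (ebasis m) = 1"
proof -
  have "complex_of_real ((fnorm (ebasis m))\<^sup>2) = 1"
    unfolding finner_self[symmetric] by (simp add: finner_ebasis)
  then have "(fnorm (ebasis m))\<^sup>2 = 1" by (simp only: of_real_eq_1_iff)
  then show ?thesis using fnorm_nonneg[of "ebasis m"] by (simp add: power2_eq_1_iff)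
qed

section \<open>Power series in the basis and Parseval's identity\<close>

lemma series_entire:
  assumes "\<And>z. (\<lambda>m. c m * ebasis m z) sums f z"
  shows "f holomorphic_on UNIV"
proof -
  have "f field_differentiable (at z)" for z
  proof -
    have "f holomorphic_on ball 0 (cmod z + 1)"
      by (rule power_series_holomorphic[where a = "\<lambda>m. c m * of_real (sqrt (pi ^ m / fact m))"])
         (use assms in \<open>simp add: ebasis_def mult.assoc\<close>)
    then show ?thesis
      by (rule holomorphic_on_imp_differentiable_at) auto
  qed
  then show ?thesis by (simp add: holomorphic_on_def field_differentiable_at_within)
qed

text \<open>Convergence at a point of modulus |z| + 1 gives absolute convergence at z.\<close>

lemma series_abs_summable:
  assumes "\<And>z. (\<lambda>m. c m * ebasis m z) sums f z"
  shows "summable (\<lambda>m. cmod (c m) * cmod (ebasis m z))"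
proof -
  have "summable (\<lambda>m. c m * of_real (sqrt (pi ^ m / fact m)) * of_real (cmod z + 1) ^ m)"
    using sums_summable[OF assms[of "of_real (cmod z + 1)"]] by (simp add: ebasis_def mult.assoc)
  moreover have "norm z < norm (complex_of_real (cmod z + 1))"
    unfolding norm_of_real by simp
  ultimately have "summable (\<lambda>m. norm (c m * of_real (sqrt (pi ^ m / fact m)) * z ^ m))"
    by (rule powser_insidea)
  then show ?thesis by (simp add: ebasis_def norm_mult mult.assoc)
qed

text \<open>Parseval is proved on discs, where the series converges uniformly, because termwise
  integration over the whole plane is not justified beforehand.\<close>

lemma parseval_disc:
  assumes c: "\<And>z. (\<lambda>m. c m * ebasis m z) sums f z"
  shows "(\<lambda>m. (cmod (c m))\<^sup>2 * measure (gmeas m) {..\<rho>}) sums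
    (\<integral>z. indicator {..\<rho>} (pi * (cmod z)\<^sup>2) * ((cmod (f z))\<^sup>2 * fock_weight z) \<partial>lborel)"
    and "integrable lborel (\<lambda>z. indicator {..\<rho>} (pi * (cmod z)\<^sup>2) * ((cmod (f z))\<^sup>2 * fock_weight z))"
proof -
  have [measurable]: "f \<in> borel_measurable borel"
    by (rule holomorphic_measurable[OF series_entire[OF c]])
  \<comment> \<open>The cutoff to the disc is itself radial, so the basis stays orthogonal on the
    disc and only the norms shrink, to \<open>measure (gmeas m) {..\<rho>}\<close>.\<close>
  define a :: "real \<Rightarrow> complex" where "a t = of_real (indicator {..\<rho>} t)" for t
  have [measurable]: "a \<in> borel_measurable borel" unfolding a_def by measurable
  have gama: "gam a m = of_real (measure (gmeas m) {..\<rho>})" for m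
    unfolding gam_def a_def by (subst integral_complex_of_real) simp
  have sqa: "sqint (\<lambda>z. a (pi * (cmod z)\<^sup>2) * ebasis m z)" for m
    by (rule sqint_dominated[OF sqint_ebasis[of m], of _ 1]) (auto simp: a_def norm_mult split: split_indicator)
  define s where "s N z = (\<Sum>m<N. c m * ebasis m z)" for N z
  have [measurable]: "s N \<in> borel_measurable borel" for N unfolding s_def by measurable
  have sqs: "sqint (s N)" for N
    unfolding s_def by (intro sqint_sum sqint_scale) simp
  have fin: "(\<integral>z. indicator {..\<rho>} (pi * (cmod z)\<^sup>2) * ((cmod (s N z))\<^sup>2 * fock_weight z) \<partial>lborel)
     = (\<Sum>m<N. (cmod (c m))\<^sup>2 * measure (gmeas m) {..\<rho>})" for N
  proof -
    have "complex_of_real (\<integral>z. indicator {..\<rho>} (pi * (cmod z)\<^sup>2) * ((cmod (s N z))\<^sup>2 * fock_weight z) \<partial>lborel)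
      = finner (\<lambda>z. \<Sum>m<N. c m * (a (pi * (cmod z)\<^sup>2) * ebasis m z)) (s N)"
      unfolding finner_def integral_complex_of_real[symmetric]
    proof (rule Bochner_Integration.integral_cong[OF refl])
      fix z
      have "(\<Sum>m<N. c m * (a (pi * (cmod z)\<^sup>2) * ebasis m z)) = a (pi * (cmod z)\<^sup>2) * s N z"
        by (simp add: s_def sum_distrib_left mult_ac)
      then show "complex_of_real (indicator {..\<rho>} (pi * (cmod z)\<^sup>2) * ((cmod (s N z))\<^sup>2 * fock_weight z)) =
         (\<Sum>m<N. c m * (a (pi * (cmod z)\<^sup>2) * ebasis m z)) * cnj (s N z) * of_real (fock_weight z)"
        using complex_norm_square[of "s N z"] by (simp add: a_def mult.assoc)
    qed
    also have "\<dots> = (\<Sum>m<N. c m * finner (\<lambda>z. a (pi * (cmod z)\<^sup>2) * ebasis m z) (s N))"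
      by (subst finner_sum) (auto simp: finner_scale intro!: sqint_scale sqa sqs)
    also have "\<dots> = (\<Sum>m<N. c m * (cnj (c m) * gam a m))"
    proof (rule sum.cong[OF refl])
      fix m assume m: "m \<in> {..<N}"
      have "finner (s N) (\<lambda>z. a (pi * (cmod z)\<^sup>2) * ebasis m z) = (\<Sum>n<N. c n * finner (ebasis n) (\<lambda>z. a (pi * (cmod z)\<^sup>2) * ebasis m z))"
        unfolding s_def by (subst finner_sum) (auto simp: finner_scale intro!: sqint_scale sqa)
      also have "\<dots> = (\<Sum>n<N. c n * cnj (if m = n then gam a m else 0))"
        using finner_radial_ebasis[of a m] by (simp add: finner_cnj[of "ebasis _"])
      also have "\<dots> = (\<Sum>n<N. if m = n then c n * cnj (gam a m) else 0)"
        by (intro sum.cong) auto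
      also have "\<dots> = c m * cnj (gam a m)" using m by simp
      finally show "c m * finner (\<lambda>z. a (pi * (cmod z)\<^sup>2) * ebasis m z) (s N) = c m * (cnj (c m) * gam a m)"
        by (subst finner_cnj) simp
    qed
    also have "\<dots> = of_real (\<Sum>m<N. (cmod (c m))\<^sup>2 * measure (gmeas m) {..\<rho>})"
      unfolding of_real_sum
    proof (rule sum.cong[OF refl])
      fix m
      show "c m * (cnj (c m) * gam a m) = of_real ((cmod (c m))\<^sup>2 * measure (gmeas m) {..\<rho>})"
        unfolding of_real_mult complex_norm_square gama by (simp only: mult.assoc)
    qed
    finally show ?thesis by (simp only: of_real_eq_iff)
  qed
  \<comment> \<open>The boundary point where all monomials are largest on the disc; its absolute
    series \<open>K\<close> dominates every partial sum. The \<open>max\<close> covers negative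
    \<rho>, where the disc is empty.\<close>
  define r where "r = complex_of_real (sqrt (max \<rho> 0 / pi))"
  define K where "K = (\<Sum>m. cmod (c m) * cmod (ebasis m r))"
  have sK: "summable (\<lambda>m. cmod (c m) * cmod (ebasis m r))" by (rule series_abs_summable[OF c])
  have sb: "cmod (s N z) \<le> K" if "pi * (cmod z)\<^sup>2 \<le> \<rho>" for N z
  proof -
    have "(cmod z)\<^sup>2 \<le> max \<rho> 0 / pi" using that by (simp add: pos_le_divide_eq mult.commute)
    then have "cmod z \<le> cmod r"
      using real_sqrt_le_iff[of "(cmod z)\<^sup>2" "max \<rho> 0 / pi"] by (simp add: r_def)
    then have "cmod (ebasis m z) \<le> cmod (ebasis m r)" for m
      by (auto simp: ebasis_def norm_mult norm_power intro!: mult_left_mono power_mono)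
    then have "cmod (s N z) \<le> (\<Sum>m<N. cmod (c m) * cmod (ebasis m r))"
      unfolding s_def by (intro sum_norm_le) (auto simp: norm_mult intro!: mult_left_mono)
    also have "\<dots> \<le> K" unfolding K_def by (intro sum_le_suminf sK) auto
    finally show ?thesis .
  qed
  have w: "integrable lborel fock_weight"
    using sqint_ebasis[of 0] by (simp add: sqint_def ebasis_def)
  have lim: "(\<lambda>N. s N z) \<longlonglongrightarrow> f z" for z
    using c[of z] unfolding sums_def s_def by simp
  note dc = integral_dominated_convergence[of "\<lambda>z. indicator {..\<rho>} (pi * (cmod z)\<^sup>2) * ((cmod (f z))\<^sup>2 * fock_weight z)" lborel
    "\<lambda>N z. indicator {..\<rho>} (pi * (cmod z)\<^sup>2) * ((cmod (s N z))\<^sup>2 * fock_weight z)" "\<lambda>z. K\<^sup>2 * fock_weight z"]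
    integrable_dominated_convergence[of "\<lambda>z. indicator {..\<rho>} (pi * (cmod z)\<^sup>2) * ((cmod (f z))\<^sup>2 * fock_weight z)" lborel
    "\<lambda>N z. indicator {..\<rho>} (pi * (cmod z)\<^sup>2) * ((cmod (s N z))\<^sup>2 * fock_weight z)" "\<lambda>z. K\<^sup>2 * fock_weight z"]
  have m1: "(\<lambda>z. indicator {..\<rho>} (pi * (cmod z)\<^sup>2) * ((cmod (f z))\<^sup>2 * fock_weight z)) \<in> borel_measurable lborel"
    "\<And>N. (\<lambda>z. indicator {..\<rho>} (pi * (cmod z)\<^sup>2) * ((cmod (s N z))\<^sup>2 * fock_weight z)) \<in> borel_measurable lborel"
    by measurable
  have iK: "integrable lborel (\<lambda>z. K\<^sup>2 * fock_weight z)" using w by simp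
  have l1: "AE z in lborel. (\<lambda>N. indicator {..\<rho>} (pi * (cmod z)\<^sup>2) * ((cmod (s N z))\<^sup>2 * fock_weight z)) \<longlonglongrightarrow> indicator {..\<rho>} (pi * (cmod z)\<^sup>2) * ((cmod (f z))\<^sup>2 * fock_weight z)"
    by (intro AE_I2 tendsto_intros lim)
  have b1: "AE z in lborel. norm (indicator {..\<rho>} (pi * (cmod z)\<^sup>2) * ((cmod (s N z))\<^sup>2 * fock_weight z)) \<le> K\<^sup>2 * fock_weight z" for N
    using sb by (intro AE_I2) (auto simp: indicator_def intro!: mult_right_mono power_mono)
  show "integrable lborel (\<lambda>z. indicator {..\<rho>} (pi * (cmod z)\<^sup>2) * ((cmod (f z))\<^sup>2 * fock_weight z))"
    by (rule dc(2)[OF m1 iK l1 b1])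
  show "(\<lambda>m. (cmod (c m))\<^sup>2 * measure (gmeas m) {..\<rho>}) sums
    (\<integral>z. indicator {..\<rho>} (pi * (cmod z)\<^sup>2) * ((cmod (f z))\<^sup>2 * fock_weight z) \<partial>lborel)"
    using dc(1)[OF m1 iK l1 b1] unfolding sums_def fin .
qed

text \<open>Both sides are monotone limits over growing discs in the extended reals, so infinite
  values are allowed. The identity thus yields summable coefficients from square integrability and
  conversely.\<close>

lemma parseval_nn:
  assumes c: "\<And>z. (\<lambda>m. c m * ebasis m z) sums f z"
  shows "(\<integral>\<^sup>+z. ennreal ((cmod (f z))\<^sup>2 * fock_weight z) \<partial>lborel) = (\<Sum>m. ennreal ((cmod (c m))\<^sup>2))"
proof -
  have [measurable]: "f \<in> borel_measurable borel"
    by (rule holomorphic_measurable[OF series_entire[OF c]])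
  define D where "D = density lborel (\<lambda>z. ennreal ((cmod (f z))\<^sup>2 * fock_weight z))"
  define B where "B n = {z::complex. pi * (cmod z)\<^sup>2 \<le> real n}" for n
  have Bm [measurable]: "B n \<in> sets borel" for n unfolding B_def by measurable
  have disc: "(\<Sum>m. ennreal ((cmod (c m))\<^sup>2) * emeasure (gmeas m) {..real n}) = emeasure D (B n)" for n
  proof -
    have "(\<Sum>m. ennreal ((cmod (c m))\<^sup>2) * emeasure (gmeas m) {..real n}) = (\<Sum>m. ennreal ((cmod (c m))\<^sup>2 * measure (gmeas m) {..real n}))"
      by (simp add: gm.emeasure_eq_measure ennreal_mult)
    also have "\<dots> = ennreal (\<integral>z. indicator {..real n} (pi * (cmod z)\<^sup>2) * ((cmod (f z))\<^sup>2 * fock_weight z) \<partial>lborel)"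
      using parseval_disc(1)[OF c] by (intro suminf_ennreal_eq) auto
    also have "\<dots> = (\<integral>\<^sup>+z. ennreal (indicator {..real n} (pi * (cmod z)\<^sup>2) * ((cmod (f z))\<^sup>2 * fock_weight z)) \<partial>lborel)"
      using parseval_disc(2)[OF c] by (intro nn_integral_eq_integral[symmetric]) auto
    also have "\<dots> = (\<integral>\<^sup>+z. ennreal ((cmod (f z))\<^sup>2 * fock_weight z) * indicator (B n) z \<partial>lborel)"
      by (intro nn_integral_cong) (auto simp: B_def split: split_indicator)
    also have "\<dots> = emeasure D (B n)" unfolding D_def by (rule emeasure_density[symmetric]) auto
    finally show ?thesis .
  qed
  have "(\<Sum>m. ennreal ((cmod (c m))\<^sup>2)) = (\<Sum>m. SUP n. ennreal ((cmod (c m))\<^sup>2) * emeasure (gmeas m) {..real n})"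
  proof (rule suminf_cong)
    fix m
    have "(SUP n. emeasure (gmeas m) {..real n}) = emeasure (gmeas m) (\<Union>n. {..real n})"
      by (rule SUP_emeasure_incseq) (auto simp: incseq_def)
    also have "(\<Union>n. {..real n}) = UNIV" using real_arch_simple by auto
    finally show "ennreal ((cmod (c m))\<^sup>2) = (SUP n. ennreal ((cmod (c m))\<^sup>2) * emeasure (gmeas m) {..real n})"
      by (simp add: SUP_mult_left_ennreal[symmetric] gm.emeasure_eq_measure)
  qed
  also have "\<dots> = (SUP n. \<Sum>m. ennreal ((cmod (c m))\<^sup>2) * emeasure (gmeas m) {..real n})"
    by (rule ennreal_suminf_SUP_eq) (auto simp: incseq_def intro!: mult_left_mono emeasure_mono)
  also have "\<dots> = (SUP n. emeasure D (B n))" by (simp only: disc)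
  also have "\<dots> = emeasure D (\<Union>n. B n)"
    by (rule SUP_emeasure_incseq) (auto simp: incseq_def D_def B_def intro: order.trans)
  also have "(\<Union>n. B n) = UNIV" unfolding B_def using real_arch_simple by auto
  also have "emeasure D UNIV = (\<integral>\<^sup>+z. ennreal ((cmod (f z))\<^sup>2 * fock_weight z) \<partial>lborel)"
    unfolding D_def by (subst emeasure_density) auto
  finally show ?thesis by simp
qed

section \<open>Diagonal and radial Toeplitz operators\<close>

lemma sums_rewrite: "f sums s \<Longrightarrow> (\<And>n. f n = g n) \<Longrightarrow> g sums s"
  by (simp add: sums_def)

lemma series_fnorm:
  assumes c: "\<And>z. (\<lambda>m. c m * ebasis m z) sums f z" and f: "sqint f"
  shows "(\<lambda>m. (cmod (c m))\<^sup>2) sums (fnorm f)\<^sup>2"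
proof -
  have "(\<Sum>m. ennreal ((cmod (c m))\<^sup>2)) = ennreal ((fnorm f)\<^sup>2)"
    unfolding parseval_nn[OF c, symmetric] fnorm_power2 using f
    by (intro nn_integral_eq_integral) (auto simp: sqint_def)
  note e = this
  have s: "summable (\<lambda>m. (cmod (c m))\<^sup>2)"
    by (rule summable_suminf_not_top) (simp_all add: e)
  have "(\<Sum>m. ennreal ((cmod (c m))\<^sup>2)) = ennreal (\<Sum>m. (cmod (c m))\<^sup>2)"
    by (rule suminf_ennreal2) (simp, rule s)
  from trans[OF this[symmetric] e] have "ennreal (\<Sum>m. (cmod (c m))\<^sup>2) = ennreal ((fnorm f)\<^sup>2)" .
  moreover have "0 \<le> (\<Sum>m. (cmod (c m))\<^sup>2)" by (rule suminf_nonneg[OF s]) simp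
  ultimately have "(\<Sum>m. (cmod (c m))\<^sup>2) = (fnorm f)\<^sup>2"
    by (subst (asm) ennreal_inj) auto
  then show ?thesis using s by (simp add: sums_iff)
qed

lemma series_sqint:
  assumes c: "\<And>z. (\<lambda>m. c m * ebasis m z) sums f z" and s: "summable (\<lambda>m. (cmod (c m))\<^sup>2)"
  shows "sqint f"
proof -
  have [measurable]: "f \<in> borel_measurable borel"
    by (rule holomorphic_measurable[OF series_entire[OF c]])
  have "(\<integral>\<^sup>+z. ennreal ((cmod (f z))\<^sup>2 * fock_weight z) \<partial>lborel) = ennreal (\<Sum>m. (cmod (c m))\<^sup>2)"
    unfolding parseval_nn[OF c] using s by (intro suminf_ennreal2) auto
  then have "integrable lborel (\<lambda>z. (cmod (f z))\<^sup>2 * fock_weight z)"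
    by (intro integrableI_nn_integral_finite[where x = "\<Sum>m. (cmod (c m))\<^sup>2"]) (auto intro: suminf_nonneg s)
  then show ?thesis by (simp add: sqint_def)
qed

text \<open>The remainder is again such a series, with its first N coefficients set to zero, so
  Parseval turns its norm into the tail of a convergent sum.\<close>

lemma series_tail:
  assumes c: "\<And>z. (\<lambda>m. c m * ebasis m z) sums f z" and f: "sqint f"
  shows "(\<lambda>N. fnorm (\<lambda>z. f z - (\<Sum>m<N. c m * ebasis m z))) \<longlonglongrightarrow> 0"
proof -
  define F where "F N z = f z - (\<Sum>m<N. c m * ebasis m z)" for N z
  have F: "(fnorm (F N))\<^sup>2 = (fnorm f)\<^sup>2 - (\<Sum>m<N. (cmod (c m))\<^sup>2)" for N
  proof -
    have *: "(\<lambda>m. if m < N then g m else 0) sums (\<Sum>m<N. g m)" for g :: "nat \<Rightarrow> 'b::real_normed_vector"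
      using sums_If_finite_set[of "{..<N}" g] by simp
    have "(\<lambda>m. (if m < N then 0 else c m) * ebasis m z) sums F N z" for z
    proof -
      have "(\<lambda>m. c m * ebasis m z - (if m < N then c m * ebasis m z else 0)) sums F N z"
        unfolding F_def by (intro sums_diff c *)
      then show ?thesis by (rule sums_rewrite) auto
    qed
    moreover have "sqint (F N)"
      unfolding F_def by (intro sqint_diff f sqint_sum sqint_scale sqint_ebasis)
    ultimately have 1: "(\<lambda>m. (cmod (if m < N then 0 else c m))\<^sup>2) sums (fnorm (F N))\<^sup>2"
      by (rule series_fnorm)
    have "(\<lambda>m. (cmod (c m))\<^sup>2 - (if m < N then (cmod (c m))\<^sup>2 else 0)) sums ((fnorm f)\<^sup>2 - (\<Sum>m<N. (cmod (c m))\<^sup>2))"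
      by (intro sums_diff series_fnorm c f *)
    then have "(\<lambda>m. (cmod (if m < N then 0 else c m))\<^sup>2) sums ((fnorm f)\<^sup>2 - (\<Sum>m<N. (cmod (c m))\<^sup>2))"
      by (rule sums_rewrite) auto
    with 1 show ?thesis by (rule sums_unique2)
  qed
  have "(\<lambda>N. sqrt ((fnorm f)\<^sup>2 - (\<Sum>m<N. (cmod (c m))\<^sup>2))) \<longlonglongrightarrow> sqrt ((fnorm f)\<^sup>2 - (fnorm f)\<^sup>2)"
    using series_fnorm[OF c f] unfolding sums_def by (intro tendsto_intros)
  moreover have "sqrt ((fnorm f)\<^sup>2 - (\<Sum>m<N. (cmod (c m))\<^sup>2)) = fnorm (F N)" for N
    unfolding F[symmetric] by simp
  ultimately show ?thesis by (simp add: F_def[abs_def])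
qed

text \<open>The second argument may be any square integrable function; this allows testing against a
  symbol times a basis vector.\<close>

lemma series_finner:
  assumes c: "\<And>z. (\<lambda>m. c m * ebasis m z) sums f z" and f: "sqint f" and g: "sqint g"
  shows "(\<lambda>m. c m * finner (ebasis m) g) sums finner f g"
proof -
  have eq: "finner f g - (\<Sum>m<N. c m * finner (ebasis m) g) = finner (\<lambda>z. f z - (\<Sum>m<N. c m * ebasis m z)) g" for N
    using f g by (subst finner_diff) (auto intro!: sqint_sum sqint_scale simp: finner_sum finner_scale sqint_scale)
  have bound: "cmod ((\<Sum>m<N. c m * finner (ebasis m) g) - finner f g) \<le> fnorm (\<lambda>z. f z - (\<Sum>m<N. c m * ebasis m z)) * fnorm g" for N
    unfolding norm_minus_commute[of _ "finner f g"] eq using f g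
    by (intro finner_Cauchy_Schwarz sqint_diff sqint_sum sqint_scale) auto
  have "(\<lambda>N. fnorm (\<lambda>z. f z - (\<Sum>m<N. c m * ebasis m z)) * fnorm g) \<longlonglongrightarrow> 0 * fnorm g"
    by (intro tendsto_intros series_tail c f)
  then have lim: "(\<lambda>N. fnorm (\<lambda>z. f z - (\<Sum>m<N. c m * ebasis m z)) * fnorm g) \<longlonglongrightarrow> 0" by simp
  have "(\<lambda>N. (\<Sum>m<N. c m * finner (ebasis m) g) - finner f g) \<longlonglongrightarrow> 0"
    by (rule Lim_null_comparison[OF _ lim]) (intro always_eventually allI bound)
  then show ?thesis unfolding sums_def by (simp add: LIM_zero_iff)
qed

section \<open>Coefficients of Fock space functions\<close>

definition coef :: "(complex \<Rightarrow> complex) \<Rightarrow> nat \<Rightarrow> complex" where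
  "coef f m = finner f (ebasis m)"

lemma series_coef:
  assumes c: "\<And>z. (\<lambda>m. c m * ebasis m z) sums f z" and f: "sqint f"
  shows "coef f = c"
proof
  fix n
  have "(\<lambda>m. c m * finner (ebasis m) (ebasis n)) sums coef f n"
    unfolding coef_def by (rule series_finner[OF c f]) simp
  then have "(\<lambda>m. if m = n then c m else 0) sums coef f n"
    by (rule sums_cong[THEN iffD1, rotated]) (auto simp: finner_ebasis)
  then show "coef f n = c n" using sums_single[of n c] sums_unique2 by blast
qed

lemma fock_sqint: "f \<in> fock \<Longrightarrow> sqint f"
  by (simp add: fock_iff)

text \<open>The Taylor series supplies some expansion in the rescaled monomials, and
  \<open>series_coef\<close> forces its coefficients to be the inner products.\<close>

lemma coef_sums:
  assumes "f \<in> fock"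
  shows "(\<lambda>m. coef f m * ebasis m z) sums f z"
proof -
  define s where "s m = complex_of_real (sqrt (pi ^ m / fact m))" for m
  have s: "s m \<noteq> 0" for m by (simp add: s_def)
  define c where "c m = (deriv ^^ m) f 0 / fact m / s m" for m
  have "(\<lambda>m. c m * ebasis m z) sums f z" for z
  proof -
    have "f holomorphic_on ball 0 (cmod z + 1)"
      using assms holomorphic_on_subset by (auto simp: fock_iff)
    then have "(\<lambda>m. (deriv ^^ m) f 0 / fact m * (z - 0) ^ m) sums f z"
      by (rule holomorphic_power_series) simp
    moreover have "(deriv ^^ m) f 0 / fact m * (z - 0) ^ m = c m * ebasis m z" for m
      using s[of m] by (simp add: c_def ebasis_def s_def[symmetric])
    ultimately show ?thesis by simp
  qed
  then show ?thesis using series_coef[of c f] fock_sqint[OF assms] by simp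
qed

lemma coef_norm_sums: "f \<in> fock \<Longrightarrow> (\<lambda>m. (cmod (coef f m))\<^sup>2) sums (fnorm f)\<^sup>2"
  by (rule series_fnorm[OF coef_sums fock_sqint])

lemma coef_bound:
  assumes "f \<in> fock" shows "cmod (coef f m) \<le> fnorm f"
  using finner_Cauchy_Schwarz[OF fock_sqint[OF assms] sqint_ebasis[of m]] by (simp add: coef_def)

lemma fock_eqI:
  assumes "f \<in> fock" "g \<in> fock" "\<And>m. coef f m = coef g m"
  shows "f = g"
proof
  fix z show "f z = g z"
    using coef_sums[OF assms(1), of z] coef_sums[OF assms(2), of z] assms(3) by (simp add: sums_unique2)
qed

lemma finner_coef_sums:
  assumes "f \<in> fock" "g \<in> fock"
  shows "(\<lambda>m. coef f m * cnj (coef g m)) sums finner f g"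
  using series_finner[OF coef_sums[OF assms(1)] fock_sqint[OF assms(1)] fock_sqint[OF assms(2)]]
  by (simp add: coef_def finner_cnj[of "ebasis _" g])

lemma fock_add: "f \<in> fock \<Longrightarrow> g \<in> fock \<Longrightarrow> (\<lambda>z. f z + g z) \<in> fock"
  by (auto simp: fock_iff intro: sqint_add holomorphic_intros)

lemma fock_diff: "f \<in> fock \<Longrightarrow> g \<in> fock \<Longrightarrow> (\<lambda>z. f z - g z) \<in> fock"
  by (auto simp: fock_iff intro: sqint_diff holomorphic_intros)

lemma fock_scale: "f \<in> fock \<Longrightarrow> (\<lambda>z. c * f z) \<in> fock"
  by (auto simp: fock_iff intro: sqint_scale holomorphic_intros)

lemma fock_zero [simp]: "(\<lambda>z. 0) \<in> fock"
  by (auto simp: fock_iff)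

lemma fock_sum: "(\<And>i. i \<in> I \<Longrightarrow> f i \<in> fock) \<Longrightarrow> (\<lambda>z. \<Sum>i\<in>I. f i z) \<in> fock"
  by (induction I rule: infinite_finite_induct) (auto intro: fock_add)

lemma coef_add: "f \<in> fock \<Longrightarrow> g \<in> fock \<Longrightarrow> coef (\<lambda>z. f z + g z) m = coef f m + coef g m"
  by (simp add: coef_def finner_add fock_sqint)

lemma coef_diff: "f \<in> fock \<Longrightarrow> g \<in> fock \<Longrightarrow> coef (\<lambda>z. f z - g z) m = coef f m - coef g m"
  by (simp add: coef_def finner_diff fock_sqint)

lemma coef_scale: "coef (\<lambda>z. c * f z) m = c * coef f m"
  by (simp add: coef_def finner_scale)

lemma coef_sum: "(\<And>i. i \<in> I \<Longrightarrow> f i \<in> fock) \<Longrightarrow> coef (\<lambda>z. \<Sum>i\<in>I. f i z) m = (\<Sum>i\<in>I. coef (f i) m)"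
  by (simp add: coef_def finner_sum fock_sqint)

lemma coef_ebasis: "coef (ebasis m) n = (if m = n then 1 else 0)"
  by (simp add: coef_def finner_ebasis)

section \<open>Synthesis from coefficients and diagonal operators\<close>

definition synth :: "(nat \<Rightarrow> complex) \<Rightarrow> complex \<Rightarrow> complex" where
  "synth c z = (\<Sum>m. c m * ebasis m z)"

lemma ebasis_norm_summable: "summable (\<lambda>m. (cmod (ebasis m z))\<^sup>2)"
  using summable_exp_generic[of "pi * (cmod z)\<^sup>2"] by (simp add: ebasis_norm divide_inverse mult.commute)

lemma synth_sums:
  assumes "summable (\<lambda>m. (cmod (c m))\<^sup>2)"
  shows "(\<lambda>m. c m * ebasis m z) sums synth c z"
proof -
  have "summable (\<lambda>m. c m * ebasis m z)"
  proof (rule summable_comparison_test')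
    show "summable (\<lambda>m. (cmod (c m))\<^sup>2 + (cmod (ebasis m z))\<^sup>2)"
      by (intro summable_add assms ebasis_norm_summable)
    fix m
    have "2 * (cmod (c m) * cmod (ebasis m z)) \<le> (cmod (c m))\<^sup>2 + (cmod (ebasis m z))\<^sup>2"
      using zero_le_power2[of "cmod (c m) - cmod (ebasis m z)"] by (simp add: power2_eq_square algebra_simps)
    moreover have "0 \<le> cmod (c m) * cmod (ebasis m z)" by simp
    ultimately show "norm (c m * ebasis m z) \<le> (cmod (c m))\<^sup>2 + (cmod (ebasis m z))\<^sup>2"
      unfolding norm_mult by linarith
  qed
  then show ?thesis by (simp add: synth_def summable_sums)
qed

lemma synth_fock:
  assumes "summable (\<lambda>m. (cmod (c m))\<^sup>2)"
  shows "synth c \<in> fock"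
  using series_entire[OF synth_sums] series_sqint[OF synth_sums] assms by (simp add: fock_iff)

lemma coef_synth:
  assumes "summable (\<lambda>m. (cmod (c m))\<^sup>2)"
  shows "coef (synth c) = c"
  using series_coef[OF synth_sums] fock_sqint[OF synth_fock] assms by blast

text \<open>The zero branch follows the normalisation in \<open>bops\<close>, so that eigenvalues
  determine the operator as a function.\<close>

definition diagop :: "(nat \<Rightarrow> complex) \<Rightarrow> (complex \<Rightarrow> complex) \<Rightarrow> complex \<Rightarrow> complex" where
  "diagop x f = (if f \<in> fock then synth (\<lambda>m. x m * coef f m) else (\<lambda>_. 0))"

lemma diagop_bound:
  assumes x: "\<And>m. cmod (x m) \<le> B" and f: "f \<in> fock"
  shows "diagop x f \<in> fock" "coef (diagop x f) m = x m * coef f m" "fnorm (diagop x f) \<le> B * fnorm f"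
proof -
  have B: "B \<ge> 0" using order.trans[OF norm_ge_zero x[of 0]] .
  have le: "(cmod (x m * coef f m))\<^sup>2 \<le> B\<^sup>2 * (cmod (coef f m))\<^sup>2" for m
    unfolding norm_mult power_mult_distrib using x by (intro mult_right_mono power_mono) auto
  have s: "summable (\<lambda>m. B\<^sup>2 * (cmod (coef f m))\<^sup>2)"
    using coef_norm_sums[OF f] by (intro summable_mult) (simp add: sums_iff)
  have sx: "summable (\<lambda>m. (cmod (x m * coef f m))\<^sup>2)"
    by (rule summable_comparison_test'[OF s]) (use le in simp)
  have D: "diagop x f = synth (\<lambda>m. x m * coef f m)" using f by (simp add: diagop_def)
  show D1: "diagop x f \<in> fock" unfolding D by (rule synth_fock[OF sx])
  show D2: "coef (diagop x f) m = x m * coef f m" for m unfolding D by (simp add: coef_synth[OF sx])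
  have "(fnorm (diagop x f))\<^sup>2 \<le> B\<^sup>2 * (fnorm f)\<^sup>2"
    using coef_norm_sums[OF D1] sums_mult[OF coef_norm_sums[OF f], of "B\<^sup>2"]
    by (rule sums_le[rotated]) (use le in \<open>simp add: D2\<close>)
  then have "(fnorm (diagop x f))\<^sup>2 \<le> (B * fnorm f)\<^sup>2" by (simp add: power_mult_distrib)
  then show "fnorm (diagop x f) \<le> B * fnorm f"
    by (rule power2_le_imp_le) (use B in simp)
qed

lemma diagop_fock:
  assumes "bounded (range x)" "f \<in> fock"
  shows "diagop x f \<in> fock" "coef (diagop x f) m = x m * coef f m"
proof -
  obtain B where B: "\<And>m. cmod (x m) \<le> B" using assms(1) bounded_rangeE by blast
  show "diagop x f \<in> fock" "coef (diagop x f) m = x m * coef f m"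
    using diagop_bound[OF B assms(2)] by auto
qed

lemma diagop_bops:
  assumes x: "bounded (range x)"
  shows "diagop x \<in> bops"
proof -
  obtain B where B: "\<And>m. cmod (x m) \<le> B" using x bounded_rangeE by blast
  note D = diagop_fock[OF x]
  have "diagop x (\<lambda>z. f z + g z) = (\<lambda>z. diagop x f z + diagop x g z)" if "f \<in> fock" "g \<in> fock" for f g
    by (rule fock_eqI) (use that in \<open>auto simp: D fock_add coef_add distrib_left\<close>)
  moreover have "diagop x (\<lambda>z. c * f z) = (\<lambda>z. c * diagop x f z)" if "f \<in> fock" for f c
    by (rule fock_eqI) (use that in \<open>auto simp: D fock_scale coef_scale\<close>)
  moreover have "\<exists>C. \<forall>f\<in>fock. fnorm (diagop x f) \<le> C * fnorm f"
    using diagop_bound(3)[of x B] B by blast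
  moreover have "diagop x f = (\<lambda>_. 0)" if "f \<notin> fock" for f
    using that by (simp add: diagop_def)
  ultimately show ?thesis using D(1) by (simp add: bops_def)
qed

lemma diagop_eqI:
  assumes S: "S \<in> bops" and x: "bounded (range x)"
    and eq: "\<And>f m. f \<in> fock \<Longrightarrow> coef (S f) m = x m * coef f m"
  shows "S = diagop x"
proof
  fix f
  show "S f = diagop x f"
  proof (cases "f \<in> fock")
    case True
    then show ?thesis
      using S by (intro fock_eqI) (auto simp: bops_def diagop_fock[OF x] eq)
  next
    case False
    then show ?thesis using S by (simp add: bops_def diagop_def)
  qed
qed

lemma Gamma_diagop: "bounded (range x) \<Longrightarrow> Gamma_op (diagop x) = x"
  by (rule ext) (simp add: Gamma_op_def coef_def[symmetric] diagop_fock coef_ebasis)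

lemma bounded_range_add:
  fixes x y :: "'a \<Rightarrow> complex"
  shows "bounded (range x) \<Longrightarrow> bounded (range y) \<Longrightarrow> bounded (range (\<lambda>m. x m + y m))"
  by (rule bounded_plus_comp)

lemma bounded_range_mult:
  fixes x y :: "'a \<Rightarrow> complex"
  assumes "bounded (range x)" "bounded (range y)" shows "bounded (range (\<lambda>m. x m * y m))"
proof -
  obtain B where B: "B > 0" "\<And>m. cmod (x m) \<le> B" using assms(1) bounded_rangeE by blast
  obtain C where C: "C > 0" "\<And>m. cmod (y m) \<le> C" using assms(2) bounded_rangeE by blast
  show ?thesis
    using B C by (intro bounded_rangeI[of _ "B * C"]) (auto simp: norm_mult intro!: mult_mono)
qed

lemma bounded_range_scale:
  fixes x :: "'a \<Rightarrow> complex"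
  shows "bounded (range x) \<Longrightarrow> bounded (range (\<lambda>m. c * x m))"
  using bounded_range_mult[of "\<lambda>_. c" x] by auto

lemma bounded_range_cnj:
  fixes x :: "'a \<Rightarrow> complex"
  shows "bounded (range x) \<Longrightarrow> bounded (range (\<lambda>m. cnj (x m)))"
  by (auto simp: bounded_iff)

lemma op_add_diagop:
  assumes "bounded (range x)" "bounded (range y)"
  shows "op_add (diagop x) (diagop y) = diagop (\<lambda>m. x m + y m)"
proof
  fix f
  show "op_add (diagop x) (diagop y) f = diagop (\<lambda>m. x m + y m) f"
  proof (cases "f \<in> fock")
    case True
    then show ?thesis unfolding op_add_def
      by (intro fock_eqI) (auto simp: diagop_fock coef_add bounded_range_add assms fock_add distrib_right)
  qed (simp add: op_add_def diagop_def)
qed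

lemma op_scale_diagop:
  assumes "bounded (range x)"
  shows "op_scale c (diagop x) = diagop (\<lambda>m. c * x m)"
proof
  fix f
  show "op_scale c (diagop x) f = diagop (\<lambda>m. c * x m) f"
  proof (cases "f \<in> fock")
    case True
    then show ?thesis unfolding op_scale_def
      by (intro fock_eqI) (auto simp: diagop_fock coef_scale bounded_range_scale assms fock_scale)
  qed (simp add: op_scale_def diagop_def)
qed

lemma op_comp_diagop:
  assumes "bounded (range x)" "bounded (range y)"
  shows "op_comp (diagop x) (diagop y) = diagop (\<lambda>m. x m * y m)"
proof
  fix f
  show "op_comp (diagop x) (diagop y) f = diagop (\<lambda>m. x m * y m) f"
  proof (cases "f \<in> fock")
    case True
    then show ?thesis unfolding op_comp_def
      by (intro fock_eqI) (auto simp: diagop_fock bounded_range_mult assms)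
  next
    case False
    \<comment> \<open>Off the Fock space the inner operator returns the zero function, which lies in
      the Fock space, so the outer one must be evaluated there.\<close>
    have "coef (\<lambda>z. 0) m = 0" for m by (simp add: coef_def)
    then have "diagop x (\<lambda>z. 0) = (\<lambda>z. 0)"
      by (intro fock_eqI) (auto simp: diagop_fock assms)
    then show ?thesis using False by (simp add: op_comp_def diagop_def)
  qed
qed

lemma is_adjoint_diagop:
  assumes "bounded (range x)"
  shows "is_adjoint (diagop x) (diagop (\<lambda>m. cnj (x m)))"
  unfolding is_adjoint_def
proof (intro ballI)
  fix f g assume fg: "f \<in> fock" "g \<in> fock"
  have "(\<lambda>m. coef (diagop x f) m * cnj (coef g m)) sums finner (diagop x f) g"
    by (rule finner_coef_sums) (use fg assms in \<open>simp_all add: diagop_fock\<close>)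
  moreover have "(\<lambda>m. coef f m * cnj (coef (diagop (\<lambda>m. cnj (x m)) g) m)) sums finner f (diagop (\<lambda>m. cnj (x m)) g)"
    by (rule finner_coef_sums) (use fg assms in \<open>simp_all add: diagop_fock bounded_range_cnj\<close>)
  ultimately show "finner (diagop x f) g = finner f (diagop (\<lambda>m. cnj (x m)) g)"
    using fg assms by (simp add: diagop_fock bounded_range_cnj mult_ac sums_unique2)
qed

text \<open>\<open>cstar_closed\<close> provides some adjoint within the algebra; this identifies it
  as the conjugate diagonal operator, so conjugate sequences stay in the algebra.\<close>

lemma is_adjoint_diagop_unique:
  assumes "bounded (range x)" "T \<in> bops" "is_adjoint (diagop x) T"
  shows "T = diagop (\<lambda>m. cnj (x m))"
proof (rule diagop_eqI)
  fix g m assume g: "g \<in> fock"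
  have Tg: "T g \<in> fock" using assms(2) g by (simp add: bops_def)
  have "finner (ebasis m) (T g) = finner (diagop x (ebasis m)) g"
    using assms(3) g by (simp add: is_adjoint_def)
  also have "diagop x (ebasis m) = (\<lambda>z. x m * ebasis m z)"
    by (rule fock_eqI) (auto simp: diagop_fock assms fock_scale coef_scale coef_ebasis)
  finally have "finner (ebasis m) (T g) = x m * finner (ebasis m) g" by (simp add: finner_scale)
  then show "coef (T g) m = cnj (x m) * coef g m"
    unfolding coef_def by (subst (1 2) finner_cnj) simp
qed (use assms bounded_range_cnj in auto)

lemma bops_sum:
  assumes S: "S \<in> bops" and f: "\<And>i. i \<in> I \<Longrightarrow> f i \<in> fock"
  shows "S (\<lambda>z. \<Sum>i\<in>I. f i z) = (\<lambda>z. \<Sum>i\<in>I. S (f i) z)"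
proof -
  have S0: "S (\<lambda>z. 0) = (\<lambda>z. 0)"
  proof -
    have "\<forall>f\<in>fock. \<forall>c. S (\<lambda>z. c * f z) = (\<lambda>z. c * S f z)" using S by (simp add: bops_def)
    from this[rule_format, OF fock_zero, of 0] show ?thesis by simp
  qed
  show ?thesis using f
  proof (induction I rule: infinite_finite_induct)
    case (insert i I)
    have "\<forall>f\<in>fock. \<forall>g\<in>fock. S (\<lambda>z. f z + g z) = (\<lambda>z. S f z + S g z)" using S by (simp add: bops_def)
    from this[rule_format, of "f i" "\<lambda>z. \<Sum>i\<in>I. f i z"] show ?case
      using insert by (simp add: fock_sum)
  qed (auto simp: S0)
qed

text \<open>The matrix determines the operator: the basis expansion converges in norm, and
  boundedness carries the convergence through S.\<close>

lemma bops_coef_sums: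
  assumes S: "S \<in> bops" and f: "f \<in> fock"
  shows "(\<lambda>m. coef f m * coef (S (ebasis m)) n) sums coef (S f) n"
proof -
  have "\<exists>C. \<forall>f\<in>fock. fnorm (S f) \<le> C * fnorm f" using S by (simp add: bops_def)
  then obtain C where C: "\<And>f. f \<in> fock \<Longrightarrow> fnorm (S f) \<le> C * fnorm f" by blast
  have Sf: "S f \<in> fock" if "f \<in> fock" for f using S that by (simp add: bops_def)
  have Sadd: "S (\<lambda>z. f z + g z) = (\<lambda>z. S f z + S g z)" if "f \<in> fock" "g \<in> fock" for f g
    using S that by (simp add: bops_def)
  have Sscale: "S (\<lambda>z. c * f z) = (\<lambda>z. c * S f z)" if "f \<in> fock" for f c
    using S that by (simp add: bops_def)
  define F where "F N z = (\<Sum>m<N. coef f m * ebasis m z)" for N z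
  have F: "F N \<in> fock" for N unfolding F_def by (intro fock_sum fock_scale) simp
  have fF: "(\<lambda>z. f z - F N z) \<in> fock" for N by (intro fock_diff f F)
  have eq: "coef (S f) n - (\<Sum>m<N. coef f m * coef (S (ebasis m)) n) = coef (S (\<lambda>z. f z - F N z)) n" for N
  proof -
    have "S f = (\<lambda>z. S (\<lambda>z. f z - F N z) z + S (F N) z)"
      using Sadd[OF fF[of N] F[of N]] by simp
    also have "S (F N) = (\<lambda>z. \<Sum>m<N. coef f m * S (ebasis m) z)"
      unfolding F_def by (subst bops_sum[OF S]) (auto intro: fock_scale simp: Sscale)
    finally have "S f = (\<lambda>z. S (\<lambda>z. f z - F N z) z + (\<Sum>m<N. coef f m * S (ebasis m) z))" .
    then have "coef (S f) n = coef (S (\<lambda>z. f z - F N z)) n + coef (\<lambda>z. \<Sum>m<N. coef f m * S (ebasis m) z) n"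
      using coef_add[OF Sf[OF fF] fock_sum, of "{..<N}" "\<lambda>m z. coef f m * S (ebasis m) z"] by (simp add: fock_scale Sf)
    also have "coef (\<lambda>z. \<Sum>m<N. coef f m * S (ebasis m) z) n = (\<Sum>m<N. coef f m * coef (S (ebasis m)) n)"
      by (subst coef_sum) (auto simp: coef_scale intro!: fock_scale Sf)
    finally show ?thesis by simp
  qed
  have bound: "cmod ((\<Sum>m<N. coef f m * coef (S (ebasis m)) n) - coef (S f) n) \<le> C * fnorm (\<lambda>z. f z - F N z)" for N
    unfolding norm_minus_commute[of _ "coef (S f) n"] eq
    using coef_bound[OF Sf[OF fF]] C[OF fF] order.trans by blast
  have "(\<lambda>N. C * fnorm (\<lambda>z. f z - F N z)) \<longlonglongrightarrow> C * 0"
    unfolding F_def by (intro tendsto_intros series_tail coef_sums fock_sqint f)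
  then have lim: "(\<lambda>N. C * fnorm (\<lambda>z. f z - F N z)) \<longlonglongrightarrow> 0" by simp
  have "(\<lambda>N. (\<Sum>m<N. coef f m * coef (S (ebasis m)) n) - coef (S f) n) \<longlonglongrightarrow> 0"
    by (rule Lim_null_comparison[OF _ lim]) (intro always_eventually allI bound)
  then show ?thesis unfolding sums_def by (simp add: LIM_zero_iff)
qed

section \<open>Radial Toeplitz operators as diagonal operators\<close>

lemma fock_proj_radial:
  fixes a0 :: "real \<Rightarrow> complex"
  assumes a0: "a0 \<in> borel_measurable borel" "bounded (range a0)" and a: "a \<in> borel_measurable borel"
    and ae: "AE z in lborel. a z = a0 (pi * (cmod z)\<^sup>2)" and f: "f \<in> fock"
  shows "fock_proj (\<lambda>z. a z * f z) = diagop (gam a0) f"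
proof -
  obtain B where B: "\<And>t. cmod (a0 t) \<le> B" using a0(2) bounded_rangeE by blast
  have bg: "bounded (range (gam a0))" using gam_bound[OF B] by (rule bounded_rangeI)
  have [measurable]: "a0 \<in> borel_measurable borel" "a \<in> borel_measurable borel" "f \<in> borel_measurable borel"
    using a0 a fock_sqint[OF f] by (auto simp: sqint_def)
  define g where "g z = a0 (pi * (cmod z)\<^sup>2) * f z" for z
  have sq: "sqint (\<lambda>z. a0 (pi * (cmod z)\<^sup>2) * k z)" if "sqint k" for k
    using that B by (intro sqint_dominated[OF that, of _ B]) (auto simp: norm_mult mult_right_mono sqint_def)
  have sg: "sqint g" unfolding g_def by (rule sq[OF fock_sqint[OF f]])
  define h0 where "h0 = diagop (gam a0) f"
  have h0: "h0 \<in> fock" "\<And>m. coef h0 m = gam a0 m * coef f m"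
    unfolding h0_def using diagop_fock[OF bg f] by auto
  \<comment> \<open>The symbol moves, conjugated, to the second slot, so that the expansion of f can
    be inserted in the first; orthogonality leaves one term.\<close>
  have gm: "finner g (ebasis m) = gam a0 m * coef f m" for m
  proof -
    have [measurable]: "(\<lambda>t. cnj (a0 t)) \<in> borel_measurable borel" by measurable
    have sqc: "sqint (\<lambda>z. cnj (a0 (pi * (cmod z)\<^sup>2)) * ebasis m z)"
      using B by (intro sqint_dominated[OF sqint_ebasis[of m], of _ B]) (auto simp: norm_mult mult_right_mono)
    have "finner g (ebasis m) = finner f (\<lambda>z. cnj (a0 (pi * (cmod z)\<^sup>2)) * ebasis m z)"
      unfolding finner_def g_def by (simp add: mult_ac)
    moreover have "(\<lambda>n. coef f n * finner (ebasis n) (\<lambda>z. cnj (a0 (pi * (cmod z)\<^sup>2)) * ebasis m z)) sums finner f (\<lambda>z. cnj (a0 (pi * (cmod z)\<^sup>2)) * ebasis m z)"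
      by (rule series_finner[OF coef_sums[OF f] fock_sqint[OF f] sqc])
    moreover have "finner (ebasis n) (\<lambda>z. cnj (a0 (pi * (cmod z)\<^sup>2)) * ebasis m z) = (if n = m then gam a0 m else 0)" for n
    proof -
      have "finner (ebasis n) (\<lambda>z. cnj (a0 (pi * (cmod z)\<^sup>2)) * ebasis m z) = finner (\<lambda>z. a0 (pi * (cmod z)\<^sup>2) * ebasis n z) (ebasis m)"
        unfolding finner_def by (simp add: mult_ac)
      then show ?thesis using finner_radial_ebasis[OF a0(1), of n m] by simp
    qed
    ultimately have "(\<lambda>n. coef f n * (if n = m then gam a0 m else 0)) sums finner g (ebasis m)" by simp
    then have "(\<lambda>n. if n = m then coef f n * gam a0 m else 0) sums finner g (ebasis m)"
      by (rule sums_rewrite) auto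
    then have "finner g (ebasis m) = coef f m * gam a0 m"
      using sums_single[of m "\<lambda>n. coef f n * gam a0 m"] sums_unique2 by blast
    then show ?thesis by simp
  qed
  have eqd: "finner (\<lambda>z. a z * f z - h z) k = finner g k - finner h k" if "h \<in> fock" "k \<in> fock" for h k
  proof -
    have [measurable]: "h \<in> borel_measurable borel" "k \<in> borel_measurable borel"
      using that fock_sqint by (auto simp: sqint_def)
    have "finner (\<lambda>z. a z * f z - h z) k = finner (\<lambda>z. g z - h z) k"
      unfolding finner_def g_def by (rule integral_cong_AE) (use ae in \<open>auto elim!: eventually_mono\<close>)
    then show ?thesis using that sg fock_sqint by (simp add: finner_diff)
  qed
  \<comment> \<open>Agreement on the basis extends to every test function k by expanding k; this is
    the orthogonality required of the projection.\<close>
  have gk: "finner g k = finner h0 k" if k: "k \<in> fock" for k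
  proof -
    have "(\<lambda>m. coef k m * finner (ebasis m) g) sums finner k g"
      by (rule series_finner[OF coef_sums[OF k] fock_sqint[OF k] sg])
    moreover have "(\<lambda>m. coef k m * finner (ebasis m) h0) sums finner k h0"
      by (rule series_finner[OF coef_sums[OF k] fock_sqint[OF k] fock_sqint[OF h0(1)]])
    moreover have "finner (ebasis m) g = finner (ebasis m) h0" for m
      by (subst (1 2) finner_cnj) (simp add: gm h0(2)[unfolded coef_def] coef_def)
    ultimately have "finner k g = finner k h0" by (simp add: sums_unique2)
    then show ?thesis by (subst (1 2) finner_cnj) simp
  qed
  show ?thesis
    unfolding fock_proj_def h0_def[symmetric]
  proof (rule the_equality)
    show "h0 \<in> fock \<and> (\<forall>k\<in>fock. finner (\<lambda>z. a z * f z - h0 z) k = 0)"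
      using h0 gk by (simp add: eqd)
    fix h assume h: "h \<in> fock \<and> (\<forall>k\<in>fock. finner (\<lambda>z. a z * f z - h z) k = 0)"
    then have "finner g (ebasis m) - finner h (ebasis m) = 0" for m by (metis eqd ebasis_fock)
    then have "coef h m = gam a0 m * coef f m" for m by (simp add: gm coef_def)
    then show "h = h0" using h h0 by (intro fock_eqI) auto
  qed
qed

lemma toeplitz_radial:
  fixes a0 :: "real \<Rightarrow> complex"
  assumes "a0 \<in> borel_measurable borel" "bounded (range a0)"
  shows "(\<lambda>z. a0 (pi * (cmod z)\<^sup>2)) \<in> radial_Linf" "toeplitz (\<lambda>z. a0 (pi * (cmod z)\<^sup>2)) = diagop (gam a0)"
proof -
  have [measurable]: "a0 \<in> borel_measurable borel" by fact
  obtain B where B: "\<And>t. cmod (a0 t) \<le> B" using assms(2) bounded_rangeE by blast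
  show "(\<lambda>z. a0 (pi * (cmod z)\<^sup>2)) \<in> radial_Linf"
    unfolding radial_Linf_def using B by (auto intro: exI[of _ "\<lambda>r. a0 (pi * r\<^sup>2)"])
  have m: "(\<lambda>z::complex. a0 (pi * (cmod z)\<^sup>2)) \<in> borel_measurable borel" by measurable
  show "toeplitz (\<lambda>z. a0 (pi * (cmod z)\<^sup>2)) = diagop (gam a0)"
    using fock_proj_radial[OF assms m] by (auto simp: toeplitz_def diagop_def fun_eq_iff)
qed

text \<open>Radial symbols are measurable functions on the plane bounded almost everywhere, whereas
  \<open>gam\<close> averages are taken of everywhere bounded Borel functions on the line; both
  properties have to be arranged.\<close>

lemma radial_Linf_toeplitz:
  assumes "a \<in> radial_Linf"
  obtains a0 :: "real \<Rightarrow> complex"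
  where "a0 \<in> borel_measurable borel" "bounded (range a0)" "toeplitz a = diagop (gam a0)"
proof -
  obtain C a1 where am [measurable]: "a \<in> borel_measurable borel" and C: "AE z in lborel. cmod (a z) \<le> C" and a1: "\<And>z. a z = a1 (cmod z)"
    using assms by (auto simp: radial_Linf_def)
  \<comment> \<open>The profile \<open>a1\<close> comes without measurability; restricting the Borel
    function \<open>a\<close> to the real axis gives a measurable profile in the variable t.\<close>
  define b where "b t = a (of_real (sqrt (t / pi)))" for t
  have [measurable]: "b \<in> borel_measurable borel" unfolding b_def by measurable
  \<comment> \<open>Values above the essential bound are reset to 0, which changes the symbol on a
    null set only.\<close>
  define a0 where "a0 t = (if cmod (b t) \<le> C then b t else 0)" for t
  have a0m: "a0 \<in> borel_measurable borel" unfolding a0_def by measurable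
  have a0b: "bounded (range a0)"
    by (rule bounded_rangeI[of _ "max C 0"]) (auto simp: a0_def)
  have "b (pi * (cmod z)\<^sup>2) = a z" for z by (simp add: b_def a1)
  then have ae: "AE z in lborel. a z = a0 (pi * (cmod z)\<^sup>2)"
    using C by (auto elim!: eventually_mono simp: a0_def)
  have "toeplitz a = diagop (gam a0)"
    using fock_proj_radial[OF a0m a0b am ae] by (auto simp: toeplitz_def diagop_def fun_eq_iff)
  then show ?thesis using that a0m a0b by blast
qed

section \<open>Berezin transforms of radial operators\<close>

definition egf :: "(nat \<Rightarrow> complex) \<Rightarrow> complex \<Rightarrow> complex" where
  "egf x z = (\<Sum>m. x m / fact m * z ^ m)"

lemma egf_sums:
  assumes "bounded (range x)"
  shows "(\<lambda>m. x m / fact m * z ^ m) sums egf x z"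
proof -
  obtain B where B: "B > 0" "\<And>m. cmod (x m) \<le> B" using assms bounded_rangeE by blast
  have "summable (\<lambda>m. x m / fact m * z ^ m)"
  proof (rule summable_comparison_test')
    show "summable (\<lambda>m. B * (inverse (fact m) * cmod z ^ m))"
      using summable_exp[of "cmod z"] by (rule summable_mult)
    fix m
    have "cmod (x m) * (inverse (fact m) * cmod z ^ m) \<le> B * (inverse (fact m) * cmod z ^ m)"
      using B by (intro mult_right_mono) auto
    moreover have "norm (x m / fact m * z ^ m) = cmod (x m) * (inverse (fact m) * cmod z ^ m)"
      unfolding norm_mult norm_divide norm_power norm_fact by (simp add: divide_inverse)
    ultimately show "norm (x m / fact m * z ^ m) \<le> B * (inverse (fact m) * cmod z ^ m)" by simp
  qed
  then show ?thesis by (simp add: egf_def summable_sums)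
qed

lemma egf_deriv:
  assumes "bounded (range x)"
  shows "(egf x has_field_derivative egf (\<lambda>m. x (Suc m)) z) (at z)"
proof -
  define c where "c m = x m / fact m" for m
  have "((\<lambda>z. \<Sum>m. c m * z ^ m) has_field_derivative (\<Sum>m. diffs c m * z ^ m)) (at z)"
  proof (rule termdiffs_strong)
    show "summable (\<lambda>m. c m * of_real (cmod z + 1) ^ m)"
      unfolding c_def using egf_sums[OF assms] by (rule sums_summable)
    show "norm z < norm (complex_of_real (cmod z + 1))" unfolding norm_of_real by simp
  qed
  moreover have "diffs c m = x (Suc m) / fact m" for m
    by (simp add: diffs_def c_def del: of_nat_Suc)
  ultimately show ?thesis unfolding egf_def[abs_def] c_def by simp
qed

lemma bounded_range_Suc:
  fixes x :: "nat \<Rightarrow> complex"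
  shows "bounded (range x) \<Longrightarrow> bounded (range (\<lambda>m. x (Suc m)))"
  by (rule bounded_subset) auto

lemma bounded_range_diff:
  fixes x y :: "'a \<Rightarrow> complex"
  shows "bounded (range x) \<Longrightarrow> bounded (range y) \<Longrightarrow> bounded (range (\<lambda>m. x m - y m))"
  by (rule bounded_minus_comp)

lemma egf_diff:
  assumes "bounded (range x)" "bounded (range y)"
  shows "egf (\<lambda>m. x m - y m) z = egf x z - egf y z"
proof -
  have "(\<lambda>m. x m / fact m * z ^ m - y m / fact m * z ^ m) sums (egf x z - egf y z)"
    by (intro sums_diff egf_sums assms)
  then have "(\<lambda>m. (x m - y m) / fact m * z ^ m) sums (egf x z - egf y z)"
    by (rule sums_rewrite) (simp add: diff_divide_distrib left_diff_distrib)
  then show ?thesis by (simp add: egf_def sums_iff)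
qed

text \<open>For real z \<ge> 0 this is the mean of x under the Poisson law with parameter z. It is
  kept as an entire function so that complex differentiation and power series apply.\<close>

definition bsum :: "(nat \<Rightarrow> complex) \<Rightarrow> complex \<Rightarrow> complex" where
  "bsum x z = exp (- z) * egf x z"

definition fdiff :: "(nat \<Rightarrow> complex) \<Rightarrow> nat \<Rightarrow> complex" where
  "fdiff x m = x (Suc m) - x m"

lemma bounded_fdiff: "bounded (range x) \<Longrightarrow> bounded (range (fdiff x))"
  unfolding fdiff_def[abs_def] by (intro bounded_range_diff bounded_range_Suc)

text \<open>Differentiating the generating function shifts the sequence and differentiating the
  exponential subtracts it, so derivatives become forward differences.\<close>

lemma bsum_deriv:
  assumes "bounded (range x)"
  shows "(bsum x has_field_derivative bsum (fdiff x) z) (at z)"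
proof -
  have "((\<lambda>z. exp (- z) * egf x z) has_field_derivative - exp (- z) * egf x z + exp (- z) * egf (\<lambda>m. x (Suc m)) z) (at z)"
    by (auto intro!: derivative_eq_intros egf_deriv[OF assms])
  moreover have "- exp (- z) * egf x z + exp (- z) * egf (\<lambda>m. x (Suc m)) z = bsum (fdiff x) z"
    unfolding bsum_def fdiff_def[abs_def] by (subst egf_diff) (auto simp: assms bounded_range_Suc algebra_simps)
  ultimately show ?thesis by (simp add: bsum_def[abs_def])
qed

text \<open>Multiplication by z shifts the index, turning z times the second difference into m y (m
  - 1); adding the first difference gives \<open>Lop\<close>. Convergence is part of the claim:
  \<open>Lop x\<close> is not assumed bounded here, so \<open>egf_sums\<close> does not apply to
  it.\<close>

lemma egf_Lop_sums:
  assumes x: "bounded (range x)"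
  shows "(\<lambda>m. Lop x m / fact m * z ^ m) sums (egf (fdiff x) z + z * egf (fdiff (fdiff x)) z)"
proof -
  let ?y = "fdiff (fdiff x)"
  have "(\<lambda>m. z * (?y m / fact m * z ^ m)) sums (z * egf ?y z)"
    by (intro sums_mult egf_sums bounded_fdiff x)
  then have "(\<lambda>m. of_nat (Suc m) * ?y m / fact (Suc m) * z ^ Suc m) sums (z * egf ?y z)"
    by (rule sums_rewrite) (simp del: of_nat_Suc)
  then have "(\<lambda>m. of_nat m * ?y (m - 1) / fact m * z ^ m) sums (z * egf ?y z)"
    using sums_Suc_iff[of "\<lambda>m. of_nat m * ?y (m - 1) / fact m * z ^ m" "z * egf ?y z"] by simp
  then have "(\<lambda>m. fdiff x m / fact m * z ^ m + of_nat m * ?y (m - 1) / fact m * z ^ m) sums (egf (fdiff x) z + z * egf ?y z)"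
    by (intro sums_add egf_sums bounded_fdiff x)
  moreover have "fdiff x m / fact m * z ^ m + of_nat m * ?y (m - 1) / fact m * z ^ m = Lop x m / fact m * z ^ m" for m
  proof -
    have "fdiff x m + of_nat m * ?y (m - 1) = Lop x m"
      by (cases m) (auto simp: fdiff_def Lop_def algebra_simps)
    then show ?thesis by (metis add_divide_distrib distrib_right)
  qed
  ultimately show ?thesis by simp
qed

lemma egf_Lop:
  "bounded (range x) \<Longrightarrow> egf (Lop x) z = egf (fdiff x) z + z * egf (fdiff (fdiff x)) z"
  using egf_Lop_sums unfolding egf_def[of "Lop x"] by (metis sums_unique)

lemma dpart_radial:
  assumes F: "\<And>w. (F has_field_derivative F' w) (at w)"
  shows "dpart v (\<lambda>z. F (of_real (pi * (cmod z)\<^sup>2))) z = of_real (2 * pi * (z \<bullet> v)) * F' (of_real (pi * (cmod z)\<^sup>2))"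
    and "((\<lambda>s. F (of_real (pi * (cmod (z + of_real s * v))\<^sup>2))) has_vector_derivative
          of_real (2 * pi * (z \<bullet> v)) * F' (of_real (pi * (cmod z)\<^sup>2))) (at (0::real))"
proof -
  define r where "r s = pi * ((Re z + s * Re v)\<^sup>2 + (Im z + s * Im v)\<^sup>2)" for s
  have r: "r s = pi * (cmod (z + of_real s * v))\<^sup>2" for s
    by (simp add: r_def cmod_power2)
  have "(r has_real_derivative 2 * pi * (z \<bullet> v)) (at 0)"
    unfolding r_def by (auto intro!: derivative_eq_intros simp: inner_complex_def algebra_simps)
  then have "((\<lambda>s. complex_of_real (r s)) has_vector_derivative of_real (2 * pi * (z \<bullet> v))) (at 0)"
    by (rule has_vector_derivative_of_real)
  from field_vector_diff_chain_at[OF this F]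
  have "((\<lambda>s. F (of_real (r s))) has_vector_derivative of_real (2 * pi * (z \<bullet> v)) * F' (of_real (r 0))) (at 0)"
    by (simp add: o_def)
  then show vd: "((\<lambda>s. F (of_real (pi * (cmod (z + of_real s * v))\<^sup>2))) has_vector_derivative
          of_real (2 * pi * (z \<bullet> v)) * F' (of_real (pi * (cmod z)\<^sup>2))) (at 0)"
    unfolding r by simp
  then show "dpart v (\<lambda>z. F (of_real (pi * (cmod z)\<^sup>2))) z = of_real (2 * pi * (z \<bullet> v)) * F' (of_real (pi * (cmod z)\<^sup>2))"
    unfolding dpart_def by (rule vector_derivative_at)
qed

lemma dpart_dpart_radial:
  assumes F: "\<And>w. (F has_field_derivative F' w) (at w)" and F': "\<And>w. (F' has_field_derivative F'' w) (at w)"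
  shows "dpart v (dpart v (\<lambda>z. F (of_real (pi * (cmod z)\<^sup>2)))) z =
    of_real (2 * pi * (v \<bullet> v)) * F' (of_real (pi * (cmod z)\<^sup>2)) + (of_real (2 * pi * (z \<bullet> v)))\<^sup>2 * F'' (of_real (pi * (cmod z)\<^sup>2))"
proof -
  have 1: "dpart v (\<lambda>z. F (of_real (pi * (cmod z)\<^sup>2))) = (\<lambda>z. of_real (2 * pi * (z \<bullet> v)) * F' (of_real (pi * (cmod z)\<^sup>2)))"
    using dpart_radial(1)[OF F] by blast
  have "((\<lambda>s. 2 * pi * ((z + of_real s * v) \<bullet> v)) has_real_derivative 2 * pi * (v \<bullet> v)) (at (0::real))"
    by (auto intro!: derivative_eq_intros simp: inner_complex_def algebra_simps)
  then have q: "((\<lambda>s. complex_of_real (2 * pi * ((z + of_real s * v) \<bullet> v))) has_vector_derivative of_real (2 * pi * (v \<bullet> v))) (at 0)"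
    by (rule has_vector_derivative_of_real)
  from has_vector_derivative_mult[OF q dpart_radial(2)[OF F', of z v]]
  show ?thesis
    unfolding 1 dpart_def[of v "\<lambda>z. of_real (2 * pi * (z \<bullet> v)) * F' (of_real (pi * (cmod z)\<^sup>2))"]
    by (intro vector_derivative_at) (simp add: power2_eq_square mult.assoc add.commute)
qed

text \<open>For F(t) with t = \<pi> |z|^2, the two second derivatives add up to 4 \<pi> F' + 4
  \<pi>^2 |z|^2 F'', and a quarter of this is \<pi> (F' + t F'').\<close>

lemma laplace_bsum:
  assumes x: "bounded (range x)"
  shows "laplace (\<lambda>z. bsum x (of_real (pi * (cmod z)\<^sup>2))) z = of_real pi * bsum (Lop x) (of_real (pi * (cmod z)\<^sup>2))"
proof -
  define t where "t = complex_of_real (pi * (cmod z)\<^sup>2)"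
  note d = dpart_dpart_radial[OF bsum_deriv[OF x] bsum_deriv[OF bounded_fdiff[OF x]]]
  have "laplace (\<lambda>z. bsum x (of_real (pi * (cmod z)\<^sup>2))) z =
    (4 * of_real pi * bsum (fdiff x) t + 4 * (of_real pi)\<^sup>2 * of_real ((Re z)\<^sup>2 + (Im z)\<^sup>2) * bsum (fdiff (fdiff x)) t) / 4"
    unfolding laplace_def d t_def[symmetric] by (simp add: inner_complex_def power_mult_distrib algebra_simps)
  also have "\<dots> = of_real pi * (bsum (fdiff x) t + t * bsum (fdiff (fdiff x)) t)"
    unfolding t_def cmod_power2 by (simp add: power2_eq_square algebra_simps)
  also have "\<dots> = of_real pi * bsum (Lop x) t"
    unfolding bsum_def egf_Lop[OF x] by (simp add: algebra_simps)
  finally show ?thesis unfolding t_def .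
qed

section \<open>Normalized kernels and Berezin transforms of diagonal operators\<close>

lemma kz_series:
  "(\<lambda>m. of_real (exp (- (pi * (cmod z)\<^sup>2 / 2))) * cnj (ebasis m z) * ebasis m w) sums kz z w"
proof -
  have "(\<lambda>m. of_real (exp (- (pi * (cmod z)\<^sup>2 / 2))) * ((of_real pi * cnj z * w) ^ m /\<^sub>R fact m)) sums
    (of_real (exp (- (pi * (cmod z)\<^sup>2 / 2))) * exp (of_real pi * cnj z * w))"
    by (intro sums_mult exp_converges)
  moreover have "of_real (exp (- (pi * (cmod z)\<^sup>2 / 2))) * exp (of_real pi * cnj z * w) = kz z w"
    by (simp only: kz_def exp_diff of_real_exp[symmetric] exp_minus divide_inverse of_real_inverse) (simp add: mult.commute)
  moreover have "(of_real pi * cnj z * w) ^ m /\<^sub>R fact m = cnj (ebasis m z) * ebasis m w" for m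
  proof -
    define s where "s = sqrt (pi ^ m / fact m)"
    have s: "s * s = pi ^ m / fact m" unfolding s_def by simp
    have "cnj (ebasis m z) * ebasis m w = of_real (s * s) * (cnj z ^ m * w ^ m)"
      by (simp add: ebasis_def s_def[symmetric] mult_ac)
    then show ?thesis unfolding s by (simp add: power_mult_distrib scaleR_conv_of_real divide_inverse mult_ac)
  qed
  ultimately show ?thesis by (simp only: mult.assoc)
qed

lemma kz_fock: "kz z \<in> fock"
  and coef_kz: "coef (kz z) m = of_real (exp (- (pi * (cmod z)\<^sup>2 / 2))) * cnj (ebasis m z)"
proof -
  define c where "c m = of_real (exp (- (pi * (cmod z)\<^sup>2 / 2))) * cnj (ebasis m z)" for m
  have s: "(\<lambda>m. c m * ebasis m w) sums kz z w" for w
    unfolding c_def by (rule kz_series)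
  have "summable (\<lambda>m. (exp (- (pi * (cmod z)\<^sup>2 / 2)))\<^sup>2 * (cmod (ebasis m z))\<^sup>2)"
    by (intro summable_mult ebasis_norm_summable)
  then have "summable (\<lambda>m. (cmod (c m))\<^sup>2)"
    by (simp add: c_def norm_mult power_mult_distrib)
  then have sq: "sqint (kz z)" by (rule series_sqint[OF s])
  show "kz z \<in> fock" using series_entire[OF s] sq by (simp add: fock_iff)
  show "coef (kz z) m = of_real (exp (- (pi * (cmod z)\<^sup>2 / 2))) * cnj (ebasis m z)"
    using series_coef[OF s sq] by (simp add: c_def)
qed

text \<open>Squared moduli of the kernel coefficients are Poisson weights with parameter \<pi>
  |z|^2, whence the Poisson mean in \<open>berezin_diagop\<close>.\<close>

lemma coef_kz_norm:
  "coef (kz z) m * cnj (coef (kz z) m) = exp (- of_real (pi * (cmod z)\<^sup>2)) * (of_real (pi * (cmod z)\<^sup>2)) ^ m / fact m"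
proof -
  have "(cmod (coef (kz z) m))\<^sup>2 = exp (- (pi * (cmod z)\<^sup>2)) * ((pi * (cmod z)\<^sup>2) ^ m / fact m)"
    by (simp add: coef_kz norm_mult power_mult_distrib ebasis_norm exp_double[symmetric])
  then have "coef (kz z) m * cnj (coef (kz z) m) = of_real (exp (- (pi * (cmod z)\<^sup>2)) * ((pi * (cmod z)\<^sup>2) ^ m / fact m))"
    unfolding complex_norm_square[symmetric] by simp
  then show ?thesis by (simp add: exp_of_real[symmetric])
qed

lemma bsum_kz:
  assumes "(\<lambda>m. x m / fact m * (of_real (pi * (cmod z)\<^sup>2)) ^ m) sums egf x (of_real (pi * (cmod z)\<^sup>2))"
  shows "(\<lambda>m. x m * (coef (kz z) m * cnj (coef (kz z) m))) sums bsum x (of_real (pi * (cmod z)\<^sup>2))"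
  unfolding bsum_def coef_kz_norm
  using sums_mult[OF assms, of "exp (- of_real (pi * (cmod z)\<^sup>2))"]
  by (rule sums_rewrite) simp

lemma berezin_diagop:
  assumes x: "bounded (range x)"
  shows "berezin (diagop x) z = bsum x (of_real (pi * (cmod z)\<^sup>2))"
proof -
  have "(\<lambda>m. coef (diagop x (kz z)) m * cnj (coef (kz z) m)) sums berezin (diagop x) z"
    unfolding berezin_def by (rule finner_coef_sums) (auto simp: diagop_fock[OF x] kz_fock)
  then have "(\<lambda>m. x m * (coef (kz z) m * cnj (coef (kz z) m))) sums berezin (diagop x) z"
    by (rule sums_rewrite) (simp add: diagop_fock[OF x] kz_fock)
  then show ?thesis using bsum_kz[OF egf_sums[OF x]] by (rule sums_unique2)
qed

section \<open>Rotations and the diagonal form of radial operators\<close>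

lemma rotate_fock:
  assumes f: "f \<in> fock" and u: "cmod u = 1"
  shows "(\<lambda>z. f (u * z)) \<in> fock" "coef (\<lambda>z. f (u * z)) m = u ^ m * coef f m"
proof -
  have s: "(\<lambda>m. (u ^ m * coef f m) * ebasis m z) sums f (u * z)" for z
    using coef_sums[OF f, of "u * z"] by (rule sums_rewrite) (simp add: ebasis_def power_mult_distrib)
  have "summable (\<lambda>m. (cmod (u ^ m * coef f m))\<^sup>2)"
    using sums_summable[OF coef_norm_sums[OF f]] u by (simp add: norm_mult norm_power)
  then have sq: "sqint (\<lambda>z. f (u * z))" by (rule series_sqint[OF s])
  show "(\<lambda>z. f (u * z)) \<in> fock" using series_entire[OF s] sq by (simp add: fock_iff)
  show "coef (\<lambda>z. f (u * z)) m = u ^ m * coef f m" using series_coef[OF s sq] by simp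
qed

lemma radial_diagop:
  assumes x: "bounded (range x)"
  shows "radial_op (diagop x)"
  unfolding radial_op_def
proof (intro allI impI ballI)
  fix u f assume u: "cmod u = 1" and f: "f \<in> fock"
  have u': "cmod (inverse u) = 1" using u by (simp add: norm_inverse)
  show "diagop x (\<lambda>z. f (inverse u * z)) = (\<lambda>z. diagop x f (inverse u * z))"
  proof (rule fock_eqI)
    show "coef (diagop x (\<lambda>z. f (inverse u * z))) m = coef (\<lambda>z. diagop x f (inverse u * z)) m" for m
      using rotate_fock[OF f u'] rotate_fock[OF diagop_fock(1)[OF x f] u']
      by (simp only: diagop_fock[OF x] f mult_ac)
  qed (use rotate_fock[OF f u'] rotate_fock[OF diagop_fock(1)[OF x f] u'] diagop_fock[OF x] in auto)
qed

text \<open>The angle pi / (m - n) makes the two powers opposite, hence distinct.\<close>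

lemma cis_separates:
  assumes "m \<noteq> n"
  obtains u where "cmod u = 1" "u ^ m \<noteq> u ^ n"
proof
  define q where "q = pi / (real m - real n)"
  show "cmod (cis q) = 1" by simp
  have "cis q ^ m = cis (real n * q + q * (real m - real n))"
    unfolding Complex.DeMoivre by (simp add: algebra_simps)
  also have "\<dots> = - (cis q ^ n)"
    using assms by (simp add: q_def Complex.DeMoivre flip: cis_mult)
  finally show "cis q ^ m \<noteq> cis q ^ n" by (simp add: neg_eq_iff_add_eq_0)
qed

lemma bops_bounded_matrix:
  assumes "S \<in> bops"
  obtains C where "C > 0" "\<And>m n. cmod (coef (S (ebasis m)) n) \<le> C"
proof -
  have "\<exists>C. \<forall>f\<in>fock. fnorm (S f) \<le> C * fnorm f" using assms by (simp add: bops_def)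
  then obtain C where C: "\<And>f. f \<in> fock \<Longrightarrow> fnorm (S f) \<le> C * fnorm f" by blast
  have "cmod (coef (S (ebasis m)) n) \<le> max C 1" for m n
  proof -
    have "S (ebasis m) \<in> fock" using assms by (simp add: bops_def)
    then show ?thesis using coef_bound[of "S (ebasis m)" n] C[of "ebasis m"] by simp
  qed
  then show ?thesis using that[of "max C 1"] by simp
qed

lemma radial_op_diagonal:
  assumes S: "S \<in> bops" and r: "radial_op S"
  shows "bounded (range (Gamma_op S))" "S = diagop (Gamma_op S)"
proof -
  obtain C where C: "\<And>m n. cmod (coef (S (ebasis m)) n) \<le> C" using bops_bounded_matrix[OF S] by metis
  have G: "Gamma_op S m = coef (S (ebasis m)) m" for m by (simp add: Gamma_op_def coef_def)
  show b: "bounded (range (Gamma_op S))" using C unfolding G[abs_def] by (intro bounded_rangeI)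
  have Sf: "S f \<in> fock" if "f \<in> fock" for f using S that by (simp add: bops_def)
  have off: "coef (S (ebasis m)) n = 0" if mn: "m \<noteq> n" for m n
  proof -
    obtain u where u: "cmod u = 1" "u ^ m \<noteq> u ^ n" using cis_separates[OF mn] .
    have iu: "cmod (inverse u) = 1" using u by (simp add: norm_inverse)
    \<comment> \<open>\<open>radial_op\<close> composes with the inverse, so it is applied to
      \<open>inverse u\<close> to obtain the rotation by u. Comparing coefficients then gives u^m t
      = u^n t for the entry t.\<close>
    have "S (\<lambda>z. ebasis m (inverse (inverse u) * z)) = (\<lambda>z. S (ebasis m) (inverse (inverse u) * z))"
      using r iu ebasis_fock unfolding radial_op_def by blast
    moreover have "(\<lambda>z. ebasis m (inverse (inverse u) * z)) = (\<lambda>z. u ^ m * ebasis m z)"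
      by (simp add: ebasis_def power_mult_distrib mult_ac)
    moreover have "S (\<lambda>z. u ^ m * ebasis m z) = (\<lambda>z. u ^ m * S (ebasis m) z)"
      using S by (simp add: bops_def)
    ultimately have "(\<lambda>z. u ^ m * S (ebasis m) z) = (\<lambda>z. S (ebasis m) (u * z))" by simp
    then have "coef (\<lambda>z. u ^ m * S (ebasis m) z) n = coef (\<lambda>z. S (ebasis m) (u * z)) n" by simp
    then have "u ^ m * coef (S (ebasis m)) n = u ^ n * coef (S (ebasis m)) n"
      by (simp add: coef_scale rotate_fock[OF Sf u(1)])
    then show ?thesis using u(2) by simp
  qed
  show "S = diagop (Gamma_op S)"
  proof (rule diagop_eqI[OF S b])
    fix f m assume f: "f \<in> fock"
    have "(\<lambda>k. if k = m then coef f k * coef (S (ebasis k)) k else 0) sums coef (S f) m"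
      using bops_coef_sums[OF S f, of m] by (rule sums_rewrite) (use off in auto)
    then have "coef (S f) m = coef f m * coef (S (ebasis m)) m"
      by (rule sums_unique2) (rule sums_single)
    then show "coef (S f) m = Gamma_op S m * coef f m" by (simp add: G)
  qed
qed

section \<open>Averaging over rotations and conclusion\<close>

text \<open>Indices below M differ by a multiple of M only if they are equal; otherwise the sum is a
  full geometric sum of a nontrivial M-th root of unity.\<close>

lemma sum_roots_of_unity:
  fixes M m n :: nat
  assumes "m < M" "n < M"
  shows "(\<Sum>j<M. cis (2 * pi * real j / real M) ^ n * cnj (cis (2 * pi * real j / real M)) ^ m) = (if m = n then of_nat M else 0)"
proof -
  define q where "q = 2 * pi * (real n - real m) / real M"
  have M: "real M > 0" using assms by simp
  have "cis (2 * pi * real j / real M) ^ n * cnj (cis (2 * pi * real j / real M)) ^ m = cis q ^ j" for j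
  proof -
    have "real n * (2 * pi * real j / real M) + real m * (- (2 * pi * real j / real M)) = real j * q"
      using M by (simp add: q_def field_simps)
    then show ?thesis unfolding cis_cnj Complex.DeMoivre cis_mult by simp
  qed
  then have eq: "(\<Sum>j<M. cis (2 * pi * real j / real M) ^ n * cnj (cis (2 * pi * real j / real M)) ^ m) = (\<Sum>j<M. cis q ^ j)"
    by simp
  show ?thesis
  proof (cases "m = n")
    case True
    then show ?thesis unfolding eq by (simp add: q_def)
  next
    case False
    have "cis q \<noteq> 1"
    proof
      assume "cis q = 1"
      then have "cos q = 1" by (simp add: complex_eq_iff)
      then obtain k :: int where "q = of_int k * 2 * pi" using cos_one_2pi_int by blast
      then have "2 * pi * (real n - real m) = 2 * pi * (of_int k * real M)"
        using M by (simp add: q_def field_simps)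
      then have "real_of_int (int n - int m) = real_of_int (k * int M)" by simp
      then have k: "int n - int m = k * int M" by (simp only: of_int_eq_iff)
      then have "k \<noteq> 0" using False by auto
      then have "1 \<le> \<bar>k\<bar>" by linarith
      then have "\<bar>k\<bar> * int M \<ge> int M" using mult_right_mono[of 1 "\<bar>k\<bar>" "int M"] by simp
      then have "\<bar>int n - int m\<bar> \<ge> int M" by (simp add: k abs_mult)
      then show False using assms by linarith
    qed
    moreover have "cis q ^ M = 1"
    proof -
      have "real M * q = 2 * pi * of_int (int n - int m)" using M by (simp add: q_def)
      then have "cis q ^ M = cis (2 * pi * of_int (int n - int m))" by (simp only: Complex.DeMoivre)
      then show ?thesis using cis_multiple_2pi[of "of_int (int n - int m)"] by simp
    qed
    ultimately show ?thesis unfolding eq using False by (simp add: geometric_sum)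
  qed
qed

text \<open>The factor 2^(-m) is a square-summable coefficient sequence, and 2^(-m) |e_m(2 z)| =
  |e_m(z)|; so absolute convergence of its series at 2 z suffices.\<close>

lemma ebasis_abs_summable: "summable (\<lambda>m. cmod (ebasis m z))"
proof -
  have s: "summable (\<lambda>m. (cmod ((1 / 2) ^ m :: complex))\<^sup>2)"
  proof -
    have "(cmod ((1 / 2) ^ m :: complex))\<^sup>2 = (1 / 4) ^ m" for m
      by (simp add: norm_power norm_divide power2_eq_square power_mult_distrib[symmetric])
    then show ?thesis by (simp add: summable_geometric)
  qed
  have "summable (\<lambda>m. cmod ((1 / 2) ^ m) * cmod (ebasis m (2 * z)))"
    by (rule series_abs_summable[OF synth_sums[OF s]])
  moreover have "cmod ((1 / 2) ^ m) * cmod (ebasis m (2 * z)) = cmod (ebasis m z)" for m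
    by (simp add: ebasis_def norm_mult norm_power norm_divide power_mult_distrib power_divide)
  ultimately show ?thesis by simp
qed

text \<open>Averaging over the \<open>M\<close>-th roots of unity kills every off-diagonal matrix entry with indices
  below \<open>M\<close>; the truncation error is uniform in the rotation.\<close>

lemma berezin_radial_diag:
  assumes T: "T \<in> bops" and rad: "\<And>u. cmod u = 1 \<Longrightarrow> berezin T (u * z) = berezin T z"
  shows "(\<lambda>m. Gamma_op T m * (coef (kz z) m * cnj (coef (kz z) m))) sums berezin T z"
proof -
  define t where "t m n = coef (T (ebasis m)) n" for m n
  obtain C where C: "C > 0" "\<And>m n. cmod (t m n) \<le> C" unfolding t_def using bops_bounded_matrix[OF T] by metis
  define c where "c = coef (kz z)"
  have cs: "summable (\<lambda>m. cmod (c m))"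
    unfolding c_def coef_kz by (simp add: norm_mult ebasis_abs_summable summable_mult)
  define A where "A = (\<Sum>m. cmod (c m))"
  define A' where "A' M = (\<Sum>m<M. cmod (c m))" for M
  have A'le: "A' M \<le> A" for M unfolding A_def A'_def by (intro sum_le_suminf cs) auto
  have A0: "0 \<le> A' M" for M unfolding A'_def by (intro sum_nonneg) auto
  \<comment> \<open>Used for both nested series of \<open>berezin T (u * z)\<close>: the expansion
    of T k and the inner product. At M = 0 it also bounds the sum itself.\<close>
  have tail: "cmod (s - (\<Sum>m<M. g m)) \<le> B * (A - A' M)"
    if g: "g sums s" and le: "\<And>m. cmod (g m) \<le> B * cmod (c m)" for g s B M
  proof -
    have sg: "summable (\<lambda>m. cmod (g m))"
      by (rule summable_comparison_test'[OF summable_mult[OF cs, of B]]) (use le in simp)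
    have "s - (\<Sum>m<M. g m) = (\<Sum>m. g (m + M))"
      using suminf_minus_initial_segment[OF sums_summable[OF g], of M] sums_unique[OF g] by simp
    also have "cmod \<dots> \<le> (\<Sum>m. cmod (g (m + M)))"
      by (intro summable_norm summable_ignore_initial_segment sg)
    also have "\<dots> \<le> (\<Sum>m. B * cmod (c (m + M)))"
      using cs by (intro suminf_le le summable_mult summable_ignore_initial_segment[of "\<lambda>m. cmod (g m)"] sg
          summable_ignore_initial_segment[of "\<lambda>m. cmod (c m)"])
    also have "\<dots> = B * (A - A' M)"
      unfolding A_def A'_def suminf_minus_initial_segment[OF cs, symmetric]
      by (rule suminf_mult[OF summable_ignore_initial_segment[OF cs]])
    finally show ?thesis .
  qed
  define D where "D M u = (\<Sum>n<M. \<Sum>m<M. (cnj u ^ m * c m * t m n) * (u ^ n * cnj (c n)))" for M u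
  \<comment> \<open>Each of the two truncations costs C A (A - A' M). Rotation alters the kernel
    coefficients by unimodular factors only, so u does not enter the bound.\<close>
  have approx: "cmod (berezin T z - D M u) \<le> 2 * C * A * (A - A' M)" if u: "cmod u = 1" for M u
  proof -
    define k where "k = kz (u * z)"
    have k: "k \<in> fock" by (simp add: k_def kz_fock)
    have ck: "coef k m = cnj u ^ m * c m" for m
      using u by (simp add: k_def c_def coef_kz norm_mult ebasis_def power_mult_distrib mult_ac)
    have nk: "cmod (coef k m) = cmod (c m)" for m using u by (simp add: ck norm_mult norm_power)
    define b where "b n = coef (T k) n" for n
    define b' where "b' n = (\<Sum>m<M. coef k m * t m n)" for n
    have bs: "(\<lambda>m. coef k m * t m n) sums b n" for n
      unfolding b_def t_def by (rule bops_coef_sums[OF T k])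
    have tk: "cmod (coef k m * t m n) \<le> C * cmod (c m)" for m n
      using mult_left_mono[OF C(2)[of m n] norm_ge_zero[of "c m"]] by (simp add: norm_mult nk mult.commute)
    have bb': "cmod (b n - b' n) \<le> C * (A - A' M)" for n
      unfolding b'_def by (rule tail[OF bs tk])
    have bA: "cmod (b n) \<le> C * A" for n
      using tail[OF bs tk, of n 0] by (simp add: A'_def)
    have Ts: "(\<lambda>n. b n * cnj (coef k n)) sums berezin T (u * z)"
      unfolding berezin_def b_def k_def[symmetric] using T k by (intro finner_coef_sums) (auto simp: bops_def)
    have "cmod (b n * cnj (coef k n)) \<le> C * A * cmod (c n)" for n
      using bA[of n] by (simp add: norm_mult nk mult_right_mono)
    then have 1: "cmod (berezin T (u * z) - (\<Sum>n<M. b n * cnj (coef k n))) \<le> C * A * (A - A' M)"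
      by (rule tail[OF Ts])
    have "cmod ((\<Sum>n<M. b n * cnj (coef k n)) - (\<Sum>n<M. b' n * cnj (coef k n))) \<le> (\<Sum>n<M. C * (A - A' M) * cmod (c n))"
      unfolding sum_subtractf[symmetric] left_diff_distrib[symmetric]
      by (intro sum_norm_le) (auto simp: norm_mult nk intro!: mult_right_mono bb')
    also have "\<dots> = C * (A - A' M) * A' M" by (simp add: A'_def sum_distrib_left)
    also have "\<dots> \<le> C * (A - A' M) * A"
      using A'le[of M] C by (intro mult_left_mono) auto
    finally have 2: "cmod ((\<Sum>n<M. b n * cnj (coef k n)) - (\<Sum>n<M. b' n * cnj (coef k n))) \<le> C * A * (A - A' M)"
      by (simp add: mult_ac)
    have bD: "(\<Sum>n<M. b' n * cnj (coef k n)) = D M u"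
      unfolding D_def b'_def ck by (simp add: sum_distrib_right)
    have "cmod (berezin T (u * z) - D M u) \<le> cmod (berezin T (u * z) - (\<Sum>n<M. b n * cnj (coef k n))) + cmod ((\<Sum>n<M. b n * cnj (coef k n)) - D M u)"
      using norm_triangle_ineq[of "berezin T (u * z) - (\<Sum>n<M. b n * cnj (coef k n))" "(\<Sum>n<M. b n * cnj (coef k n)) - D M u"]
      by simp
    also have "\<dots> \<le> C * A * (A - A' M) + C * A * (A - A' M)"
      using 1 2 unfolding bD by (rule add_mono)
    finally show ?thesis using rad[OF u] by (simp add: mult_ac)
  qed
  have avg: "(\<Sum>j<M. D M (cis (2 * pi * real j / real M))) = of_nat M * (\<Sum>m<M. t m m * (c m * cnj (c m)))" for M
  proof -
    define w where "w j = cis (2 * pi * real j / real M)" for j :: nat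
    have "D M u = (\<Sum>n<M. \<Sum>m<M. (c m * t m n * cnj (c n)) * (u ^ n * cnj u ^ m))" for u
      unfolding D_def by (intro sum.cong refl) (simp only: mult_ac)
    then have "(\<Sum>j<M. D M (w j)) = (\<Sum>j<M. \<Sum>n<M. \<Sum>m<M. (c m * t m n * cnj (c n)) * (w j ^ n * cnj (w j) ^ m))"
      by simp
    also have "\<dots> = (\<Sum>n<M. \<Sum>j<M. \<Sum>m<M. (c m * t m n * cnj (c n)) * (w j ^ n * cnj (w j) ^ m))"
      by (rule sum.swap)
    also have "\<dots> = (\<Sum>n<M. \<Sum>m<M. \<Sum>j<M. (c m * t m n * cnj (c n)) * (w j ^ n * cnj (w j) ^ m))"
      by (rule sum.cong[OF refl], rule sum.swap)
    also have "\<dots> = (\<Sum>n<M. \<Sum>m<M. (c m * t m n * cnj (c n)) * (if m = n then of_nat M else 0))"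
      unfolding sum_distrib_left[symmetric] w_def
      by (intro sum.cong refl arg_cong2[where f = "(*)"] sum_roots_of_unity) auto
    also have "\<dots> = (\<Sum>n<M. \<Sum>m<M. if m = n then (c m * t m n * cnj (c n)) * of_nat M else 0)"
      by (intro sum.cong refl) auto
    also have "\<dots> = (\<Sum>n<M. c n * t n n * cnj (c n) * of_nat M)" by simp
    also have "\<dots> = of_nat M * (\<Sum>m<M. t m m * (c m * cnj (c m)))"
      by (simp add: sum_distrib_left mult_ac)
    finally show ?thesis unfolding w_def .
  qed
  have bound: "cmod ((\<Sum>m<M. t m m * (c m * cnj (c m))) - berezin T z) \<le> 2 * C * A * (A - A' M)" if M: "M > 0" for M
  proof -
    have "of_nat M * (berezin T z - (\<Sum>m<M. t m m * (c m * cnj (c m)))) = (\<Sum>j<M. berezin T z - D M (cis (2 * pi * real j / real M)))"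
      using avg[of M] by (simp add: sum_subtractf right_diff_distrib)
    also have "cmod \<dots> \<le> (\<Sum>j<M. 2 * C * A * (A - A' M))"
      by (intro sum_norm_le approx) simp
    finally have "real M * cmod (berezin T z - (\<Sum>m<M. t m m * (c m * cnj (c m)))) \<le> real M * (2 * C * A * (A - A' M))"
      by (simp add: norm_mult)
    then show ?thesis using M by (simp add: norm_minus_commute)
  qed
  have "A' \<longlonglongrightarrow> A" unfolding A'_def[abs_def] A_def using summable_LIMSEQ[OF cs] .
  then have "(\<lambda>M. 2 * C * A * (A - A' M)) \<longlonglongrightarrow> 2 * C * A * (A - A)" by (intro tendsto_intros)
  then have lim: "(\<lambda>M. 2 * C * A * (A - A' M)) \<longlonglongrightarrow> 0" by simp
  have "(\<lambda>M. (\<Sum>m<M. t m m * (c m * cnj (c m))) - berezin T z) \<longlonglongrightarrow> 0"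
    by (rule Lim_null_comparison[OF _ lim]) (use bound in \<open>auto simp: eventually_sequentially intro!: exI[of _ 1]\<close>)
  then show ?thesis
    unfolding sums_def by (simp add: LIM_zero_iff t_def c_def Gamma_op_def coef_def)
qed

text \<open>The half-line accumulates at 0, where a nonzero power series vanishing at its centre has
  an isolated zero.\<close>

lemma entire_coeffs_unique:
  fixes a b :: "nat \<Rightarrow> complex"
  assumes a: "\<And>z. (\<lambda>m. a m * z ^ m) sums f z" and b: "\<And>z. (\<lambda>m. b m * z ^ m) sums g z"
    and eq: "\<And>s. s \<ge> 0 \<Longrightarrow> f (of_real s) = g (of_real s)"
  shows "a = b"
proof (rule ccontr)
  assume "a \<noteq> b"
  then obtain m where m: "a m - b m \<noteq> 0" by auto
  define h where "h z = f z - g z" for z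
  have s: "(\<lambda>m. (a m - b m) * (z - 0) ^ m) sums h z" for z
    using sums_diff[OF a b, of z z] by (simp add: h_def left_diff_distrib)
  have h0: "h (of_real s) = 0" if "s \<ge> 0" for s using eq[OF that] by (simp add: h_def)
  \<comment> \<open>The isolated-zero lemma asks for a nonzero coefficient of positive index, so the
    constant term is settled first.\<close>
  have "a 0 - b 0 = 0"
  proof -
    have "(\<lambda>m. (a m - b m) * 0 ^ m) sums (a 0 - b 0)"
      using powser_sums_zero[of "\<lambda>m. a m - b m"] .
    then show ?thesis using s[of 0] h0[of 0] by (simp add: sums_unique2)
  qed
  then have "m > 0" using m by (cases m) auto
  then obtain r where r: "0 < r" "\<And>z. z \<in> cball 0 r - {0} \<Longrightarrow> h z \<noteq> 0"
    using powser_0_nonzero[of 1 0 "\<lambda>m. a m - b m" h m] s h0[of 0] m by auto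
  have "complex_of_real r \<in> cball 0 r - {0}" using r(1) by (simp add: dist_norm)
  then show False using r(2) h0[of r] r(1) by fastforce
qed

section \<open>Identification of \<open>d_Delta\<close> with the bounded radial Laplacian
  space\<close>

lemma d_Delta_eq: "d_Delta = Wseq"
proof
  show "Wseq \<subseteq> d_Delta"
  proof
    fix x assume "x \<in> Wseq"
    then have x: "bounded (range x)" "bounded (range (Lop x))" by (auto simp: Wseq_def)
    then have Lx: "bounded (range (\<lambda>m. of_real pi * Lop x m))" by (intro bounded_range_scale)
    have "laplace (berezin (diagop x)) z = berezin (diagop (\<lambda>m. of_real pi * Lop x m)) z" for z
    proof -
      have "berezin (diagop x) = (\<lambda>z. bsum x (of_real (pi * (cmod z)\<^sup>2)))" using berezin_diagop[OF x(1)] by blast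
      then have "laplace (berezin (diagop x)) z = of_real pi * bsum (Lop x) (of_real (pi * (cmod z)\<^sup>2))"
        by (simp only: laplace_bsum[OF x(1)])
      also have "\<dots> = bsum (\<lambda>m. of_real pi * Lop x m) (of_real (pi * (cmod z)\<^sup>2))"
      proof -
        have "egf (\<lambda>m. of_real pi * Lop x m) w = of_real pi * egf (Lop x) w" for w
          using sums_mult[OF egf_sums[OF x(2), of w], of "of_real pi"]
          by (simp add: egf_def[of "\<lambda>m. of_real pi * Lop x m"] sums_iff mult.assoc)
        then show ?thesis by (simp add: bsum_def mult_ac)
      qed
      finally show ?thesis by (simp only: berezin_diagop[OF Lx])
    qed
    then have "diagop x \<in> W2inf"
      unfolding W2inf_def using diagop_bops[OF x(1)] diagop_bops[OF Lx] by blast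
    then show "x \<in> d_Delta"
      unfolding d_Delta_def using diagop_bops[OF x(1)] radial_diagop[OF x(1)] Gamma_diagop[OF x(1)] by (intro CollectI exI[of _ "diagop x"]) auto
  qed
  show "d_Delta \<subseteq> Wseq"
  proof
    fix x assume "x \<in> d_Delta"
    then obtain S where S: "x = Gamma_op S" "S \<in> bops" "radial_op S" "S \<in> W2inf" by (auto simp: d_Delta_def)
    then have x: "bounded (range x)" "S = diagop x" using radial_op_diagonal by auto
    obtain T where T: "T \<in> bops" "\<And>z. laplace (berezin S) z = berezin T z" using S(4) by (auto simp: W2inf_def)
    have "berezin S = (\<lambda>z. bsum x (of_real (pi * (cmod z)\<^sup>2)))" using berezin_diagop[OF x(1)] x(2) by auto
    then have BT: "berezin T z = of_real pi * bsum (Lop x) (of_real (pi * (cmod z)\<^sup>2))" for z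
      using T(2)[of z] by (simp only: laplace_bsum[OF x(1)])
    \<comment> \<open>T itself may be far from radial; rotation invariance of its transform is all
      that \<open>berezin_radial_diag\<close> asks for.\<close>
    then have rad: "berezin T (u * z) = berezin T z" if "cmod u = 1" for u z
      using that by (simp add: norm_mult)
    obtain C where C: "\<And>m n. cmod (coef (T (ebasis m)) n) \<le> C" using bops_bounded_matrix[OF T(1)] by metis
    have Gb: "cmod (Gamma_op T m) \<le> C" for m using C by (simp add: Gamma_op_def coef_def)
    then have G: "bounded (range (Gamma_op T))" by (rule bounded_rangeI)
    have e1: "(\<lambda>m. Gamma_op T m / fact m * w ^ m) sums egf (Gamma_op T) w" for w
      by (rule egf_sums[OF G])
    \<comment> \<open>Boundedness of \<open>Lop x\<close> is the goal here, so convergence is taken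
      from \<open>egf_Lop_sums\<close>, which assumes only that x is bounded.\<close>
    have e2: "(\<lambda>m. of_real pi * Lop x m / fact m * w ^ m) sums (of_real pi * egf (Lop x) w)" for w
      using sums_mult[OF egf_Lop_sums[OF x(1), of w], of "of_real pi"] by (simp add: egf_Lop[OF x(1)] mult.assoc)
    have "egf (Gamma_op T) (of_real s) = of_real pi * egf (Lop x) (of_real s)" if s: "s \<ge> 0" for s
    proof -
      \<comment> \<open>Every s \<ge> 0 is a value of \<pi> |z|^2, so the two entire functions agree
        on the whole half-line.\<close>
      define z where "z = complex_of_real (sqrt (s / pi))"
      have z: "pi * (cmod z)\<^sup>2 = s" using s by (simp add: z_def)
      have "(\<lambda>m. Gamma_op T m * (coef (kz z) m * cnj (coef (kz z) m))) sums bsum (Gamma_op T) (of_real (pi * (cmod z)\<^sup>2))"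
        by (rule bsum_kz[OF e1])
      moreover have "(\<lambda>m. Gamma_op T m * (coef (kz z) m * cnj (coef (kz z) m))) sums berezin T z"
        by (rule berezin_radial_diag[OF T(1) rad])
      ultimately have "bsum (Gamma_op T) (of_real s) = of_real pi * bsum (Lop x) (of_real s)"
        unfolding BT z by (rule sums_unique2)
      then show ?thesis by (simp add: bsum_def)
    qed
    then have "(\<lambda>m. Gamma_op T m / fact m) = (\<lambda>m. of_real pi * Lop x m / fact m)"
      by (rule entire_coeffs_unique[OF e1 e2])
    then have "Gamma_op T m = of_real pi * Lop x m" for m by (metis (no_types) divide_cancel_right fact_nonzero)
    then have "Lop x m = of_real (1 / pi) * Gamma_op T m" for m by simp
    then have "cmod (Lop x m) \<le> 1 / pi * C" for m
      using Gb by (simp add: norm_mult norm_divide divide_right_mono)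
    then have "bounded (range (Lop x))" by (rule bounded_rangeI)
    then show "x \<in> Wseq" using x(1) by (simp add: Wseq_def)
  qed
qed

section \<open>Uniform closure\<close>

lemma Cbu_bounded: "x \<in> Cbu \<Longrightarrow> bounded (range x)"
  by (simp add: Cbu_def)

lemma bounded_range_limit:
  fixes x :: "'a \<Rightarrow> complex"
  assumes y: "bounded (range y)" and le: "\<And>m. cmod (x m - y m) < e"
  shows "bounded (range x)"
proof -
  obtain B where B: "\<And>m. cmod (y m) \<le> B" using y bounded_rangeE by blast
  have "cmod (x m) \<le> e + B" for m
    using norm_triangle_ineq[of "x m - y m" "y m"] B[of m] le[of m] by simp
  then show ?thesis by (rule bounded_rangeI)
qed

lemma Cbu_limit:
  assumes "\<And>\<epsilon>. \<epsilon> > 0 \<Longrightarrow> \<exists>y\<in>Cbu. \<forall>m. cmod (x m - y m) < \<epsilon>"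
  shows "x \<in> Cbu"
  unfolding Cbu_def
proof (intro CollectI conjI allI impI)
  obtain y where "y \<in> Cbu" "\<And>m. cmod (x m - y m) < 1" using assms[of 1] by auto
  then show "bounded (range x)" using bounded_range_limit Cbu_bounded by blast
  fix \<epsilon> :: real assume e: "\<epsilon> > 0"
  then obtain y where y: "y \<in> Cbu" "\<And>m. cmod (x m - y m) < \<epsilon> / 3" using assms[of "\<epsilon> / 3"] by auto
  have "\<epsilon> / 3 > 0" using e by simp
  then obtain \<delta> where d: "\<delta> > 0" "\<And>m n. \<bar>sqrt (real m) - sqrt (real n)\<bar> < \<delta> \<Longrightarrow> cmod (y m - y n) < \<epsilon> / 3"
    using y(1) unfolding Cbu_def by blast
  have "cmod (x m - x n) < \<epsilon>" if "\<bar>sqrt (real m) - sqrt (real n)\<bar> < \<delta>" for m n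
  proof -
    have "x m - x n = (x m - y m) + (y m - y n) - (x n - y n)" by simp
    then have "cmod (x m - x n) \<le> cmod (x m - y m) + cmod (y m - y n) + cmod (x n - y n)"
      by (metis (no_types) add_mono_thms_linordered_semiring(3) norm_triangle_ineq norm_triangle_ineq4 order_trans)
    then show ?thesis using y(2)[of m] y(2)[of n] d(2)[OF that] by linarith
  qed
  then show "\<exists>\<delta>>0. \<forall>m1 m2. \<bar>sqrt (real m1) - sqrt (real m2)\<bar> < \<delta> \<longrightarrow> cmod (x m1 - x m2) < \<epsilon>"
    using d(1) by blast
qed

definition seq_closure :: "(nat \<Rightarrow> complex) set \<Rightarrow> (nat \<Rightarrow> complex) set" where
  "seq_closure W = {x. \<forall>\<epsilon>>0. \<exists>y\<in>W. \<forall>m. cmod (x m - y m) < \<epsilon>}"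

lemma gamma_algebra_closure: "gamma_algebra (seq_closure Wseq)"
proof
  have sub: "x \<in> seq_closure Wseq" if "x \<in> Wseq" for x
    using that unfolding seq_closure_def by (auto intro!: bexI[of _ x])
  have bd: "bounded (range x)" if x: "x \<in> seq_closure Wseq" for x
  proof -
    obtain y where "y \<in> Wseq" "\<And>m. cmod (x m - y m) < 1"
      using x unfolding seq_closure_def by (auto dest: spec[of _ 1])
    then show ?thesis using bounded_range_limit unfolding Wseq_def by blast
  qed
  fix x y c
  assume x: "x \<in> seq_closure Wseq"
  obtain B where B: "B > 0" "\<And>m. cmod (x m) \<le> B" using bounded_rangeE[OF bd[OF x]] by blast
  show "(\<lambda>m. c * x m) \<in> seq_closure Wseq"
    unfolding seq_closure_def
  proof (intro CollectI allI impI)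
    fix \<epsilon> :: real assume "\<epsilon> > 0"
    then have e: "\<epsilon> / (cmod c + 1) > 0" by (simp add: add_nonneg_pos)
    then obtain x' where x': "x' \<in> Wseq" "\<And>m. cmod (x m - x' m) < \<epsilon> / (cmod c + 1)"
      using x unfolding seq_closure_def by blast
    have "cmod (c * x m - c * x' m) < \<epsilon>" for m
    proof -
      have "cmod (c * x m - c * x' m) = cmod c * cmod (x m - x' m)"
        by (simp add: right_diff_distrib[symmetric] norm_mult)
      also have "\<dots> \<le> cmod c * (\<epsilon> / (cmod c + 1))" using x'(2)[of m] by (intro mult_left_mono) auto
      also have "\<dots> < (cmod c + 1) * (\<epsilon> / (cmod c + 1))" using e by (intro mult_strict_right_mono) auto
      also have "\<dots> = \<epsilon>" using norm_ge_zero[of c] by (simp add: add_nonneg_eq_0_iff)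
      finally show ?thesis .
    qed
    then show "\<exists>y\<in>Wseq. \<forall>m. cmod (c * x m - y m) < \<epsilon>" using Wseq_scale[OF x'(1)] by (intro bexI[of _ "\<lambda>m. c * x' m"]) auto
  qed
  show "(\<lambda>m. cnj (x m)) \<in> seq_closure Wseq"
    unfolding seq_closure_def
  proof (intro CollectI allI impI)
    fix \<epsilon> :: real assume "\<epsilon> > 0"
    then obtain x' where x': "x' \<in> Wseq" "\<And>m. cmod (x m - x' m) < \<epsilon>"
      using x unfolding seq_closure_def by blast
    then show "\<exists>y\<in>Wseq. \<forall>m. cmod (cnj (x m) - y m) < \<epsilon>"
      using Wseq_cnj[OF x'(1)] by (intro bexI[of _ "\<lambda>m. cnj (x' m)"]) (auto simp flip: complex_cnj_diff)
  qed
  assume y: "y \<in> seq_closure Wseq"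
  obtain C where C: "C > 0" "\<And>m. cmod (y m) \<le> C" using bounded_rangeE[OF bd[OF y]] by blast
  show "(\<lambda>m. x m + y m) \<in> seq_closure Wseq"
    unfolding seq_closure_def
  proof (intro CollectI allI impI)
    fix \<epsilon> :: real assume "\<epsilon> > 0"
    then have e: "\<epsilon> / 2 > 0" by simp
    obtain x' where x': "x' \<in> Wseq" "\<And>m. cmod (x m - x' m) < \<epsilon> / 2"
      using x e unfolding seq_closure_def by blast
    obtain y' where y': "y' \<in> Wseq" "\<And>m. cmod (y m - y' m) < \<epsilon> / 2"
      using y e unfolding seq_closure_def by blast
    have "cmod (x m + y m - (x' m + y' m)) < \<epsilon>" for m
      using norm_diff_triangle_ineq[of "x m" "y m" "x' m" "y' m"] x'(2)[of m] y'(2)[of m] by simp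
    then show "\<exists>z\<in>Wseq. \<forall>m. cmod (x m + y m - z m) < \<epsilon>"
      using Wseq_add[OF x'(1) y'(1)] by (intro bexI[of _ "\<lambda>m. x' m + y' m"]) auto
  qed
  show "(\<lambda>m. x m * y m) \<in> seq_closure Wseq"
    unfolding seq_closure_def
  proof (intro CollectI allI impI)
    fix \<epsilon> :: real assume e: "\<epsilon> > 0"
    define e1 where "e1 = \<epsilon> / (2 * C)"
    have e1: "e1 > 0" using e C by (simp add: e1_def)
    obtain x' where x': "x' \<in> Wseq" "\<And>m. cmod (x m - x' m) < e1"
      using x e1 unfolding seq_closure_def by blast
    \<comment> \<open>Bounds the approximant \<open>x'\<close>, not x; hence \<open>x'\<close> is
      fixed before the accuracy \<open>e2\<close> for y is chosen.\<close>
    define r where "r = B + e1"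
    have r: "r > 0" using B e1 by (simp add: r_def)
    define e2 where "e2 = \<epsilon> / (2 * r)"
    have e2: "e2 > 0" using e r by (simp add: e2_def)
    obtain y' where y': "y' \<in> Wseq" "\<And>m. cmod (y m - y' m) < e2"
      using y e2 unfolding seq_closure_def by blast
    have "cmod (x m * y m - x' m * y' m) < \<epsilon>" for m
    proof -
      have xb: "cmod (x' m) \<le> r"
        using norm_triangle_ineq4[of "x m" "x m - x' m"] B(2)[of m] x'(2)[of m] by (simp add: r_def)
      have "x m * y m - x' m * y' m = (x m - x' m) * y m + x' m * (y m - y' m)" by (simp add: algebra_simps)
      then have "cmod (x m * y m - x' m * y' m) \<le> cmod (x m - x' m) * cmod (y m) + cmod (x' m) * cmod (y m - y' m)"
        by (metis norm_mult norm_triangle_ineq)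
      also have "cmod (x m - x' m) * cmod (y m) \<le> cmod (x m - x' m) * C" using C by (intro mult_left_mono) auto
      also have "\<dots> < e1 * C" using x'(2)[of m] C by (intro mult_strict_right_mono) auto
      also have "\<dots> = \<epsilon> / 2" using C by (simp add: e1_def)
      also have "cmod (x' m) * cmod (y m - y' m) \<le> r * e2"
        using xb y'(2)[of m] r by (intro mult_mono) auto
      also have "r * e2 = \<epsilon> / 2" using r by (simp add: e2_def)
      finally show ?thesis by simp
    qed
    then show "\<exists>z\<in>Wseq. \<forall>m. cmod (x m * y m - z m) < \<epsilon>"
      using Wseq_mult[OF x'(1) y'(1)] by (intro bexI[of _ "\<lambda>m. x' m * y' m"]) auto
  qed
next
  fix a :: "real \<Rightarrow> complex" assume "a \<in> borel_measurable borel" "bounded (range a)"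
  then have "gam a \<in> Wseq" by (rule gam_in_Wseq)
  then show "gam a \<in> seq_closure Wseq" unfolding seq_closure_def by (auto intro!: bexI[of _ "gam a"])
next
  fix x :: "nat \<Rightarrow> complex"
  assume x: "\<And>\<epsilon>. \<epsilon> > 0 \<Longrightarrow> \<exists>y\<in>seq_closure Wseq. \<forall>m. cmod (x m - y m) < \<epsilon>"
  show "x \<in> seq_closure Wseq"
    unfolding seq_closure_def
  proof (intro CollectI allI impI)
    fix \<epsilon> :: real assume "\<epsilon> > 0"
    then have e: "\<epsilon> / 2 > 0" by simp
    obtain y where y: "y \<in> seq_closure Wseq" "\<And>m. cmod (x m - y m) < \<epsilon> / 2" using x[OF e] by blast
    obtain y' where y': "y' \<in> Wseq" "\<And>m. cmod (y m - y' m) < \<epsilon> / 2"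
      using y(1) e unfolding seq_closure_def by blast
    have "cmod (x m - y' m) < \<epsilon>" for m
      using norm_triangle_ineq[of "x m - y m" "y m - y' m"] y(2)[of m] y'(2)[of m] by simp
    then show "\<exists>y\<in>Wseq. \<forall>m. cmod (x m - y m) < \<epsilon>" using y'(1) by blast
  qed
qed

lemma closure_Wseq: "seq_closure Wseq = Cbu"
proof
  show "Cbu \<subseteq> seq_closure Wseq" by (rule gamma_algebra.Cbu_subset[OF gamma_algebra_closure])
  show "seq_closure Wseq \<subseteq> Cbu"
    using Wseq_subset_Cbu by (auto simp: seq_closure_def intro!: Cbu_limit) blast
qed

text \<open>Obtained from the closure of \<open>Wseq\<close>, which is already known to be an
  algebra.\<close>

lemma Cbu_algebra:
  "x \<in> Cbu \<Longrightarrow> y \<in> Cbu \<Longrightarrow> (\<lambda>m. x m + y m) \<in> Cbu"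
  "x \<in> Cbu \<Longrightarrow> y \<in> Cbu \<Longrightarrow> (\<lambda>m. x m * y m) \<in> Cbu"
  "x \<in> Cbu \<Longrightarrow> (\<lambda>m. c * x m) \<in> Cbu"
  "x \<in> Cbu \<Longrightarrow> (\<lambda>m. cnj (x m)) \<in> Cbu"
  using gamma_algebra.add_in gamma_algebra.mult_in gamma_algebra.scale_in gamma_algebra.cnj_in gamma_algebra_closure
  unfolding closure_Wseq by metis+

section \<open>The radial Toeplitz algebra\<close>

lemma cstar_closed_Cbu: "cstar_closed (diagop ` Cbu)"
  unfolding cstar_closed_def
proof (intro conjI ballI allI impI)
  show "diagop ` Cbu \<subseteq> bops" using diagop_bops Cbu_bounded by blast
next
  fix S T assume "S \<in> diagop ` Cbu" "T \<in> diagop ` Cbu"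
  then obtain x y where xy: "x \<in> Cbu" "y \<in> Cbu" "S = diagop x" "T = diagop y" by blast
  then show "op_add S T \<in> diagop ` Cbu" "op_comp S T \<in> diagop ` Cbu"
    using Cbu_algebra by (auto simp: op_add_diagop op_comp_diagop Cbu_bounded)
next
  fix S c assume "S \<in> diagop ` Cbu"
  then show "op_scale c S \<in> diagop ` Cbu"
    using Cbu_algebra by (auto simp: op_scale_diagop Cbu_bounded)
next
  fix S assume "S \<in> diagop ` Cbu"
  then show "\<exists>T\<in>diagop ` Cbu. is_adjoint S T"
    using Cbu_algebra(4) is_adjoint_diagop Cbu_bounded by blast
next
  fix S assume S: "S \<in> bops" and lim: "\<forall>\<epsilon>>0. \<exists>T\<in>diagop ` Cbu. \<forall>f\<in>fock. fnorm (\<lambda>z. S f z - T f z) \<le> \<epsilon> * fnorm f"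
  have Sf: "S f \<in> fock" if "f \<in> fock" for f using S that by (simp add: bops_def)
  \<comment> \<open>Operator approximation is passed to single coefficients, each bounded by the
    norm. Testing on the basis makes the diagonal of S a uniform limit of sequences in
    \<open>Cbu\<close>; general f then show that S has no other entries.\<close>
  have near: "\<exists>y\<in>Cbu. \<forall>f\<in>fock. \<forall>m. cmod (coef (S f) m - y m * coef f m) \<le> \<epsilon> * fnorm f" if eps: "\<epsilon> > 0" for \<epsilon>
  proof -
    obtain y where y: "y \<in> Cbu" "\<And>f. f \<in> fock \<Longrightarrow> fnorm (\<lambda>z. S f z - diagop y f z) \<le> \<epsilon> * fnorm f"
      using lim eps by blast
    have "cmod (coef (S f) m - y m * coef f m) \<le> \<epsilon> * fnorm f" if f: "f \<in> fock" for f m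
    proof -
      have D: "diagop y f \<in> fock" "coef (diagop y f) m = y m * coef f m"
        using diagop_fock[OF Cbu_bounded[OF y(1)] f] by auto
      have "cmod (coef (\<lambda>z. S f z - diagop y f z) m) \<le> fnorm (\<lambda>z. S f z - diagop y f z)"
        by (rule coef_bound[OF fock_diff[OF Sf[OF f] D(1)]])
      then show ?thesis using y(2)[OF f] by (simp add: coef_diff Sf f D)
    qed
    then show ?thesis using y(1) by blast
  qed
  define x where "x m = coef (S (ebasis m)) m" for m
  have xy: "cmod (x m - y m) \<le> \<epsilon>" if "\<forall>f\<in>fock. \<forall>m. cmod (coef (S f) m - y m * coef f m) \<le> \<epsilon> * fnorm f" for y \<epsilon> m
    using that[rule_format, of "ebasis m" m] by (simp add: coef_ebasis x_def)
  have x: "x \<in> Cbu"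
  proof (rule Cbu_limit)
    fix \<epsilon> :: real assume e: "\<epsilon> > 0"
    then obtain y where "y \<in> Cbu" "\<forall>f\<in>fock. \<forall>m. cmod (coef (S f) m - y m * coef f m) \<le> \<epsilon> / 2 * fnorm f"
      using near[of "\<epsilon> / 2"] by auto
    then have "y \<in> Cbu" "\<And>m. cmod (x m - y m) \<le> \<epsilon> / 2" using xy by blast+
    moreover have "\<epsilon> / 2 < \<epsilon>" using e by simp
    ultimately show "\<exists>y\<in>Cbu. \<forall>m. cmod (x m - y m) < \<epsilon>" using le_less_trans by blast
  qed
  have "S = diagop x"
  proof (rule diagop_eqI[OF S Cbu_bounded[OF x]])
    fix f m assume f: "f \<in> fock"
    have "cmod (coef (S f) m - x m * coef f m) \<le> 0 + e" if e: "e > 0" for e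
    proof -
      \<comment> \<open>Adding 1 keeps the divisor positive when f = 0.\<close>
      define r where "r = fnorm f + 1"
      have r: "r > 0" by (simp add: r_def add_nonneg_pos)
      define \<epsilon> where "\<epsilon> = e / (2 * r)"
      have \<epsilon>: "\<epsilon> > 0" using e r by (simp add: \<epsilon>_def)
      obtain y where y: "y \<in> Cbu" "\<forall>f\<in>fock. \<forall>m. cmod (coef (S f) m - y m * coef f m) \<le> \<epsilon> * fnorm f"
        using near[OF \<epsilon>] by blast
      have "coef (S f) m - x m * coef f m = (coef (S f) m - y m * coef f m) - (x m - y m) * coef f m"
        by (simp add: algebra_simps)
      then have "cmod (coef (S f) m - x m * coef f m) \<le> cmod (coef (S f) m - y m * coef f m) + cmod (x m - y m) * cmod (coef f m)"
        by (metis norm_mult norm_triangle_ineq4)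
      also have "\<dots> \<le> \<epsilon> * fnorm f + \<epsilon> * fnorm f"
        using y f xy[OF y(2), of m] coef_bound[OF f, of m] \<epsilon> by (intro add_mono mult_mono) auto
      also have "\<dots> \<le> 2 * \<epsilon> * r" using \<epsilon> by (simp add: r_def algebra_simps)
      also have "\<dots> = e" using r by (simp add: \<epsilon>_def)
      finally show ?thesis by simp
    qed
    then have "cmod (coef (S f) m - x m * coef f m) \<le> 0" by (rule field_le_epsilon)
    then show "coef (S f) m = x m * coef f m" by simp
  qed
  then show "S \<in> diagop ` Cbu" using x by blast
qed

text \<open>The map \<open>diagop\<close> respects sums, products and scalars, and its operator norm
  is at most the supremum norm, so closure properties of A pull back to sequences.\<close>

lemma gamma_algebra_cstar:
  assumes A: "cstar_closed A" "toeplitz ` radial_Linf \<subseteq> A"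
  shows "gamma_algebra {x. bounded (range x) \<and> diagop x \<in> A}"
proof
  have add: "\<And>S T. S \<in> A \<Longrightarrow> T \<in> A \<Longrightarrow> op_add S T \<in> A" and comp: "\<And>S T. S \<in> A \<Longrightarrow> T \<in> A \<Longrightarrow> op_comp S T \<in> A"
    and scale: "\<And>S c. S \<in> A \<Longrightarrow> op_scale c S \<in> A" and adj: "\<And>S. S \<in> A \<Longrightarrow> \<exists>T\<in>A. is_adjoint S T"
    and bops: "A \<subseteq> bops"
    and lim: "\<And>S. S \<in> bops \<Longrightarrow> (\<And>\<epsilon>. \<epsilon> > 0 \<Longrightarrow> \<exists>T\<in>A. \<forall>f\<in>fock. fnorm (\<lambda>z. S f z - T f z) \<le> \<epsilon> * fnorm f) \<Longrightarrow> S \<in> A"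
    using A(1) unfolding cstar_closed_def by blast+
  {
    fix a :: "real \<Rightarrow> complex" assume a: "a \<in> borel_measurable borel" "bounded (range a)"
    obtain B where "\<And>t. cmod (a t) \<le> B" using a(2) bounded_rangeE by blast
    then have "bounded (range (gam a))" by (intro bounded_rangeI gam_bound)
    moreover have "diagop (gam a) \<in> A" using toeplitz_radial[OF a] A(2) by (metis image_subset_iff)
    ultimately show "gam a \<in> {x. bounded (range x) \<and> diagop x \<in> A}" by simp
  }
  {
    fix x :: "nat \<Rightarrow> complex"
    assume x: "\<And>\<epsilon>. \<epsilon> > 0 \<Longrightarrow> \<exists>y\<in>{x. bounded (range x) \<and> diagop x \<in> A}. \<forall>m. cmod (x m - y m) < \<epsilon>"
    obtain y where "bounded (range y)" "\<And>m. cmod (x m - y m) < 1" using x[of 1] by auto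
    then have xb: "bounded (range x)" by (rule bounded_range_limit)
    have "diagop x \<in> A"
    proof (rule lim[OF diagop_bops[OF xb]])
      fix \<epsilon> :: real assume "\<epsilon> > 0"
      then obtain y where y: "bounded (range y)" "diagop y \<in> A" "\<And>m. cmod (x m - y m) < \<epsilon>" using x by blast
      have "fnorm (\<lambda>z. diagop x f z - diagop y f z) \<le> \<epsilon> * fnorm f" if f: "f \<in> fock" for f
      proof -
        have le: "\<And>m. cmod (x m - y m) \<le> \<epsilon>" using y(3) less_imp_le by blast
        have "(\<lambda>z. diagop x f z - diagop y f z) = diagop (\<lambda>m. x m - y m) f"
          by (rule fock_eqI)
            (simp_all add: fock_diff diagop_fock[OF xb f] diagop_fock[OF y(1) f] diagop_bound(1,2)[OF le f] coef_diff left_diff_distrib)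
        then show ?thesis using diagop_bound(3)[OF le f] by simp
      qed
      then show "\<exists>T\<in>A. \<forall>f\<in>fock. fnorm (\<lambda>z. diagop x f z - T f z) \<le> \<epsilon> * fnorm f" using y(2) by blast
    qed
    then show "x \<in> {x. bounded (range x) \<and> diagop x \<in> A}" using xb by simp
  }
  fix x y c
  assume "x \<in> {x. bounded (range x) \<and> diagop x \<in> A}"
  then have x: "bounded (range x)" "diagop x \<in> A" by auto
  show "(\<lambda>m. c * x m) \<in> {x. bounded (range x) \<and> diagop x \<in> A}"
    using scale[OF x(2), of c] bounded_range_scale[OF x(1)] by (simp add: op_scale_diagop[OF x(1)])
  obtain T where T: "T \<in> A" "is_adjoint (diagop x) T" using adj[OF x(2)] by blast
  then have "T = diagop (\<lambda>m. cnj (x m))" using is_adjoint_diagop_unique[OF x(1)] bops by blast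
  then show "(\<lambda>m. cnj (x m)) \<in> {x. bounded (range x) \<and> diagop x \<in> A}"
    using T(1) bounded_range_cnj[OF x(1)] by simp
  assume "y \<in> {x. bounded (range x) \<and> diagop x \<in> A}"
  then have y: "bounded (range y)" "diagop y \<in> A" by auto
  show "(\<lambda>m. x m + y m) \<in> {x. bounded (range x) \<and> diagop x \<in> A}"
    using add[OF x(2) y(2)] bounded_range_add[OF x(1) y(1)] by (simp add: op_add_diagop[OF x(1) y(1)])
  show "(\<lambda>m. x m * y m) \<in> {x. bounded (range x) \<and> diagop x \<in> A}"
    using comp[OF x(2) y(2)] bounded_range_mult[OF x(1) y(1)] by (simp add: op_comp_diagop[OF x(1) y(1)])
qed

text \<open>The image of \<open>Cbu\<close> under \<open>diagop\<close> is one of the algebras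
  intersected, and every one of them contains it by the approximation theorem.\<close>

lemma T_rad_eq: "T_rad = diagop ` Cbu"
proof
  have "toeplitz ` radial_Linf \<subseteq> diagop ` Cbu"
  proof
    fix S assume "S \<in> toeplitz ` radial_Linf"
    then obtain a where "a \<in> radial_Linf" "S = toeplitz a" by blast
    then show "S \<in> diagop ` Cbu"
      using radial_Linf_toeplitz gam_in_Wseq Wseq_subset_Cbu by (metis image_eqI subsetD)
  qed
  then show "T_rad \<subseteq> diagop ` Cbu" unfolding T_rad_def using cstar_closed_Cbu by blast
  show "diagop ` Cbu \<subseteq> T_rad"
    unfolding T_rad_def using gamma_algebra.Cbu_subset[OF gamma_algebra_cstar] by blast
qed

lemma star_iso_Gamma: "star_iso Gamma_op"
  unfolding star_iso_def T_rad_eq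
proof (intro conjI ballI allI impI)
  show "bij_betw Gamma_op (diagop ` Cbu) Cbu"
    by (rule bij_betw_byWitness[where f' = diagop]) (auto simp: Gamma_diagop Cbu_bounded)
next
  fix S T assume "S \<in> diagop ` Cbu" "T \<in> diagop ` Cbu"
  then obtain x y where xy: "S = diagop x" "T = diagop y" "bounded (range x)" "bounded (range y)" using Cbu_bounded by blast
  show "Gamma_op (op_add S T) = (\<lambda>m. Gamma_op S m + Gamma_op T m)"
    using xy by (simp add: op_add_diagop Gamma_diagop bounded_range_add)
  show "Gamma_op (op_comp S T) = (\<lambda>m. Gamma_op S m * Gamma_op T m)"
    using xy by (simp add: op_comp_diagop Gamma_diagop bounded_range_mult)
  assume "is_adjoint S T"
  then have "T = diagop (\<lambda>m. cnj (x m))"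
    using is_adjoint_diagop_unique[OF xy(3) diagop_bops[OF xy(4)]] xy(1,2) by simp
  then show "Gamma_op T = (\<lambda>m. cnj (Gamma_op S m))"
    using xy by (simp add: Gamma_diagop bounded_range_cnj)
next
  fix S c assume "S \<in> diagop ` Cbu"
  then obtain x where "S = diagop x" "bounded (range x)" using Cbu_bounded by blast
  then show "Gamma_op (op_scale c S) = (\<lambda>m. c * Gamma_op S m)"
    by (simp add: op_scale_diagop Gamma_diagop bounded_range_scale)
qed

theorem theorem5p7:
  shows "(\<forall>x. x \<in> Cbu \<longleftrightarrow> (\<forall>\<epsilon>>0. \<exists>y\<in>d_Delta. \<forall>m. cmod (x m - y m) < \<epsilon>))
         \<and> (\<exists>\<Phi>. star_iso \<Phi>)"
proof
  show "\<forall>x. x \<in> Cbu \<longleftrightarrow> (\<forall>\<epsilon>>0. \<exists>y\<in>d_Delta. \<forall>m. cmod (x m - y m) < \<epsilon>)"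
    unfolding d_Delta_eq closure_Wseq[symmetric] seq_closure_def by simp
  show "\<exists>\<Phi>. star_iso \<Phi>" using star_iso_Gamma by blast
qed

end
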